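(* Let $\tilde{w}_0=s_{i_1}\cdots s_{i_N}$ be a reduced expression of $w_0$ adapted to a quiver $Q$ of type $ADE$. Let $\alpha=s_{i_1}s_{i_2}\cdots s_{i_{j-1}}(\alpha_{i_j})$ and $\beta=s_{i_1}s_{i_2}\cdots s_{i_{k-1}}(\alpha_{i_k})$ with $1\le j,k\le N$. Then $[\alpha]\to[\beta]$ is an arrow in the Auslander-Reiten quiver $\Gamma_Q$ if and only if (i) $i_j$ and $i_k$ are linked in the Dynkin diagram $D$; (ii) $j<k$; (iii) for $j<p<k$, $i_p\neq i_j$.
   Context: Let $D$ be a Dynkin diagram of type $ADE$ with vertex set $I=\{1,\dots,n\}$, $\Phi$ its root system, $\Phi^+$ the positive roots, $N=|\Phi^+|$, $\alpha_i$ the simple roots, $W$ the Weyl group with simple reflections $s_i$, and $w_0$ its longest element. A quiver $Q$ of type $ADE$ is an orientation of the edges of such a $D$. By Gabriel's theorem, isomorphism classes of indecomposable finite dimensional representations of $Q$ over $\mathbb{C}$ are in bijection with $\Phi^+$ via the dimension vector $\dim M=\sum_i(\dim V_i)\alpha_i$; $[\beta]$ denotes the class with dimension vector $\beta$. The Auslander-Reiten quiver $\Gamma_Q$ has these classes as vertices, with an arrow $[\alpha]\to[\beta]$ iff there is an irreducible morphism from the indecomposable of class $[\alpha]$ to that of class $[\beta]$ (a morphism that is neither a split monomorphism nor a split epimorphism, and such that in any factorization $f=gh$ either $h$ is a split monomorphism or $g$ is a split epimorphism). A vertex $k$ is a sink of $Q$ if all arrows incident to $k$ enter $k$; then $S_kQ$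 is obtained from $Q$ by reversing all arrows ending at $k$. A reduced expression $s_{i_1}\cdots s_{i_N}$ of $w_0$ is adapted to $Q$ if $i_1$ is a sink of $Q$, $i_2$ a sink of $S_{i_1}Q$, $i_3$ a sink of $S_{i_2}S_{i_1}Q$, and so on. *)

theory Defs
  imports Jordan_Normal_Form.Matrix
begin

section \<open>Dynkin diagrams of type ADE\<close>

text \<open>A diagram on the vertex set \<open>{1..n}\<close> is given by its set of edges, an edge being a
  two-element set of vertices.  The standard diagrams carry the Bourbaki numbering; a Dynkin
  diagram of type ADE may number its vertices in any other way.\<close>

definition edges_A :: "nat \<Rightarrow> nat set set" where
  "edges_A n = {{i, i + 1} | i. 1 \<le> i \<and> i < n}"

definition edges_D :: "nat \<Rightarrow> nat set set" where
  "edges_D n = {{i, i + 1} | i. 1 \<le> i \<and> i < n - 1} \<union> {{n - 2, n}}"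

definition edges_E :: "nat \<Rightarrow> nat set set" where
  "edges_E n = {{1, 3}, {2, 4}, {3, 4}} \<union> {{i, i + 1} | i. 4 \<le> i \<and> i < n}"

definition standard_ade :: "nat \<Rightarrow> nat set set \<Rightarrow> bool" where
  "standard_ade n E \<longleftrightarrow>
     (1 \<le> n \<and> E = edges_A n) \<or> (4 \<le> n \<and> E = edges_D n) \<or> (n \<in> {6, 7, 8} \<and> E = edges_E n)"

definition ade_diagram :: "nat \<Rightarrow> nat set set \<Rightarrow> bool" where
  "ade_diagram n D \<longleftrightarrow>
     (\<exists>E \<pi>. standard_ade n E \<and> bij_betw \<pi> {1..n} {1..n} \<and> D = (\<lambda>e. \<pi> ` e) ` E)"

definition linked :: "nat set set \<Rightarrow> nat \<Rightarrow> nat \<Rightarrow> bool" where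
  "linked D i j \<longleftrightarrow> {i, j} \<in> D"


section \<open>Root system and Weyl group\<close>

text \<open>Elements of the root lattice are coordinate functions with respect to the simple roots;
  the coordinates outside \<open>{1..n}\<close> play no role.\<close>

type_synonym lattice = "nat \<Rightarrow> int"

definition simple_root :: "nat \<Rightarrow> lattice" where
  "simple_root i = (\<lambda>j. if j = i then 1 else 0)"

definition cartan :: "nat set set \<Rightarrow> nat \<Rightarrow> nat \<Rightarrow> int" where
  "cartan D i j = (if i = j then 2 else if linked D i j then - 1 else 0)"

definition simple_reflection :: "nat \<Rightarrow> nat set set \<Rightarrow> nat \<Rightarrow> lattice \<Rightarrow> lattice" where
  "simple_reflection n D i v =
     (\<lambda>j. v j - (\<Sum>l = 1..n. cartan D i l * v l) * simple_root i j)"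

text \<open>The composition \<open>s\<^sub>i\<^sub>1 \<circ> s\<^sub>i\<^sub>2 \<circ> \<dots>\<close>: the last letter acts first.\<close>

definition word_product :: "nat \<Rightarrow> nat set set \<Rightarrow> nat list \<Rightarrow> lattice \<Rightarrow> lattice" where
  "word_product n D is = foldr (\<circ>) (map (simple_reflection n D) is) id"

definition weyl_group :: "nat \<Rightarrow> nat set set \<Rightarrow> (lattice \<Rightarrow> lattice) set" where
  "weyl_group n D = {word_product n D is | is. set is \<subseteq> {1..n}}"

definition roots :: "nat \<Rightarrow> nat set set \<Rightarrow> lattice set" where
  "roots n D = {w (simple_root i) | w i. w \<in> weyl_group n D \<and> i \<in> {1..n}}"

definition positive_roots :: "nat \<Rightarrow> nat set set \<Rightarrow> lattice set" where
  "positive_roots n D = {\<beta> \<in> roots n D. \<forall>i. 0 \<le> \<beta> i}"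

definition weyl_length :: "nat \<Rightarrow> nat set set \<Rightarrow> (lattice \<Rightarrow> lattice) \<Rightarrow> nat" where
  "weyl_length n D w =
     (LEAST l. \<exists>is. set is \<subseteq> {1..n} \<and> length is = l \<and> word_product n D is = w)"

definition longest_element :: "nat \<Rightarrow> nat set set \<Rightarrow> (lattice \<Rightarrow> lattice) \<Rightarrow> bool" where
  "longest_element n D w \<longleftrightarrow>
     w \<in> weyl_group n D \<and> (\<forall>u \<in> weyl_group n D. weyl_length n D u \<le> weyl_length n D w)"

definition reduced_expression ::
  "nat \<Rightarrow> nat set set \<Rightarrow> nat list \<Rightarrow> (lattice \<Rightarrow> lattice) \<Rightarrow> bool" where
  "reduced_expression n D is w \<longleftrightarrow>
     set is \<subseteq> {1..n} \<and> word_product n D is = w \<and> length is = weyl_length n D w"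


section \<open>Quivers and adapted words\<close>

text \<open>A quiver with vertex set \<open>{1..n}\<close> is given by its set of arrows; \<open>(s, t)\<close> is an arrow
  from \<open>s\<close> to \<open>t\<close>.  Orientations of a simple graph have no multiple arrows.\<close>

type_synonym quiver = "(nat \<times> nat) set"

definition orientation :: "nat set set \<Rightarrow> quiver \<Rightarrow> bool" where
  "orientation D Q \<longleftrightarrow>
     (\<forall>s t. (s, t) \<in> Q \<longrightarrow> linked D s t) \<and>
     (\<forall>s t. linked D s t \<longrightarrow> ((s, t) \<in> Q \<longleftrightarrow> (t, s) \<notin> Q))"

definition sink :: "nat \<Rightarrow> quiver \<Rightarrow> nat \<Rightarrow> bool" where
  "sink n Q k \<longleftrightarrow> k \<in> {1..n} \<and> (\<forall>(s, t) \<in> Q. s = k \<or> t = k \<longrightarrow> t = k)"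

definition reverse_at :: "nat \<Rightarrow> quiver \<Rightarrow> quiver" where
  "reverse_at k Q = {(s, t) \<in> Q. t \<noteq> k} \<union> {(k, s) | s. (s, k) \<in> Q}"

fun adapted :: "nat \<Rightarrow> quiver \<Rightarrow> nat list \<Rightarrow> bool" where
  "adapted n Q [] \<longleftrightarrow> True"
| "adapted n Q (i # is) \<longleftrightarrow> sink n Q i \<and> adapted n (reverse_at i Q) is"


section \<open>Finite dimensional complex representations\<close>

text \<open>The space at vertex \<open>i\<close> is \<open>\<complex>\<close> to the power \<open>rdim M i\<close>, and linear maps are matrices
  acting on column vectors.  Every finite dimensional representation is isomorphic to one of
  this form.  Only values at vertices and arrows of the quiver are meaningful.\<close>

record qrep =
  rdim :: "nat \<Rightarrow> nat"
  rmap :: "nat \<times> nat \<Rightarrow> complex mat"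

definition representation :: "quiver \<Rightarrow> qrep \<Rightarrow> bool" where
  "representation Q M \<longleftrightarrow> (\<forall>(s, t) \<in> Q. rmap M (s, t) \<in> carrier_mat (rdim M t) (rdim M s))"

definition dimension_vector :: "nat \<Rightarrow> qrep \<Rightarrow> lattice" where
  "dimension_vector n M = (\<lambda>j. \<Sum>i = 1..n. int (rdim M i) * simple_root i j)"

type_synonym qmor = "nat \<Rightarrow> complex mat"

definition morphism :: "nat \<Rightarrow> quiver \<Rightarrow> qrep \<Rightarrow> qrep \<Rightarrow> qmor \<Rightarrow> bool" where
  "morphism n Q M N f \<longleftrightarrow>
     (\<forall>i \<in> {1..n}. f i \<in> carrier_mat (rdim N i) (rdim M i)) \<and>
     (\<forall>(s, t) \<in> Q. f t * rmap M (s, t) = rmap N (s, t) * f s)"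

definition mor_comp :: "qmor \<Rightarrow> qmor \<Rightarrow> qmor" where
  "mor_comp g f = (\<lambda>i. g i * f i)"

definition mor_id :: "qrep \<Rightarrow> qmor" where
  "mor_id M = (\<lambda>i. 1\<^sub>m (rdim M i))"

definition mor_eq :: "nat \<Rightarrow> qmor \<Rightarrow> qmor \<Rightarrow> bool" where
  "mor_eq n f g \<longleftrightarrow> (\<forall>i \<in> {1..n}. f i = g i)"

definition split_mono :: "nat \<Rightarrow> quiver \<Rightarrow> qrep \<Rightarrow> qrep \<Rightarrow> qmor \<Rightarrow> bool" where
  "split_mono n Q M N f \<longleftrightarrow>
     morphism n Q M N f \<and> (\<exists>r. morphism n Q N M r \<and> mor_eq n (mor_comp r f) (mor_id M))"

definition split_epi :: "nat \<Rightarrow> quiver \<Rightarrow> qrep \<Rightarrow> qrep \<Rightarrow> qmor \<Rightarrow> bool" where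
  "split_epi n Q M N f \<longleftrightarrow>
     morphism n Q M N f \<and> (\<exists>r. morphism n Q N M r \<and> mor_eq n (mor_comp f r) (mor_id N))"

definition isomorphic :: "nat \<Rightarrow> quiver \<Rightarrow> qrep \<Rightarrow> qrep \<Rightarrow> bool" where
  "isomorphic n Q M N \<longleftrightarrow>
     (\<exists>f g. morphism n Q M N f \<and> morphism n Q N M g \<and>
        mor_eq n (mor_comp g f) (mor_id M) \<and> mor_eq n (mor_comp f g) (mor_id N))"

definition direct_sum :: "qrep \<Rightarrow> qrep \<Rightarrow> qrep" where
  "direct_sum M N =
     \<lparr>rdim = (\<lambda>i. rdim M i + rdim N i),
      rmap = (\<lambda>(s, t). four_block_mat
                (rmap M (s, t)) (0\<^sub>m (rdim M t) (rdim N s))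
                (0\<^sub>m (rdim N t) (rdim M s)) (rmap N (s, t)))\<rparr>"

definition zero_rep :: "nat \<Rightarrow> qrep \<Rightarrow> bool" where
  "zero_rep n M \<longleftrightarrow> (\<forall>i \<in> {1..n}. rdim M i = 0)"

definition indecomposable :: "nat \<Rightarrow> quiver \<Rightarrow> qrep \<Rightarrow> bool" where
  "indecomposable n Q M \<longleftrightarrow>
     representation Q M \<and> \<not> zero_rep n M \<and>
     (\<forall>M1 M2. representation Q M1 \<and> representation Q M2 \<and> isomorphic n Q M (direct_sum M1 M2)
        \<longrightarrow> zero_rep n M1 \<or> zero_rep n M2)"

definition irreducible_morphism :: "nat \<Rightarrow> quiver \<Rightarrow> qrep \<Rightarrow> qrep \<Rightarrow> qmor \<Rightarrow> bool" where
  "irreducible_morphism n Q M N f \<longleftrightarrow>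
     morphism n Q M N f \<and> \<not> split_mono n Q M N f \<and> \<not> split_epi n Q M N f \<and>
     (\<forall>L h g. representation Q L \<and> morphism n Q M L h \<and> morphism n Q L N g \<and>
        mor_eq n f (mor_comp g h) \<longrightarrow> split_mono n Q M L h \<or> split_epi n Q L N g)"


section \<open>The Auslander-Reiten quiver\<close>

definition iso_class :: "nat \<Rightarrow> quiver \<Rightarrow> qrep \<Rightarrow> qrep set" where
  "iso_class n Q M = {N. representation Q N \<and> isomorphic n Q M N}"

definition ar_vertices :: "nat \<Rightarrow> quiver \<Rightarrow> qrep set set" where
  "ar_vertices n Q = {iso_class n Q M | M. indecomposable n Q M}"

definition ar_arrows :: "nat \<Rightarrow> quiver \<Rightarrow> (qrep set \<times> qrep set) set" where
  "ar_arrows n Q = {(X, Y). X \<in> ar_vertices n Q \<and> Y \<in> ar_vertices n Q \<and>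
     (\<exists>M \<in> X. \<exists>N \<in> Y. \<exists>f. irreducible_morphism n Q M N f)}"

text \<open>The class of indecomposables with dimension vector \<open>\<beta>\<close>.  By Gabriel's theorem the
  description is satisfied by exactly one class when \<open>\<beta>\<close> is a positive root.\<close>

definition root_class :: "nat \<Rightarrow> quiver \<Rightarrow> lattice \<Rightarrow> qrep set" where
  "root_class n Q \<beta> = (THE X. X \<in> ar_vertices n Q \<and> (\<forall>M \<in> X. dimension_vector n M = \<beta>))"

end

theory Submission
  imports Defs
begin

text \<open>The reflection at the first letter \<open>a\<close> of the word is an equivalence, away from the simple
  projective representation \<open>S\<close> at the sink \<open>a\<close>, between the representations of \<open>Q\<close> and those of
  \<open>S\<^sub>a Q\<close>.  It preserves irreducible morphisms and removes the first letter, so only the arrows into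
  and out of \<open>[\<alpha>\<^sub>a]\<close> remain.  Nothing but \<open>S\<close> maps nontrivially to \<open>S\<close>.  A morphism from \<open>S\<close> to an
  indecomposable \<open>N \<noteq> S\<close> is a vector of \<open>N a\<close>; this vector is a sum of images of vectors of \<open>N b\<close> for
  neighbours \<open>b\<close> of \<open>a\<close>, and these are reached through the projective covers of the simples at \<open>b\<close>.
  Hence \<open>S \<longrightarrow> N\<close> is irreducible for some morphism iff \<open>N\<close> is one of these projective covers, which are
  the representations belonging to the first occurrences of the letters \<open>b\<close>.

  The same reflections construct, for each letter of the word, the indecomposable with the prescribed
  dimension vector, show that its endomorphisms are scalars and that it is unique.  The construction
  could only break down at a step where the representation is the simple one that the reflection
  annihilates, and then two letters of the word could be cancelled.  Neither Gabriel's theorem nor the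
  classification of the root systems is used.\<close>

section \<open>Exact pairs of matrices\<close>

text \<open>The obstacle is the middle term of a factorization. It is an arbitrary representation
  and may have \<open>S\<close> as a summand, so the equivalence does not reach it. Reflection is
  therefore a relation of two strengths. \<open>refl_exact\<close> asks only for exactness in the
  middle: every representation has such a partner, and morphisms can be carried across in both
  directions, though not uniquely. \<open>reflected\<close> adds surjectivity at the sink and
  injectivity at the new source, which makes the carried morphism unique. Identities between
  composites are then checked away from the sink alone, provided that the two ends are
  \<open>reflected\<close>.

  Radicals are replaced by bricks, the representations with only scalar endomorphisms. Two morphisms
  in opposite directions between non-isomorphic bricks compose to zero, so membership in the square
  of the radical can be certified by vanishing composites, without decomposing the middle term.
  Scalars also turn an endomorphism that fixes one nonzero vector into the identity, which is how a
  splitting is recognised.\<close>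

lemma mult_assoc_dim:
  fixes A B C :: "'a::semiring_0 mat"
  assumes "dim_col A = dim_row B" "dim_col B = dim_row C"
  shows "(A * B) * C = A * (B * C)"
  using assms by (intro assoc_mult_mat[of A "dim_row A" "dim_row B" B "dim_row C" C "dim_col C"]) auto

lemma mult_add_dim:
  fixes A B C :: "'a::semiring_0 mat"
  assumes "dim_col A = dim_row B" "dim_row B = dim_row C" "dim_col B = dim_col C"
  shows "A * (B + C) = A * B + A * C"
  using assms by (intro mult_add_distrib_mat[of A "dim_row A" "dim_row C" B "dim_col C" C]) auto

lemma add_mult_dim:
  fixes A B C :: "'a::semiring_0 mat"
  assumes "dim_row A = dim_row B" "dim_col A = dim_col B" "dim_col A = dim_row C"
  shows "(A + B) * C = A * C + B * C"
  using assms by (intro add_mult_distrib_mat[of A "dim_row B" "dim_row C" B C "dim_col C"]) auto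

lemma mult_smult_dim:
  fixes A B :: "'a::comm_semiring_0 mat"
  assumes "dim_col A = dim_row B"
  shows "A * (c \<cdot>\<^sub>m B) = c \<cdot>\<^sub>m (A * B)"
  using assms by (intro mult_smult_distrib[of A "dim_row A" "dim_row B" B "dim_col B"]) auto

lemma smult_mult_dim:
  fixes A B :: "'a::comm_semiring_0 mat"
  assumes "dim_col A = dim_row B"
  shows "(c \<cdot>\<^sub>m A) * B = c \<cdot>\<^sub>m (A * B)"
  using assms by (intro mult_smult_assoc_mat[of A "dim_row A" "dim_row B" B "dim_col B"]) auto

lemma add_zero_dim:
  fixes A :: "'a::monoid_add mat"
  assumes "dim_row A = m" "dim_col A = k"
  shows "A + 0\<^sub>m m k = A" "0\<^sub>m m k + A = A"
  using assms by auto

text \<open>Products are normalised by bracketing to the right, so a known product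
  \<open>A * B\<close> is met only in the shape \<open>A * (B * C)\<close>; this is the rewrite for
  that shape.\<close>

lemma mult_cancel_assoc:
  fixes A B C :: "'a::semiring_0 mat"
  assumes "A * B = D" "dim_col A = dim_row B" "dim_col B = dim_row C"
  shows "A * (B * C) = D * C"
  using mult_assoc_dim[OF assms(2,3)] assms(1) by simp

lemma mat_eq_no_rows:
  fixes A B :: "'a mat"
  assumes "dim_row A = 0" "dim_row B = 0" "dim_col A = dim_col B"
  shows "A = B"
  using assms by (intro eq_matI) auto

lemma mat_eq_no_cols:
  fixes A B :: "'a mat"
  assumes "dim_col A = 0" "dim_col B = 0" "dim_row A = dim_row B"
  shows "A = B"
  using assms by (intro eq_matI) auto

lemma index_mult_sum:
  assumes "i < dim_row A" "j < dim_col B" "dim_col A = dim_row B"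
  shows "(A * B) $$ (i, j) = (\<Sum>l<dim_row B. A $$ (i, l) * B $$ (l, j))"
  using assms by (simp add: scalar_prod_def lessThan_atLeast0)

lemma zero_smult_mat: "(0::'a::mult_zero) \<cdot>\<^sub>m A = 0\<^sub>m (dim_row A) (dim_col A)"
  by (intro eq_matI) auto

lemma smult_smult_mat: "a \<cdot>\<^sub>m (b \<cdot>\<^sub>m A) = (a * b :: 'a::semigroup_mult) \<cdot>\<^sub>m A"
  by (intro eq_matI) (auto simp: mult.assoc)

lemma one_smult_mat: "(1::'a::monoid_mult) \<cdot>\<^sub>m A = A"
  by (intro eq_matI) auto

text \<open>Over a field exactness in the middle amounts to a contracting homotopy; in this form kernels
  and cokernels can be handled by matrix identities alone.\<close>

definition exact_pair :: "'a::field mat \<Rightarrow> 'a mat \<Rightarrow> bool" where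
  "exact_pair A B \<longleftrightarrow> dim_col A = dim_row B \<and> A * B = 0\<^sub>m (dim_row A) (dim_col B) \<and>
     (\<exists>G H. G \<in> carrier_mat (dim_col A) (dim_row A) \<and> H \<in> carrier_mat (dim_col B) (dim_row B) \<and>
        G * A + B * H = 1\<^sub>m (dim_col A))"

definition left_invertible :: "'a::field mat \<Rightarrow> bool" where
  "left_invertible B \<longleftrightarrow> (\<exists>H \<in> carrier_mat (dim_col B) (dim_row B). H * B = 1\<^sub>m (dim_col B))"

definition right_invertible :: "'a::field mat \<Rightarrow> bool" where
  "right_invertible A \<longleftrightarrow> (\<exists>G \<in> carrier_mat (dim_col A) (dim_row A). A * G = 1\<^sub>m (dim_row A))"

text \<open>The inner conditional is the increasing embedding that omits \<open>j\<close>; an index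
  \<open>k\<close> has a preimage exactly when it differs from \<open>j\<close>, namely
  \<open>k\<close> below \<open>j\<close> and \<open>k - 1\<close> above.\<close>

lemma sum_skip_delta:
  fixes f :: "nat \<Rightarrow> 'a::semiring_1"
  assumes "j < t" "k < t"
  shows "(\<Sum>i<t - 1. f i * (if k = (if i < j then i else Suc i) then 1 else 0)) =
    (if k = j then 0 else f (if k < j then k else k - 1))"
proof (cases "k = j")
  case True
  then show ?thesis by (auto intro!: sum.neutral)
next
  case False
  have "(\<Sum>i<t - 1. f i * (if k = (if i < j then i else Suc i) then 1 else 0)) =
    (\<Sum>i<t - 1. if i = (if k < j then k else k - 1) then f i else 0)"
    using False by (intro sum.cong) (auto split: if_splits)
  also have "\<dots> = f (if k < j then k else k - 1)"
    using assms False by (subst sum.delta) auto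
  finally show ?thesis using False by simp
qed

text \<open>Elimination of the column \<open>j\<close> of \<open>A\<close> with the pivot \<open>A $$ (i, j)\<close>: \<open>D\<close> forgets the
  \<open>j\<close>-th coordinate and \<open>B\<close> parametrises the kernel of the \<open>i\<close>-th row.\<close>

lemma pivot_step:
  fixes A :: "'a::field mat"
  assumes A: "A \<in> carrier_mat m t" and ij: "i < m" "j < t" and nz: "A $$ (i, j) \<noteq> 0"
  obtains B D P where "B \<in> carrier_mat t (t - 1)" "D \<in> carrier_mat (t - 1) t" "P \<in> carrier_mat t m"
    "P * A + B * D = 1\<^sub>m t" "D * B = 1\<^sub>m (t - 1)"
proof -
  define \<sigma> where "\<sigma> l = (if l < j then l else Suc l)" for l
  define D :: "'a mat" where "D = mat (t - 1) t (\<lambda>(l, k). if k = \<sigma> l then 1 else 0)"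
  define B where "B = mat t (t - 1)
    (\<lambda>(k, l). if k = j then - A $$ (i, \<sigma> l) / A $$ (i, j) else if k = \<sigma> l then 1 else 0)"
  \<comment> \<open>The single entry of \<open>P\<close> makes \<open>P * A\<close> the pivot row
    divided by the pivot, placed in row \<open>j\<close>. It cancels the row that \<open>B\<close>
    contributes there and leaves the diagonal entry 1.\<close>
  define P where "P = mat t m (\<lambda>(k, l). if l = i then (if k = j then 1 / A $$ (i, j) else 0) else 0)"
  have \<sigma>: "\<sigma> l < t" "\<sigma> l \<noteq> j" if "l < t - 1" for l using that by (auto simp: \<sigma>_def)
  have [simp]: "\<sigma> x = \<sigma> y \<longleftrightarrow> x = y" for x y by (auto simp: \<sigma>_def)
  have "D * B = 1\<^sub>m (t - 1)"
  proof (intro eq_matI)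
    fix x y assume xy: "x < dim_row (1\<^sub>m (t - 1) :: 'a mat)" "y < dim_col (1\<^sub>m (t - 1) :: 'a mat)"
    have "(D * B) $$ (x, y) = (\<Sum>l<t. D $$ (x, l) * B $$ (l, y))"
      using xy by (subst index_mult_sum) (auto simp: D_def B_def)
    also have "\<dots> = (\<Sum>l<t. if l = \<sigma> x then B $$ (l, y) else 0)"
      using xy by (intro sum.cong) (auto simp: D_def)
    also have "\<dots> = B $$ (\<sigma> x, y)" using \<sigma> xy by simp
    also have "\<dots> = 1\<^sub>m (t - 1) $$ (x, y)"
      using \<sigma>[of x] xy by (auto simp: B_def)
    finally show "(D * B) $$ (x, y) = 1\<^sub>m (t - 1) $$ (x, y)" .
  qed (auto simp: D_def B_def)
  moreover have "P * A + B * D = 1\<^sub>m t"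
  proof (intro eq_matI)
    fix x y assume xy: "x < dim_row (1\<^sub>m t :: 'a mat)" "y < dim_col (1\<^sub>m t :: 'a mat)"
    have "(P * A) $$ (x, y) = (\<Sum>l<m. P $$ (x, l) * A $$ (l, y))"
      using xy A by (subst index_mult_sum) (auto simp: P_def)
    also have "\<dots> = (\<Sum>l<m. if l = i then (if x = j then A $$ (i, y) / A $$ (i, j) else 0) else 0)"
      using xy by (intro sum.cong) (auto simp: P_def)
    finally have PA: "(P * A) $$ (x, y) = (if x = j then A $$ (i, y) / A $$ (i, j) else 0)"
      using ij by simp
    have "(B * D) $$ (x, y) = (\<Sum>l<t - 1. B $$ (x, l) * D $$ (l, y))"
      using xy by (subst index_mult_sum) (auto simp: D_def B_def)
    also have "\<dots> = (\<Sum>l<t - 1. B $$ (x, l) * (if y = (if l < j then l else Suc l) then 1 else 0))"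
      using xy by (intro sum.cong) (auto simp: D_def \<sigma>_def)
    also have "\<dots> = (if y = j then 0 else B $$ (x, if y < j then y else y - 1))"
      using xy ij by (subst sum_skip_delta) auto
    finally have BD: "(B * D) $$ (x, y) = (if y = j then 0 else B $$ (x, if y < j then y else y - 1))" .
    have *: "y \<noteq> j \<Longrightarrow> \<sigma> (if y < j then y else y - 1) = y" by (auto simp: \<sigma>_def)
    have **: "y \<noteq> j \<Longrightarrow> (if y < j then y else y - 1) < t - 1" using xy ij by auto
    have B': "B $$ (x, if y < j then y else y - 1) =
      (if x = j then - A $$ (i, y) / A $$ (i, j) else if x = y then 1 else 0)" if "y \<noteq> j"
      unfolding B_def using xy * ** that by (subst index_mat) auto
    have "(P * A + B * D) $$ (x, y) = (P * A) $$ (x, y) + (B * D) $$ (x, y)"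
      using xy A by (intro index_add_mat) (auto simp: B_def D_def)
    also have "\<dots> = 1\<^sub>m t $$ (x, y)"
      unfolding PA BD using xy B' nz by auto
    finally show "(P * A + B * D) $$ (x, y) = 1\<^sub>m t $$ (x, y)" .
  qed (use A in \<open>auto simp: D_def B_def P_def\<close>)
  ultimately show thesis by (intro that[of B D P]) (auto simp: B_def D_def P_def)
qed

text \<open>Gaussian elimination as an induction on the number of columns: the kernel of one nonzero
  row is parametrised by \<open>B\<close>, the kernel of \<open>A * B\<close> has one column fewer
  to deal with, and the two parametrisations are composed.\<close>

lemma ex_kernel_data:
  fixes A :: "'a::field mat"
  assumes "A \<in> carrier_mat m t"
  shows "\<exists>k B G H. B \<in> carrier_mat t k \<and> G \<in> carrier_mat t m \<and> H \<in> carrier_mat k t \<and>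
    A * B = 0\<^sub>m m k \<and> G * A + B * H = 1\<^sub>m t \<and> H * B = 1\<^sub>m k"
  using assms
proof (induction t arbitrary: A)
  case 0
  then show ?case
    by (intro exI[of _ 0] exI[of _ "1\<^sub>m 0"] exI[of _ "0\<^sub>m 0 m"]) (auto intro!: mat_eq_no_cols)
next
  case (Suc t)
  note A = Suc.prems
  show ?case
  proof (cases "A = 0\<^sub>m m (Suc t)")
    case True
    then show ?thesis
      by (intro exI[of _ "Suc t"] exI[of _ "1\<^sub>m (Suc t)"] exI[of _ "0\<^sub>m (Suc t) m"]) auto
  next
    case False
    then obtain i j where ij: "i < m" "j < Suc t" "A $$ (i, j) \<noteq> 0"
      using A by (metis eq_matI carrier_matD index_zero_mat)
    obtain B D P where *: "B \<in> carrier_mat (Suc t) t" "D \<in> carrier_mat t (Suc t)"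
      "P \<in> carrier_mat (Suc t) m" and PA: "P * A + B * D = 1\<^sub>m (Suc t)" and DB: "D * B = 1\<^sub>m t"
      using pivot_step[OF A ij] by auto
    have "A * B \<in> carrier_mat m t" using A * by auto
    from Suc.IH[OF this] obtain k B' G' H' where
      **: "B' \<in> carrier_mat t k" "G' \<in> carrier_mat t m" "H' \<in> carrier_mat k t"
      and AB: "(A * B) * B' = 0\<^sub>m m k" and GA: "G' * (A * B) + B' * H' = 1\<^sub>m t"
      and HB: "H' * B' = 1\<^sub>m k" by blast
    \<comment> \<open>Since \<open>(1 - A * P) * A = A * (1 - P * A) = A * B * D\<close>, the second
      summand contributes \<open>B * G' * (A * B) * D\<close> to \<open>G * A\<close>. Together with
      \<open>B * B' * H' * D\<close> this is \<open>B * D\<close>, exactly what \<open>P * A\<close>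
      lacks to be the identity.\<close>
    define G where "G = P + B * (G' * (1\<^sub>m m + A * (- P)))"
    have PP: "(1\<^sub>m m + A * (- P)) * A = A * (B * D)"
    proof -
      have "A = A * (P * A + B * D)" using A PA by simp
      also have "\<dots> = A * (P * A) + A * (B * D)" using A * by (subst mult_add_dim) auto
      finally have e: "A = A * (P * A) + A * (B * D)" .
      have "(1\<^sub>m m + A * (- P)) * A = A + - (A * (P * A))"
        using A * by (subst add_mult_dim) (auto simp: mult_assoc_dim)
      also have "\<dots> = A * (B * D)"
      proof (intro eq_matI)
        fix i j assume *: "i < dim_row (A * (B * D))" "j < dim_col (A * (B * D))"
        have "A $$ (i,j) = (A * (P * A) + A * (B * D)) $$ (i,j)" using e by simp
        then show "(A + - (A * (P * A))) $$ (i, j) = (A * (B * D)) $$ (i, j)"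
          using * A \<open>D \<in> _\<close> by (simp add: algebra_simps)
      qed (use A * in auto)
      finally show ?thesis .
    qed
    have "G * A + (B * B') * (H' * D) = P * A + (B * (G' * ((A * B) * D)) + B * ((B' * H') * D))"
      unfolding G_def using A * ** PP
      by (subst add_mult_dim) (auto simp: mult_assoc_dim assoc_add_mat[of _ "Suc t" "Suc t"])
    also have "B * (G' * ((A * B) * D)) + B * ((B' * H') * D) = B * ((G' * (A * B) + B' * H') * D)"
      using A * ** by (simp add: mult_add_dim add_mult_dim mult_assoc_dim)
    also have "\<dots> = B * D" using GA * by simp
    finally have "G * A + (B * B') * (H' * D) = 1\<^sub>m (Suc t)" using PA by simp
    moreover have "A * (B * B') = 0\<^sub>m m k" using AB A * ** by (simp add: mult_assoc_dim)
    moreover have "(H' * D) * (B * B') = 1\<^sub>m k"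
      using * ** DB HB by (simp add: mult_assoc_dim mult_cancel_assoc[OF DB])
    moreover have "G \<in> carrier_mat (Suc t) m" unfolding G_def using A * ** by auto
    moreover have "B * B' \<in> carrier_mat (Suc t) k" "H' * D \<in> carrier_mat k (Suc t)"
      using * ** by auto
    ultimately show ?thesis by blast
  qed
qed

lemma ex_kernel:
  fixes A :: "'a::field mat"
  obtains B where "exact_pair A B" "left_invertible B"
proof -
  have "A \<in> carrier_mat (dim_row A) (dim_col A)" by auto
  from ex_kernel_data[OF this] obtain k B G H where
    "B \<in> carrier_mat (dim_col A) k" "G \<in> carrier_mat (dim_col A) (dim_row A)"
    "H \<in> carrier_mat k (dim_col A)" "A * B = 0\<^sub>m (dim_row A) k" "G * A + B * H = 1\<^sub>m (dim_col A)"
    "H * B = 1\<^sub>m k" by blast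
  then show thesis
    by (intro that[of B]) (auto simp: exact_pair_def left_invertible_def)
qed

text \<open>The contracting homotopy is self-dual: transposition exchanges the roles of
  \<open>G\<close> and \<open>H\<close>. Cokernels are obtained from kernels in this way.\<close>

lemma exact_pair_transpose:
  assumes "exact_pair A B"
  shows "exact_pair (transpose_mat B) (transpose_mat A)"
proof -
  from assms obtain G H where d: "dim_col A = dim_row B" and z: "A * B = 0\<^sub>m (dim_row A) (dim_col B)"
    and G: "G \<in> carrier_mat (dim_col A) (dim_row A)" and H: "H \<in> carrier_mat (dim_col B) (dim_row B)"
    and e: "G * A + B * H = 1\<^sub>m (dim_col A)"
    unfolding exact_pair_def by blast
  have "transpose_mat B * transpose_mat A = transpose_mat (A * B)"
    using d by (subst transpose_mult[of _ "dim_row A" "dim_row B" _ "dim_col B"]) auto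
  moreover have "transpose_mat (G * A + B * H) = transpose_mat H * transpose_mat B + transpose_mat A * transpose_mat G"
  proof -
    have "transpose_mat (G * A) = transpose_mat A * transpose_mat G"
      using d G by (intro transpose_mult[of _ "dim_row B" "dim_row A" _ "dim_row B"]) auto
    moreover have "transpose_mat (B * H) = transpose_mat H * transpose_mat B"
      using H by (intro transpose_mult[of _ "dim_row B" "dim_col B" _ "dim_row B"]) auto
    moreover have "transpose_mat (G * A + B * H) = transpose_mat (B * H) + transpose_mat (G * A)"
      using d G H by (subst comm_add_mat[of _ "dim_row B" "dim_row B"])
        (auto intro!: transpose_add[of _ "dim_row B" "dim_row B"])
    ultimately show ?thesis by simp
  qed
  ultimately have "transpose_mat H * transpose_mat B + transpose_mat A * transpose_mat G = 1\<^sub>m (dim_row B)"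
    "transpose_mat B * transpose_mat A = 0\<^sub>m (dim_col B) (dim_row A)"
    using d e z by simp_all
  then show ?thesis
    unfolding exact_pair_def using d G H
    by (intro conjI exI[of _ "transpose_mat H"] exI[of _ "transpose_mat G"]) simp_all
qed

lemma left_invertible_transpose:
  assumes "left_invertible B"
  shows "right_invertible (transpose_mat B)"
proof -
  from assms obtain H where H: "H \<in> carrier_mat (dim_col B) (dim_row B)" "H * B = 1\<^sub>m (dim_col B)"
    unfolding left_invertible_def by blast
  have "transpose_mat B * transpose_mat H = transpose_mat (H * B)"
    using H by (subst transpose_mult[of _ "dim_col B" "dim_row B" _ "dim_col B"]) auto
  then show ?thesis
    unfolding right_invertible_def using H
    by (auto intro!: bexI[of _ "transpose_mat H"])
qed

lemma ex_cokernel: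
  fixes B :: "'a::field mat"
  obtains A where "exact_pair A B" "right_invertible A"
proof -
  obtain C where C: "exact_pair (transpose_mat B) C" "left_invertible C" by (rule ex_kernel)
  then show thesis
    using that[of "transpose_mat C"] exact_pair_transpose[OF C(1)] left_invertible_transpose[OF C(2)]
    by simp
qed

section \<open>Cancellation and counting of dimensions\<close>

lemma mult_right_cancel:
  fixes A B C :: "'a::field mat"
  assumes "right_invertible C" "A * C = B * C" "dim_col A = dim_row C" "dim_col B = dim_row C"
  shows "A = B"
proof -
  obtain G where G: "G \<in> carrier_mat (dim_col C) (dim_row C)" "C * G = 1\<^sub>m (dim_row C)"
    using assms unfolding right_invertible_def by blast
  have "A = A * (C * G)" using G assms by simp
  also have "\<dots> = (A * C) * G" using G assms by (subst mult_assoc_dim) auto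
  also have "\<dots> = (B * C) * G" using assms by simp
  also have "\<dots> = B * (C * G)" using G assms by (subst mult_assoc_dim) auto
  finally show ?thesis using G assms by simp
qed

lemma mult_left_cancel:
  fixes A B C :: "'a::field mat"
  assumes "left_invertible C" "C * A = C * B" "dim_col C = dim_row A" "dim_col C = dim_row B"
  shows "A = B"
proof -
  obtain H where H: "H \<in> carrier_mat (dim_col C) (dim_row C)" "H * C = 1\<^sub>m (dim_col C)"
    using assms unfolding left_invertible_def by blast
  have "A = (H * C) * A" using H assms by simp
  also have "\<dots> = H * (C * A)" using H assms by (subst mult_assoc_dim) auto
  also have "\<dots> = H * (C * B)" using assms by simp
  also have "\<dots> = (H * C) * B" using H assms by (subst mult_assoc_dim) auto
  finally show ?thesis using H assms by simp
qed

text \<open>Dimensions are compared through traces of identity matrices, so this stands in for rank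
  arguments and explains the characteristic zero in the lemmas that count dimensions.\<close>

lemma trace_mult_comm:
  fixes A B :: "'a::comm_semiring_1 mat"
  assumes "dim_col A = dim_row B" "dim_col B = dim_row A"
  shows "(\<Sum>i<dim_row A. (A * B) $$ (i, i)) = (\<Sum>i<dim_row B. (B * A) $$ (i, i))"
proof -
  have "(\<Sum>i<dim_row A. (A * B) $$ (i, i)) = (\<Sum>i<dim_row A. \<Sum>l<dim_row B. A $$ (i, l) * B $$ (l, i))"
    using assms by (intro sum.cong) (auto simp: index_mult_sum simp del: index_mult_mat)
  also have "\<dots> = (\<Sum>l<dim_row B. \<Sum>i<dim_row A. B $$ (l, i) * A $$ (i, l))"
    by (subst sum.swap) (simp add: mult.commute)
  also have "\<dots> = (\<Sum>i<dim_row B. (B * A) $$ (i, i))"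
    using assms by (intro sum.cong) (auto simp: index_mult_sum simp del: index_mult_mat)
  finally show ?thesis .
qed

text \<open>One-sided invertibility turns the homotopy into \<open>A * G = 1\<close> and
  \<open>H * B = 1\<close>. Then \<open>G * A\<close> and \<open>B * H\<close> sum to the identity
  and have traces \<open>dim_row A\<close> and \<open>dim_col B\<close>.\<close>

lemma exact_pair_dim:
  fixes A B :: "'a::field_char_0 mat"
  assumes "exact_pair A B" "left_invertible B" "right_invertible A"
  shows "dim_col A = dim_row A + dim_col B"
proof -
  from assms obtain G H where d: "dim_col A = dim_row B" and z: "A * B = 0\<^sub>m (dim_row A) (dim_col B)"
    and G: "G \<in> carrier_mat (dim_col A) (dim_row A)" and H: "H \<in> carrier_mat (dim_col B) (dim_row B)"
    and e: "G * A + B * H = 1\<^sub>m (dim_col A)"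
    unfolding exact_pair_def by blast
  have "(A * G) * A + A * B * H = A * (G * A + B * H)"
    using d G H by (simp add: mult_assoc_dim mult_add_dim)
  then have "(A * G) * A = 1\<^sub>m (dim_row A) * A" using z e d G H by (simp add: add_zero_dim)
  then have AG: "A * G = 1\<^sub>m (dim_row A)" by (rule mult_right_cancel[OF assms(3)]) (use G in auto)
  have "G * (A * B) + B * (H * B) = (G * A + B * H) * B"
    using d G H by (simp add: mult_assoc_dim add_mult_dim)
  then have "B * (H * B) = B * 1\<^sub>m (dim_col B)" using z e d G H by (simp add: add_zero_dim)
  then have HB: "H * B = 1\<^sub>m (dim_col B)" by (rule mult_left_cancel[OF assms(2)]) (use H in auto)
  have "of_nat (dim_col A) = (\<Sum>i<dim_col A. (G * A + B * H) $$ (i, i))" unfolding e by simp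
  also have "\<dots> = (\<Sum>i<dim_row G. (G * A) $$ (i, i)) + (\<Sum>i<dim_row B. (B * H) $$ (i, i))"
    using d G H by (simp add: sum.distrib del: index_mult_mat(1))
  also have "\<dots> = (\<Sum>i<dim_row A. (A * G) $$ (i, i)) + (\<Sum>i<dim_row H. (H * B) $$ (i, i))"
    using d G H by (subst (1 2) trace_mult_comm) (auto simp del: index_mult_mat(1))
  also have "\<dots> = (of_nat (dim_row A + dim_col B) :: 'a)" unfolding AG HB using H by simp
  finally show ?thesis using of_nat_eq_iff by blast
qed

section \<open>Block sums over a finite set of vertices\<close>

definition tot :: "nat set \<Rightarrow> (nat \<Rightarrow> nat) \<Rightarrow> nat" where
  "tot B d = (\<Sum>b\<in>B. d b)"

text \<open>An arbitrary numbering of the standard basis of the sum of the spaces of dimension \<open>d b\<close>.\<close>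

definition enc :: "nat set \<Rightarrow> (nat \<Rightarrow> nat) \<Rightarrow> nat \<times> nat \<Rightarrow> nat" where
  "enc B d = (SOME h. bij_betw h (SIGMA b:B. {..<d b}) {..<tot B d})"

text \<open>The map out of the direct sum over \<open>B\<close> with components \<open>A b\<close>,
  written as a row of blocks; \<open>pairing\<close> is the column of blocks, a map into the direct
  sum.\<close>

definition copair :: "nat set \<Rightarrow> (nat \<Rightarrow> nat) \<Rightarrow> nat \<Rightarrow> (nat \<Rightarrow> 'a::zero mat) \<Rightarrow> 'a mat" where
  "copair B d m A = mat m (tot B d)
     (\<lambda>(i, k). case inv_into (SIGMA b:B. {..<d b}) (enc B d) k of (b, j) \<Rightarrow> A b $$ (i, j))"

definition pairing :: "nat set \<Rightarrow> (nat \<Rightarrow> nat) \<Rightarrow> nat \<Rightarrow> (nat \<Rightarrow> 'a::zero mat) \<Rightarrow> 'a mat" where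
  "pairing B d m A = mat (tot B d) m
     (\<lambda>(k, i). case inv_into (SIGMA b:B. {..<d b}) (enc B d) k of (b, j) \<Rightarrow> A b $$ (j, i))"

definition incl :: "nat set \<Rightarrow> (nat \<Rightarrow> nat) \<Rightarrow> nat \<Rightarrow> 'a::zero_neq_one mat" where
  "incl B d b = mat (tot B d) (d b) (\<lambda>(k, j). if k = enc B d (b, j) then 1 else 0)"

definition proj :: "nat set \<Rightarrow> (nat \<Rightarrow> nat) \<Rightarrow> nat \<Rightarrow> 'a::zero_neq_one mat" where
  "proj B d b = mat (d b) (tot B d) (\<lambda>(j, k). if k = enc B d (b, j) then 1 else 0)"

lemma enc_bij:
  assumes "finite B"
  shows "bij_betw (enc B d) (SIGMA b:B. {..<d b}) {..<tot B d}"
proof -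
  have "\<exists>h. bij_betw h (SIGMA b:B. {..<d b}) {..<tot B d}"
    using assms by (intro finite_same_card_bij) (auto simp: tot_def)
  then show ?thesis unfolding enc_def by (rule someI_ex)
qed

lemma enc_less:
  assumes "finite B" "b \<in> B" "j < d b"
  shows "enc B d (b, j) < tot B d"
  using bij_betwE[OF enc_bij[OF assms(1)], of d] assms(2,3) by auto

lemma enc_inv:
  assumes "finite B" "b \<in> B" "j < d b"
  shows "inv_into (SIGMA b:B. {..<d b}) (enc B d) (enc B d (b, j)) = (b, j)"
  using bij_betw_inv_into_left[OF enc_bij[OF assms(1), of d]] assms(2,3) by auto

lemma enc_inject:
  assumes "finite B" "b \<in> B" "j < d b" "c \<in> B" "l < d c"
  shows "enc B d (b, j) = enc B d (c, l) \<longleftrightarrow> b = c \<and> j = l"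
  by (metis assms enc_inv prod.inject)

lemma enc_cases:
  assumes "finite B" "k < tot B d"
  obtains b j where "b \<in> B" "j < d b" "k = enc B d (b, j)"
proof -
  have "k \<in> enc B d ` (SIGMA b:B. {..<d b})"
    using enc_bij[OF assms(1), of d] assms(2) by (auto simp: bij_betw_def)
  then show thesis using that by auto
qed

lemma block_dims [simp]:
  "dim_row (copair B d m A) = m" "dim_col (copair B d m A) = tot B d"
  "dim_row (pairing B d m A) = tot B d" "dim_col (pairing B d m A) = m"
  "dim_row (incl B d b) = tot B d" "dim_col (incl B d b) = d b"
  "dim_row (proj B d b) = d b" "dim_col (proj B d b) = tot B d"
  by (auto simp: copair_def pairing_def incl_def proj_def)

text \<open>The numbering is an arbitrary choice, but it is chosen from data that depend only on the
  values of \<open>d\<close> on \<open>B\<close>. A representation and its reflection differ in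
  dimension only at the sink, which is not its own neighbour, so they share the block
  structure.\<close>

lemma block_cong:
  assumes "\<And>b. b \<in> B \<Longrightarrow> d b = d' b"
  shows "tot B d = tot B d'" "enc B d = enc B d'" "b \<in> B \<Longrightarrow> incl B d b = incl B d' b"
    "b \<in> B \<Longrightarrow> proj B d b = proj B d' b"
proof -
  show t: "tot B d = tot B d'" unfolding tot_def using assms by simp
  have "(SIGMA b:B. {..<d b}) = (SIGMA b:B. {..<d' b})" using assms by auto
  then show e: "enc B d = enc B d'" unfolding enc_def t by simp
  show "b \<in> B \<Longrightarrow> incl B d b = incl B d' b" "b \<in> B \<Longrightarrow> proj B d b = proj B d' b"
    unfolding incl_def proj_def t e using assms by simp_all
qed

lemma index_mult_incl:
  fixes X :: "'a::semiring_1 mat"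
  assumes "finite B" "b \<in> B" "dim_col X = tot B d" "i < dim_row X" "j < d b"
  shows "(X * incl B d b) $$ (i, j) = X $$ (i, enc B d (b, j))"
proof -
  have "(X * incl B d b) $$ (i, j) = (\<Sum>l<tot B d. X $$ (i, l) * incl B d b $$ (l, j))"
    using assms by (subst index_mult_sum) auto
  also have "\<dots> = (\<Sum>l<tot B d. if l = enc B d (b, j) then X $$ (i, l) else 0)"
    using assms by (intro sum.cong) (auto simp: incl_def)
  finally show ?thesis using enc_less[of B b j d] assms by simp
qed

lemma index_proj_mult:
  fixes X :: "'a::semiring_1 mat"
  assumes "finite B" "b \<in> B" "dim_row X = tot B d" "i < dim_col X" "j < d b"
  shows "(proj B d b * X) $$ (j, i) = X $$ (enc B d (b, j), i)"
proof -
  have "(proj B d b * X) $$ (j, i) = (\<Sum>l<tot B d. proj B d b $$ (j, l) * X $$ (l, i))"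
    using assms by (subst index_mult_sum) auto
  also have "\<dots> = (\<Sum>l<tot B d. if l = enc B d (b, j) then X $$ (l, i) else 0)"
    using assms by (intro sum.cong) (auto simp: proj_def)
  finally show ?thesis using enc_less[of B b j d] assms by simp
qed

lemma copair_incl:
  fixes A :: "nat \<Rightarrow> 'a::semiring_1 mat"
  assumes "finite B" "b \<in> B" "A b \<in> carrier_mat m (d b)"
  shows "copair B d m A * incl B d b = A b"
proof (intro eq_matI)
  fix i j assume "i < dim_row (A b)" "j < dim_col (A b)"
  then show "(copair B d m A * incl B d b) $$ (i, j) = A b $$ (i, j)"
    using assms by (subst index_mult_incl) (auto simp: copair_def enc_inv enc_less)
qed (use assms in auto)

lemma proj_pairing:
  fixes A :: "nat \<Rightarrow> 'a::semiring_1 mat"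
  assumes "finite B" "b \<in> B" "A b \<in> carrier_mat (d b) m"
  shows "proj B d b * pairing B d m A = A b"
proof (intro eq_matI)
  fix i j assume "i < dim_row (A b)" "j < dim_col (A b)"
  then show "(proj B d b * pairing B d m A) $$ (i, j) = A b $$ (i, j)"
    using assms by (subst index_proj_mult) (auto simp: pairing_def enc_inv enc_less)
qed (use assms in auto)

lemma proj_incl:
  assumes "finite B" "b \<in> B" "c \<in> B"
  shows "(proj B d b :: 'a::semiring_1 mat) * incl B d c = (if b = c then 1\<^sub>m (d b) else 0\<^sub>m (d b) (d c))"
proof (intro eq_matI)
  fix i j
  assume "i < dim_row (if b = c then 1\<^sub>m (d b) else 0\<^sub>m (d b) (d c) :: 'a mat)"
    "j < dim_col (if b = c then 1\<^sub>m (d b) else 0\<^sub>m (d b) (d c) :: 'a mat)"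
  then have ij: "i < d b" "j < d c" by (auto split: if_splits)
  then have "((proj B d b :: 'a mat) * incl B d c) $$ (i, j) = proj B d b $$ (i, enc B d (c, j))"
    using assms by (subst index_mult_incl) auto
  also have "\<dots> = (if enc B d (c, j) = enc B d (b, i) then 1 else 0)"
    using assms ij enc_less[of B c j d] by (simp add: proj_def)
  also have "\<dots> = (if b = c then 1\<^sub>m (d b) else 0\<^sub>m (d b) (d c) :: 'a mat) $$ (i, j)"
    using assms ij by (auto simp: enc_inject)
  finally show "((proj B d b :: 'a mat) * incl B d c) $$ (i, j) =
    (if b = c then 1\<^sub>m (d b) else 0\<^sub>m (d b) (d c)) $$ (i, j)" .
qed (use assms in auto)

text \<open>Universal property of the sum; this and \<open>pairing_ext\<close> reduce identities
  between block matrices to identities between blocks.\<close>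

lemma copair_ext:
  fixes X Y :: "'a::semiring_1 mat"
  assumes B: "finite B" and d: "dim_col X = tot B d" "dim_col Y = tot B d" "dim_row X = dim_row Y"
    and eq: "\<And>b. b \<in> B \<Longrightarrow> X * incl B d b = Y * incl B d b"
  shows "X = Y"
proof (intro eq_matI)
  fix i k assume ik: "i < dim_row Y" "k < dim_col Y"
  then obtain b j where bj: "b \<in> B" "j < d b" "k = enc B d (b, j)"
    using enc_cases[OF B] d(2) by metis
  have "X $$ (i, k) = (X * incl B d b) $$ (i, j)"
    using index_mult_incl[OF B bj(1) d(1) _ bj(2)] ik d bj(3) by simp
  also have "\<dots> = Y $$ (i, k)"
    using index_mult_incl[OF B bj(1) d(2) _ bj(2)] ik bj(3) eq[OF bj(1)] by simp
  finally show "X $$ (i, k) = Y $$ (i, k)" .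
qed (use d in auto)

lemma pairing_ext:
  fixes X Y :: "'a::semiring_1 mat"
  assumes B: "finite B" and d: "dim_row X = tot B d" "dim_row Y = tot B d" "dim_col X = dim_col Y"
    and eq: "\<And>b. b \<in> B \<Longrightarrow> proj B d b * X = proj B d b * Y"
  shows "X = Y"
proof (intro eq_matI)
  fix k i assume ik: "k < dim_row Y" "i < dim_col Y"
  then obtain b j where bj: "b \<in> B" "j < d b" "k = enc B d (b, j)"
    using enc_cases[OF B] d(2) by metis
  have "X $$ (k, i) = (proj B d b * X) $$ (j, i)"
    using index_proj_mult[OF B bj(1) d(1) _ bj(2)] ik d bj(3) by simp
  also have "\<dots> = Y $$ (k, i)"
    using index_proj_mult[OF B bj(1) d(2) _ bj(2)] ik bj(3) eq[OF bj(1)] by simp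
  finally show "X $$ (k, i) = Y $$ (k, i)" .
qed (use d in auto)

text \<open>The direct sum of the maps \<open>f b\<close>. For a morphism of representations it is
  the induced map on the sum of the spaces at the neighbours of the sink.\<close>

definition block_diag :: "nat set \<Rightarrow> (nat \<Rightarrow> nat) \<Rightarrow> (nat \<Rightarrow> nat) \<Rightarrow> (nat \<Rightarrow> 'a mat) \<Rightarrow> 'a::semiring_1 mat" where
  "block_diag B d e f = copair B d (tot B e) (\<lambda>b. incl B e b * f b)"

lemma block_diag_dims [simp]:
  "dim_row (block_diag B d e f) = tot B e" "dim_col (block_diag B d e f) = tot B d"
  by (auto simp: block_diag_def)

lemma block_diag_incl:
  assumes "finite B" "b \<in> B" "f b \<in> carrier_mat (e b) (d b)"
  shows "block_diag B d e f * incl B d b = incl B e b * f b"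
  unfolding block_diag_def using assms by (subst copair_incl) auto

lemma proj_block_diag:
  assumes "finite B" "b \<in> B" "\<And>b. b \<in> B \<Longrightarrow> f b \<in> carrier_mat (e b) (d b)"
  shows "proj B e b * block_diag B d e f = f b * proj B d b"
proof (rule copair_ext[OF assms(1)])
  fix c assume c: "c \<in> B"
  have "proj B e b * block_diag B d e f * incl B d c = (proj B e b * incl B e c) * f c"
    using assms(3)[OF c] block_diag_incl[where f = f and d = d and e = e, OF assms(1) c assms(3)[OF c]]
    by (simp add: mult_assoc_dim)
  also have "\<dots> = f b * (proj B d b * incl B d c)"
    using assms(3)[OF c] assms(3)[OF assms(2)]
    unfolding proj_incl[OF assms(1,2) c] by auto
  finally show "proj B e b * block_diag B d e f * incl B d c = f b * proj B d b * incl B d c"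
    using assms(3)[OF assms(2)] by (simp add: mult_assoc_dim)
qed (use assms(3)[OF assms(2)] in auto)

lemma block_diag_cong:
  assumes "finite B" "\<And>b. b \<in> B \<Longrightarrow> f b = g b" "\<And>b. b \<in> B \<Longrightarrow> f b \<in> carrier_mat (e b) (d b)"
  shows "block_diag B d e f = block_diag B d e g"
  by (rule copair_ext[OF assms(1)]) (use assms block_diag_incl in \<open>auto simp: block_diag_incl\<close>)

section \<open>Idempotents and direct sums of matrices\<close>

lemma inverse_mat_dims:
  fixes A B :: "'a::field_char_0 mat"
  assumes "A \<in> carrier_mat m k" "B \<in> carrier_mat k m" "A * B = 1\<^sub>m m" "B * A = 1\<^sub>m k"
  shows "m = k"
proof -
  have "of_nat m = (\<Sum>i<m. (A * B) $$ (i, i))" using assms by simp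
  also have "\<dots> = (\<Sum>i<k. (B * A) $$ (i, i))"
    using trace_mult_comm[of A B] assms(1,2) by simp
  also have "\<dots> = (of_nat k :: 'a)" unfolding assms by simp
  finally show ?thesis using of_nat_eq_iff by blast
qed

lemma one_mat_eq_zero_mat: "(1\<^sub>m k :: 'a::zero_neq_one mat) = 0\<^sub>m k k \<longleftrightarrow> k = 0"
proof
  assume eq: "(1\<^sub>m k :: 'a mat) = 0\<^sub>m k k"
  show "k = 0"
  proof (rule ccontr)
    assume "k \<noteq> 0"
    then have "(1\<^sub>m k :: 'a mat) $$ (0, 0) = 1" "(0\<^sub>m k k :: 'a mat) $$ (0, 0) = 0" by auto
    with eq show False by simp
  qed
qed auto

text \<open>The image of \<open>E\<close> is the kernel of \<open>1 - E\<close>, so a kernel basis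
  \<open>B\<close> serves as \<open>P\<close>. The retraction is \<open>H * E\<close> rather than
  \<open>H\<close>, because the homotopy term \<open>G * A\<close> disappears only after
  multiplication by \<open>E\<close>.\<close>

lemma mat_split_idempotent:
  fixes E :: "'a::field mat"
  assumes E: "E \<in> carrier_mat d d" and idem: "E * E = E"
  shows "\<exists>P R. P \<in> carrier_mat d (dim_col P) \<and> R \<in> carrier_mat (dim_col P) d \<and>
    R * P = 1\<^sub>m (dim_col P) \<and> P * R = E"
proof -
  define A where "A = 1\<^sub>m d + (- E)"
  have A: "A \<in> carrier_mat d d" using E by (auto simp: A_def)
  have A_mult: "A * X = X + (- (E * X))" if "dim_row X = d" for X
    unfolding A_def using E that by (subst add_mult_dim) auto
  from ex_kernel_data[OF A] obtain k B G H where
    B: "B \<in> carrier_mat d k" and G: "G \<in> carrier_mat d d" and H: "H \<in> carrier_mat k d"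
    and AB: "A * B = 0\<^sub>m d k" and GA: "G * A + B * H = 1\<^sub>m d" and HB: "H * B = 1\<^sub>m k" by blast
  have AE: "A * E = 0\<^sub>m d d" 
  proof -
    have "E + - E = 0\<^sub>m d d" using E by (intro eq_matI) auto
    then show ?thesis using A_mult[of E] E idem by simp
  qed
  have EB: "E * B = B"
  proof (intro eq_matI)
    fix i j assume ij: "i < dim_row B" "j < dim_col B"
    have "B + - (E * B) = 0\<^sub>m d k" using A_mult[of B, symmetric] AB B by simp
    then have "(B + - (E * B)) $$ (i, j) = 0" using B ij by simp
    then show "(E * B) $$ (i, j) = B $$ (i, j)" using ij B E by simp
  qed (use B E in auto)
  have "(H * E) * B = 1\<^sub>m k" using EB HB B H E by (simp add: mult_assoc_dim)
  moreover have "B * (H * E) = E"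
  proof -
    have "E = (G * A + B * H) * E" using GA E by simp
    also have "\<dots> = G * (A * E) + B * (H * E)"
      using A B G H E by (subst add_mult_dim) (auto simp: mult_assoc_dim)
    finally show ?thesis using AE G B H E by (simp add: add_zero_dim)
  qed
  ultimately show ?thesis using B H E by (intro exI[of _ B] exI[of _ "H * E"]) auto
qed

definition in1 :: "nat \<Rightarrow> nat \<Rightarrow> 'a::zero_neq_one mat" where
  "in1 p q = mat (p + q) p (\<lambda>(i, j). if i = j then 1 else 0)"

definition in2 :: "nat \<Rightarrow> nat \<Rightarrow> 'a::zero_neq_one mat" where
  "in2 p q = mat (p + q) q (\<lambda>(i, j). if i = p + j then 1 else 0)"

definition pr1 :: "nat \<Rightarrow> nat \<Rightarrow> 'a::zero_neq_one mat" where
  "pr1 p q = mat p (p + q) (\<lambda>(i, j). if j = i then 1 else 0)"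

definition pr2 :: "nat \<Rightarrow> nat \<Rightarrow> 'a::zero_neq_one mat" where
  "pr2 p q = mat q (p + q) (\<lambda>(i, j). if j = p + i then 1 else 0)"

lemma in_pr_dims [simp]:
  "dim_row (in1 p q) = p + q" "dim_col (in1 p q) = p" "dim_row (in2 p q) = p + q" "dim_col (in2 p q) = q"
  "dim_row (pr1 p q) = p" "dim_col (pr1 p q) = p + q" "dim_row (pr2 p q) = q" "dim_col (pr2 p q) = p + q"
  by (auto simp: in1_def in2_def pr1_def pr2_def)

lemma index_mult_in:
  fixes X :: "'a::semiring_1 mat"
  assumes "dim_col X = p + q" "i < dim_row X"
  shows "j < p \<Longrightarrow> (X * in1 p q) $$ (i, j) = X $$ (i, j)"
    "j < q \<Longrightarrow> (X * in2 p q) $$ (i, j) = X $$ (i, p + j)"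
proof -
  assume j: "j < p"
  have "(X * in1 p q) $$ (i, j) = (\<Sum>l<p + q. X $$ (i, l) * in1 p q $$ (l, j))"
    using assms j by (subst index_mult_sum) auto
  also have "\<dots> = (\<Sum>l<p + q. if l = j then X $$ (i, l) else 0)"
    using j by (intro sum.cong) (auto simp: in1_def)
  finally show "(X * in1 p q) $$ (i, j) = X $$ (i, j)" using j by simp
next
  assume j: "j < q"
  have "(X * in2 p q) $$ (i, j) = (\<Sum>l<p + q. X $$ (i, l) * in2 p q $$ (l, j))"
    using assms j by (subst index_mult_sum) auto
  also have "\<dots> = (\<Sum>l<p + q. if l = p + j then X $$ (i, l) else 0)"
    using j by (intro sum.cong) (auto simp: in2_def)
  finally show "(X * in2 p q) $$ (i, j) = X $$ (i, p + j)" using j by simp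
qed

lemma index_pr_mult:
  fixes X :: "'a::semiring_1 mat"
  assumes "dim_row X = p + q" "j < dim_col X"
  shows "i < p \<Longrightarrow> (pr1 p q * X) $$ (i, j) = X $$ (i, j)"
    "i < q \<Longrightarrow> (pr2 p q * X) $$ (i, j) = X $$ (p + i, j)"
proof -
  assume i: "i < p"
  have "(pr1 p q * X) $$ (i, j) = (\<Sum>l<p + q. pr1 p q $$ (i, l) * X $$ (l, j))"
    using assms i by (subst index_mult_sum) auto
  also have "\<dots> = (\<Sum>l<p + q. if l = i then X $$ (l, j) else 0)"
    using i by (intro sum.cong) (auto simp: pr1_def)
  finally show "(pr1 p q * X) $$ (i, j) = X $$ (i, j)" using i by simp
next
  assume i: "i < q"
  have "(pr2 p q * X) $$ (i, j) = (\<Sum>l<p + q. pr2 p q $$ (i, l) * X $$ (l, j))"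
    using assms i by (subst index_mult_sum) auto
  also have "\<dots> = (\<Sum>l<p + q. if l = p + i then X $$ (l, j) else 0)"
    using i by (intro sum.cong) (auto simp: pr2_def)
  finally show "(pr2 p q * X) $$ (i, j) = X $$ (p + i, j)" using i by simp
qed

lemma pr_in:
  "pr1 p q * in1 p q = (1\<^sub>m p :: 'a::semiring_1 mat)" "pr2 p q * in2 p q = (1\<^sub>m q :: 'a mat)"
  "pr1 p q * in2 p q = (0\<^sub>m p q :: 'a mat)" "pr2 p q * in1 p q = (0\<^sub>m q p :: 'a mat)"
  by (intro eq_matI; simp add: index_pr_mult in1_def in2_def del: index_mult_mat(1))+

lemma in_pr_sum: "in1 p q * pr1 p q + in2 p q * pr2 p q = (1\<^sub>m (p + q) :: 'a::semiring_1 mat)"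
proof (rule eq_matI)
  fix i j assume ij: "i < dim_row (1\<^sub>m (p + q) :: 'a mat)" "j < dim_col (1\<^sub>m (p + q) :: 'a mat)"
  have 1: "((in1 p q :: 'a mat) * pr1 p q) $$ (i, j) = (if i < p \<and> i = j then 1 else 0)"
  proof -
    have "((in1 p q :: 'a mat) * pr1 p q) $$ (i, j) = (\<Sum>l<p. in1 p q $$ (i, l) * pr1 p q $$ (l, j))"
      using ij by (subst index_mult_sum) auto
    also have "\<dots> = (\<Sum>l<p. if l = i then if i = j then 1 else 0 else 0)"
      using ij by (intro sum.cong) (auto simp: in1_def pr1_def)
    finally show ?thesis by simp
  qed
  have 2: "((in2 p q :: 'a mat) * pr2 p q) $$ (i, j) = (if p \<le> i \<and> i = j then 1 else 0)"
  proof -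
    have "((in2 p q :: 'a mat) * pr2 p q) $$ (i, j) = (\<Sum>l<q. in2 p q $$ (i, l) * pr2 p q $$ (l, j))"
      using ij by (subst index_mult_sum) auto
    also have "\<dots> = (\<Sum>l<q. if l = i - p then if p \<le> i \<and> i = j then 1 else 0 else 0)"
      using ij by (intro sum.cong) (auto simp: in2_def pr2_def)
    finally show ?thesis using ij by auto
  qed
  show "((in1 p q :: 'a mat) * pr1 p q + in2 p q * pr2 p q) $$ (i, j) = 1\<^sub>m (p + q) $$ (i, j)"
    using ij by (subst index_add_mat) (auto simp: 1 2 simp del: index_mult_mat(1))
qed auto

text \<open>The only place where the entries of a block matrix from \<open>direct_sum\<close> are
  inspected; afterwards direct sums are handled through inclusions and projections.\<close>

lemma four_block_in_pr:
  fixes A D :: "'a::semiring_1 mat"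
  assumes A: "A \<in> carrier_mat p p'" and D: "D \<in> carrier_mat q q'"
  defines "F \<equiv> four_block_mat A (0\<^sub>m p q') (0\<^sub>m q p') D"
  shows "F * in1 p' q' = in1 p q * A" "F * in2 p' q' = in2 p q * D"
    "pr1 p q * F = A * pr1 p' q'" "pr2 p q * F = D * pr2 p' q'"
proof -
  have F: "dim_row F = p + q" "dim_col F = p' + q'" using A D by (auto simp: F_def)
  have pF1: "pr1 p q * (F * in1 p' q') = A"
    by (intro eq_matI) (use A D F in \<open>auto simp: index_pr_mult index_mult_in F_def simp del: index_mult_mat(1)\<close>)
  have pF2: "pr1 p q * (F * in2 p' q') = 0\<^sub>m p q'"
    by (intro eq_matI) (use A D F in \<open>auto simp: index_pr_mult index_mult_in F_def simp del: index_mult_mat(1)\<close>)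
  have pF3: "pr2 p q * (F * in1 p' q') = 0\<^sub>m q p'"
    by (intro eq_matI) (use A D F in \<open>auto simp: index_pr_mult index_mult_in F_def simp del: index_mult_mat(1)\<close>)
  have pF4: "pr2 p q * (F * in2 p' q') = D"
    by (intro eq_matI) (use A D F in \<open>auto simp: index_pr_mult index_mult_in F_def simp del: index_mult_mat(1)\<close>)
  \<comment> \<open>Inserting the resolution of the identity by \<open>in_pr_sum\<close> recovers a
    matrix from its corners, which were computed entrywise above.\<close>
  have split_left: "X = in1 p q * (pr1 p q * X) + in2 p q * (pr2 p q * X)" if "dim_row X = p + q" for X :: "'a mat"
  proof -
    have "X = (in1 p q * pr1 p q + in2 p q * pr2 p q) * X" unfolding in_pr_sum using that by simp
    also have "\<dots> = in1 p q * (pr1 p q * X) + in2 p q * (pr2 p q * X)"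
      using that by (subst add_mult_dim) (auto simp: mult_assoc_dim)
    finally show ?thesis .
  qed
  have split_right: "X = (X * in1 p' q') * pr1 p' q' + (X * in2 p' q') * pr2 p' q'" if "dim_col X = p' + q'" for X :: "'a mat"
  proof -
    have "X = X * (in1 p' q' * pr1 p' q' + in2 p' q' * pr2 p' q')" unfolding in_pr_sum using that by simp
    also have "\<dots> = (X * in1 p' q') * pr1 p' q' + (X * in2 p' q') * pr2 p' q'"
      using that by (subst mult_add_dim) (auto simp: mult_assoc_dim)
    finally show ?thesis .
  qed
  show "F * in1 p' q' = in1 p q * A"
    using split_left[of "F * in1 p' q'"] F A D by (simp add: pF1 pF3 add_zero_dim)
  show "F * in2 p' q' = in2 p q * D"
    using split_left[of "F * in2 p' q'"] F A D by (simp add: pF2 pF4 add_zero_dim)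
  show "pr1 p q * F = A * pr1 p' q'"
    using split_right[of "pr1 p q * F"] F A D by (simp add: mult_assoc_dim pF1 pF2 add_zero_dim)
  show "pr2 p q * F = D * pr2 p' q'"
    using split_right[of "pr2 p q * F"] F A D by (simp add: mult_assoc_dim pF3 pF4 add_zero_dim)
qed

section \<open>Representations and morphisms\<close>

locale quiv =
  fixes n :: nat and Q :: quiver
  assumes arrow: "(s, t) \<in> Q \<Longrightarrow> s \<in> {1..n} \<and> t \<in> {1..n} \<and> s \<noteq> t"
begin

abbreviation rep :: "qrep \<Rightarrow> bool" where "rep \<equiv> representation Q"
abbreviation mor :: "qrep \<Rightarrow> qrep \<Rightarrow> qmor \<Rightarrow> bool" where "mor \<equiv> morphism n Q"

lemma rep_dims:
  assumes "rep X" "(s, t) \<in> Q"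
  shows "dim_row (rmap X (s, t)) = rdim X t" "dim_col (rmap X (s, t)) = rdim X s"
  using assms unfolding representation_def by auto

lemma mor_dims:
  assumes "mor X Y f" "v \<in> {1..n}"
  shows "dim_row (f v) = rdim Y v" "dim_col (f v) = rdim X v"
  using assms unfolding morphism_def by auto

lemma mor_carrier: "mor X Y f \<Longrightarrow> v \<in> {1..n} \<Longrightarrow> f v \<in> carrier_mat (rdim Y v) (rdim X v)"
  unfolding morphism_def by auto

lemma mor_comm: "mor X Y f \<Longrightarrow> (s, t) \<in> Q \<Longrightarrow> f t * rmap X (s, t) = rmap Y (s, t) * f s"
  unfolding morphism_def by auto

lemma morI:
  assumes "\<And>v. v \<in> {1..n} \<Longrightarrow> f v \<in> carrier_mat (rdim Y v) (rdim X v)"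
    "\<And>s t. (s, t) \<in> Q \<Longrightarrow> s \<in> {1..n} \<Longrightarrow> t \<in> {1..n} \<Longrightarrow> f t * rmap X (s, t) = rmap Y (s, t) * f s"
  shows "mor X Y f"
  using assms arrow unfolding morphism_def by auto

lemma mor_comp_mor:
  assumes "rep X" "rep L" "rep Y" "mor X L h" "mor L Y g"
  shows "mor X Y (\<lambda>v. g v * h v)"
proof (rule morI)
  fix v assume "v \<in> {1..n}"
  then show "g v * h v \<in> carrier_mat (rdim Y v) (rdim X v)"
    using mor_carrier assms by (meson mult_carrier_mat)
next
  fix s t assume Q: "(s, t) \<in> Q" and st: "s \<in> {1..n}" "t \<in> {1..n}"
  note d = mor_dims[OF assms(4) st(1)] mor_dims[OF assms(4) st(2)] mor_dims[OF assms(5) st(1)]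
    mor_dims[OF assms(5) st(2)] rep_dims[OF assms(1) Q] rep_dims[OF assms(2) Q] rep_dims[OF assms(3) Q]
  have "g t * h t * rmap X (s, t) = g t * (h t * rmap X (s, t))"
    using d by (simp add: mult_assoc_dim)
  also have "\<dots> = (g t * rmap L (s, t)) * h s"
    unfolding mor_comm[OF assms(4) Q] using d by (simp add: mult_assoc_dim)
  also have "\<dots> = rmap Y (s, t) * (g s * h s)"
    unfolding mor_comm[OF assms(5) Q] using d by (simp add: mult_assoc_dim)
  finally show "g t * h t * rmap X (s, t) = rmap Y (s, t) * (g s * h s)" .
qed

lemma mor_one: "rep X \<Longrightarrow> mor X X (\<lambda>v. 1\<^sub>m (rdim X v))"
  by (rule morI) (auto simp: rep_dims)

lemma mor_zero:
  assumes "rep X" "rep Y"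
  shows "mor X Y (\<lambda>v. 0\<^sub>m (rdim Y v) (rdim X v))"
  by (rule morI) (auto simp: rep_dims[OF assms(1)] rep_dims[OF assms(2)])

lemma mor_smult:
  assumes "rep X" "rep Y" "mor X Y f"
  shows "mor X Y (\<lambda>v. c \<cdot>\<^sub>m f v)"
proof (rule morI)
  fix s t assume Q: "(s, t) \<in> Q" and st: "s \<in> {1..n}" "t \<in> {1..n}"
  note d = mor_dims[OF assms(3) st(1)] mor_dims[OF assms(3) st(2)] rep_dims[OF assms(1) Q] rep_dims[OF assms(2) Q]
  show "c \<cdot>\<^sub>m f t * rmap X (s, t) = rmap Y (s, t) * (c \<cdot>\<^sub>m f s)"
    using d mor_comm[OF assms(3) Q] by (simp add: smult_mult_dim mult_smult_dim)
qed (use mor_carrier[OF assms(3)] in auto)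

lemma mor_add:
  assumes "rep X" "rep Y" "mor X Y f" "mor X Y g"
  shows "mor X Y (\<lambda>v. f v + g v)"
proof (rule morI)
  fix s t assume Q: "(s, t) \<in> Q" and st: "s \<in> {1..n}" "t \<in> {1..n}"
  note d = mor_dims[OF assms(3) st(1)] mor_dims[OF assms(3) st(2)] mor_dims[OF assms(4) st(1)]
    mor_dims[OF assms(4) st(2)] rep_dims[OF assms(1) Q] rep_dims[OF assms(2) Q]
  show "(f t + g t) * rmap X (s, t) = rmap Y (s, t) * (f s + g s)"
    using d mor_comm[OF assms(3) Q] mor_comm[OF assms(4) Q] by (simp add: add_mult_dim mult_add_dim)
qed (use mor_carrier[OF assms(3)] mor_carrier[OF assms(4)] in auto)

text \<open>The splitting is chosen vertex by vertex, without coherence. The structure maps of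
  \<open>M\<close> are transported by \<open>R\<close> and \<open>P\<close>, and the squares commute
  because \<open>P * R = e\<close> is itself a morphism.\<close>

lemma split_idempotent:
  assumes X: "rep X" and e: "mor X X e" and idem: "\<And>v. v \<in> {1..n} \<Longrightarrow> e v * e v = e v"
  obtains M P R where "rep M" "mor M X P" "mor X M R"
    "\<And>v. v \<in> {1..n} \<Longrightarrow> R v * P v = 1\<^sub>m (rdim M v)" "\<And>v. v \<in> {1..n} \<Longrightarrow> P v * R v = e v"
proof -
  have "\<forall>v\<in>{1..n}. \<exists>PR. fst PR \<in> carrier_mat (rdim X v) (dim_col (fst PR)) \<and>
      snd PR \<in> carrier_mat (dim_col (fst PR)) (rdim X v) \<and>
      snd PR * fst PR = 1\<^sub>m (dim_col (fst PR)) \<and> fst PR * snd PR = e v"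
  proof
    fix v assume "v \<in> {1..n}"
    from mat_split_idempotent[OF mor_carrier[OF e this] idem[OF this]]
    show "\<exists>PR. fst PR \<in> carrier_mat (rdim X v) (dim_col (fst PR)) \<and>
      snd PR \<in> carrier_mat (dim_col (fst PR)) (rdim X v) \<and>
      snd PR * fst PR = 1\<^sub>m (dim_col (fst PR)) \<and> fst PR * snd PR = e v"
      by simp
  qed
  from bchoice[OF this] obtain PR where PR: "\<forall>v\<in>{1..n}. fst (PR v) \<in> carrier_mat (rdim X v) (dim_col (fst (PR v))) \<and>
      snd (PR v) \<in> carrier_mat (dim_col (fst (PR v))) (rdim X v) \<and>
      snd (PR v) * fst (PR v) = 1\<^sub>m (dim_col (fst (PR v))) \<and> fst (PR v) * snd (PR v) = e v" ..
  define P R where "P v = fst (PR v)" and "R v = snd (PR v)" for v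
  have PR: "P v \<in> carrier_mat (rdim X v) (dim_col (P v))" "R v \<in> carrier_mat (dim_col (P v)) (rdim X v)"
    "R v * P v = 1\<^sub>m (dim_col (P v))" "P v * R v = e v" if "v \<in> {1..n}" for v
    using PR that unfolding P_def R_def by blast+
  have d: "dim_row (P v) = rdim X v" "dim_row (R v) = dim_col (P v)" "dim_col (R v) = rdim X v"
    "dim_row (e v) = rdim X v" "dim_col (e v) = rdim X v"
    if "v \<in> {1..n}" for v
    using carrier_matD[OF PR(1)[OF that]] carrier_matD[OF PR(2)[OF that]] mor_dims[OF e that] by simp_all
  have Re: "R v * e v = R v" if "v \<in> {1..n}" for v
  proof -
    have "R v * e v = (R v * P v) * R v"
      unfolding PR(4)[OF that, symmetric] using d[OF that] by (simp add: mult_assoc_dim)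
    then show ?thesis unfolding PR(3)[OF that] using d[OF that] by simp
  qed
  have eP: "e v * P v = P v" if "v \<in> {1..n}" for v
  proof -
    have "e v * P v = P v * (R v * P v)"
      unfolding PR(4)[OF that, symmetric] using d[OF that] by (simp add: mult_assoc_dim)
    then show ?thesis unfolding PR(3)[OF that] using d[OF that] by simp
  qed
  define M where "M = \<lparr>rdim = (\<lambda>v. dim_col (P v)), rmap = (\<lambda>(s, t). R t * rmap X (s, t) * P s)\<rparr>"
  have M: "rep M" unfolding representation_def
    using arrow d by (auto simp: M_def)
  have P_mor: "mor M X P"
  proof (rule morI)
    fix s t assume Q: "(s, t) \<in> Q" and st: "s \<in> {1..n}" "t \<in> {1..n}"
    note dd = d[OF st(1)] d[OF st(2)] rep_dims[OF X Q]
    have "P t * rmap M (s, t) = (P t * R t) * rmap X (s, t) * P s"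
      using dd by (simp add: M_def mult_assoc_dim)
    also have "\<dots> = rmap X (s, t) * (e s * P s)"
      unfolding PR(4)[OF st(2)] mor_comm[OF e Q] using dd by (simp add: mult_assoc_dim)
    finally show "P t * rmap M (s, t) = rmap X (s, t) * P s" using eP st by simp
  qed (use PR(1) in \<open>auto simp: M_def\<close>)
  have R_mor: "mor X M R"
  proof (rule morI)
    fix s t assume Q: "(s, t) \<in> Q" and st: "s \<in> {1..n}" "t \<in> {1..n}"
    note dd = d[OF st(1)] d[OF st(2)] rep_dims[OF X Q]
    have "rmap M (s, t) * R s = R t * (rmap X (s, t) * (P s * R s))"
      using dd by (simp add: M_def mult_assoc_dim)
    also have "\<dots> = (R t * e t) * rmap X (s, t)"
      unfolding PR(4)[OF st(1)] mor_comm[OF e Q, symmetric] using dd by (simp add: mult_assoc_dim)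
    finally show "R t * rmap X (s, t) = rmap M (s, t) * R s" using Re st by simp
  qed (use PR(2) in \<open>auto simp: M_def\<close>)
  from M P_mor R_mor show thesis
    by (rule that) (use PR in \<open>simp_all add: M_def\<close>)
qed

section \<open>Direct sums, indecomposability and bricks\<close>

lemma direct_sum_rep:
  assumes "rep M" "rep N"
  shows "rep (direct_sum M N)"
  using assms unfolding representation_def direct_sum_def
  by (auto intro!: four_block_carrier_mat)

lemma direct_sum_mors:
  assumes "rep M" "rep N"
  shows "mor M (direct_sum M N) (\<lambda>v. in1 (rdim M v) (rdim N v))"
    "mor N (direct_sum M N) (\<lambda>v. in2 (rdim M v) (rdim N v))"
    "mor (direct_sum M N) M (\<lambda>v. pr1 (rdim M v) (rdim N v))"
    "mor (direct_sum M N) N (\<lambda>v. pr2 (rdim M v) (rdim N v))"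
proof -
  have c: "rmap M (s, t) \<in> carrier_mat (rdim M t) (rdim M s)"
    "rmap N (s, t) \<in> carrier_mat (rdim N t) (rdim N s)" if "(s, t) \<in> Q" for s t
    using assms that unfolding representation_def by auto
  show "mor M (direct_sum M N) (\<lambda>v. in1 (rdim M v) (rdim N v))"
    by (rule morI) (auto simp: direct_sum_def four_block_in_pr[OF c])
  show "mor N (direct_sum M N) (\<lambda>v. in2 (rdim M v) (rdim N v))"
    by (rule morI) (auto simp: direct_sum_def four_block_in_pr[OF c])
  show "mor (direct_sum M N) M (\<lambda>v. pr1 (rdim M v) (rdim N v))"
    by (rule morI) (auto simp: direct_sum_def four_block_in_pr[OF c])
  show "mor (direct_sum M N) N (\<lambda>v. pr2 (rdim M v) (rdim N v))"
    by (rule morI) (auto simp: direct_sum_def four_block_in_pr[OF c])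
qed

text \<open>Direct sums enter all later arguments through these equations. The matrix identities are
  required at every index, not only at vertices, so that they rewrite without side
  conditions.\<close>

definition biproduct :: "qrep \<Rightarrow> qrep \<Rightarrow> qrep \<Rightarrow> qmor \<Rightarrow> qmor \<Rightarrow> qmor \<Rightarrow> qmor \<Rightarrow> bool" where
  "biproduct M N S i1 i2 p1 p2 \<longleftrightarrow> mor M S i1 \<and> mor N S i2 \<and> mor S M p1 \<and> mor S N p2 \<and>
     (\<forall>v. p1 v * i1 v = 1\<^sub>m (rdim M v) \<and> p2 v * i2 v = 1\<^sub>m (rdim N v) \<and>
       p1 v * i2 v = 0\<^sub>m (rdim M v) (rdim N v) \<and> p2 v * i1 v = 0\<^sub>m (rdim N v) (rdim M v) \<and>
       i1 v * p1 v + i2 v * p2 v = 1\<^sub>m (rdim S v))"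

lemma direct_sum_biproduct:
  assumes "rep M" "rep N"
  obtains i1 i2 p1 p2 where "biproduct M N (direct_sum M N) i1 i2 p1 p2"
proof -
  have "rdim (direct_sum M N) v = rdim M v + rdim N v" for v by (simp add: direct_sum_def)
  then have "biproduct M N (direct_sum M N) (\<lambda>v. in1 (rdim M v) (rdim N v)) (\<lambda>v. in2 (rdim M v) (rdim N v))
      (\<lambda>v. pr1 (rdim M v) (rdim N v)) (\<lambda>v. pr2 (rdim M v) (rdim N v))"
    unfolding biproduct_def using direct_sum_mors[OF assms] by (simp add: pr_in in_pr_sum)
  then show thesis by (rule that)
qed

lemma biproductD:
  assumes "biproduct M N S i1 i2 p1 p2"
  shows "mor M S i1" "mor N S i2" "mor S M p1" "mor S N p2"
    "p1 v * i1 v = 1\<^sub>m (rdim M v)" "p2 v * i2 v = 1\<^sub>m (rdim N v)"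
    "p1 v * i2 v = 0\<^sub>m (rdim M v) (rdim N v)" "p2 v * i1 v = 0\<^sub>m (rdim N v) (rdim M v)"
    "i1 v * p1 v + i2 v * p2 v = 1\<^sub>m (rdim S v)"
  using assms unfolding biproduct_def by blast+

text \<open>Indecomposability expressed through endomorphisms. Unlike decompositions into direct
  sums, endomorphisms can be carried along a reflection one at a time.\<close>

definition trivial_idempotents :: "qrep \<Rightarrow> bool" where
  "trivial_idempotents X \<longleftrightarrow> (\<forall>e. mor X X e \<and> (\<forall>v\<in>{1..n}. e v * e v = e v) \<longrightarrow>
     (\<forall>v\<in>{1..n}. e v = 0\<^sub>m (rdim X v) (rdim X v)) \<or> (\<forall>v\<in>{1..n}. e v = 1\<^sub>m (rdim X v)))"

lemma split_mono_iff:
  "split_mono n Q M N f \<longleftrightarrow> mor M N f \<and> (\<exists>r. mor N M r \<and> (\<forall>v\<in>{1..n}. r v * f v = 1\<^sub>m (rdim M v)))"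
  unfolding split_mono_def mor_eq_def mor_comp_def mor_id_def ..

lemma split_epi_iff:
  "split_epi n Q M N f \<longleftrightarrow> mor M N f \<and> (\<exists>r. mor N M r \<and> (\<forall>v\<in>{1..n}. f v * r v = 1\<^sub>m (rdim N v)))"
  unfolding split_epi_def mor_eq_def mor_comp_def mor_id_def ..

text \<open>Splitting both \<open>e\<close> and \<open>1 - e\<close> exhibits \<open>X\<close> as
  the direct sum of their images; one image must vanish, which makes \<open>e\<close> equal to 0 or
  1.\<close>

lemma trivial_idempotents_if_indecomposable:
  assumes ind: "indecomposable n Q X"
  shows "trivial_idempotents X"
  unfolding trivial_idempotents_def
proof (intro allI impI)
  fix e assume asm: "mor X X e \<and> (\<forall>v\<in>{1..n}. e v * e v = e v)"
  then have e: "mor X X e" and ee: "\<And>v. v \<in> {1..n} \<Longrightarrow> e v * e v = e v" by auto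
  have X: "rep X" using ind unfolding indecomposable_def by auto
  define e' where "e' v = 1\<^sub>m (rdim X v) + (-1) \<cdot>\<^sub>m e v" for v
  have e': "mor X X e'" unfolding e'_def
    by (intro mor_add mor_smult mor_one X e)
  have ed: "dim_row (e v) = rdim X v" "dim_col (e v) = rdim X v"
    "dim_row (e' v) = rdim X v" "dim_col (e' v) = rdim X v" if "v \<in> {1..n}" for v
    using mor_dims[OF e that] by (auto simp: e'_def)
  have cancel: "A + (-1) \<cdot>\<^sub>m A = 0\<^sub>m (dim_row A) (dim_col A)" for A :: "complex mat"
    by (intro eq_matI) auto
  have e'_mult: "e' v * Y = Y + (-1) \<cdot>\<^sub>m (e v * Y)" if "v \<in> {1..n}" "dim_row Y = rdim X v" for v Y
    unfolding e'_def using ed[OF that(1)] that(2) by (simp add: add_mult_dim smult_mult_dim)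
  have mult_e': "Y * e' v = Y + (-1) \<cdot>\<^sub>m (Y * e v)" if "v \<in> {1..n}" "dim_col Y = rdim X v" for v Y
    unfolding e'_def using ed[OF that(1)] that(2) by (simp add: mult_add_dim mult_smult_dim)
  have e'e: "e' v * e v = 0\<^sub>m (rdim X v) (rdim X v)" "e v * e' v = 0\<^sub>m (rdim X v) (rdim X v)" if "v \<in> {1..n}" for v
    using e'_mult[OF that, of "e v"] mult_e'[OF that, of "e v"] ed[OF that] ee[OF that] cancel[of "e v"] by simp_all
  have e'e': "e' v * e' v = e' v" if "v \<in> {1..n}" for v
  proof -
    have "e' v * e' v = e' v + (-1) \<cdot>\<^sub>m (e v * e' v)" using e'_mult[OF that, of "e' v"] ed[OF that] by simp
    also have "\<dots> = e' v" using e'e[OF that] ed[OF that] by (intro eq_matI) auto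
    finally show ?thesis .
  qed
  have sum1: "e v + e' v = 1\<^sub>m (rdim X v)" if "v \<in> {1..n}" for v
    unfolding e'_def using ed[OF that] by (intro eq_matI) auto
  obtain M P R where M: "rep M" and P_mor: "mor M X P" and R_mor: "mor X M R"
    and RP: "\<And>v. v \<in> {1..n} \<Longrightarrow> R v * P v = 1\<^sub>m (rdim M v)" and PR: "\<And>v. v \<in> {1..n} \<Longrightarrow> P v * R v = e v"
    using split_idempotent[OF X e ee] by blast
  obtain M' P' R' where M': "rep M'" and P'_mor: "mor M' X P'" and R'_mor: "mor X M' R'"
    and RP2: "\<And>v. v \<in> {1..n} \<Longrightarrow> R' v * P' v = 1\<^sub>m (rdim M' v)" and PR2: "\<And>v. v \<in> {1..n} \<Longrightarrow> P' v * R' v = e' v"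
    using split_idempotent[OF X e' e'e'] by blast
  have d: "dim_row (P v) = rdim X v" "dim_col (P v) = rdim M v" "dim_row (R v) = rdim M v" "dim_col (R v) = rdim X v"
    "dim_row (P' v) = rdim X v" "dim_col (P' v) = rdim M' v" "dim_row (R' v) = rdim M' v" "dim_col (R' v) = rdim X v"
    if "v \<in> {1..n}" for v
    using mor_dims[OF P_mor that] mor_dims[OF R_mor that] mor_dims[OF P'_mor that] mor_dims[OF R'_mor that] by simp_all
  \<comment> \<open>Inserting \<open>R * P = 1\<close> on the left and \<open>R' * P' = 1\<close> on
    the right exposes the product \<open>e * e' = 0\<close>.\<close>
  have RP': "R v * P' v = 0\<^sub>m (rdim M v) (rdim M' v)" if v: "v \<in> {1..n}" for v
  proof -
    have "R v * P' v = (R v * P v) * (R v * P' v) * (R' v * P' v)"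
      unfolding RP[OF v] RP2[OF v] using d[OF v] by simp
    also have "\<dots> = R v * (((P v * R v) * (P' v * R' v)) * P' v)"
      using d[OF v] by (simp add: mult_assoc_dim)
    finally show ?thesis unfolding PR[OF v] PR2[OF v] using e'e[OF v] d[OF v] by simp
  qed
  have R'P: "R' v * P v = 0\<^sub>m (rdim M' v) (rdim M v)" if v: "v \<in> {1..n}" for v
  proof -
    have "R' v * P v = (R' v * P' v) * (R' v * P v) * (R v * P v)"
      unfolding RP[OF v] RP2[OF v] using d[OF v] by simp
    also have "\<dots> = R' v * (((P' v * R' v) * (P v * R v)) * P v)"
      using d[OF v] by (simp add: mult_assoc_dim)
    finally show ?thesis unfolding PR[OF v] PR2[OF v] using e'e[OF v] d[OF v] by simp
  qed
  let ?S = "direct_sum M M'"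
  obtain i1 i2 p1 p2 where bp: "biproduct M M' ?S i1 i2 p1 p2" by (rule direct_sum_biproduct[OF M M'])
  note S = direct_sum_rep[OF M M'] and ds = biproductD(1-4)[OF bp] and pi = biproductD(5-9)[OF bp]
  have dsd: "dim_row (i1 v) = rdim ?S v" "dim_col (i1 v) = rdim M v" "dim_row (i2 v) = rdim ?S v"
    "dim_col (i2 v) = rdim M' v" "dim_col (p1 v) = rdim ?S v" "dim_row (p1 v) = rdim M v"
    "dim_col (p2 v) = rdim ?S v" "dim_row (p2 v) = rdim M' v" if "v \<in> {1..n}" for v
    using ds that by (simp_all add: mor_dims)
  let ?f = "\<lambda>v. i1 v * R v + i2 v * R' v" and ?g = "\<lambda>v. P v * p1 v + P' v * p2 v"
  have "isomorphic n Q X ?S"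
    unfolding isomorphic_def
  proof (intro exI conjI)
    show "mor X ?S ?f"
      by (intro mor_add mor_comp_mor[where L = M] mor_comp_mor[where L = M'] X M M' S R_mor R'_mor ds)
    show "mor ?S X ?g"
      by (intro mor_add mor_comp_mor[where L = M] mor_comp_mor[where L = M'] X M M' S P_mor P'_mor ds)
    show "mor_eq n (mor_comp ?g ?f) (mor_id X)"
      unfolding mor_eq_def mor_comp_def mor_id_def
    proof
      fix v assume v: "v \<in> {1..n}"
      have "?g v * ?f v = P v * ((p1 v * i1 v) * R v) + P' v * ((p2 v * i1 v) * R v) +
        (P v * ((p1 v * i2 v) * R' v) + P' v * ((p2 v * i2 v) * R' v))"
        using d[OF v] dsd[OF v] by (simp add: add_mult_dim mult_add_dim mult_assoc_dim)
      also have "\<dots> = e v + e' v"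
        unfolding pi using d[OF v] PR[OF v] PR2[OF v] by (simp add: add_zero_dim ed[OF v])
      finally show "?g v * ?f v = 1\<^sub>m (rdim X v)" using sum1[OF v] by simp
    qed
    show "mor_eq n (mor_comp ?f ?g) (mor_id ?S)"
      unfolding mor_eq_def mor_comp_def mor_id_def
    proof
      fix v assume v: "v \<in> {1..n}"
      have "?f v * ?g v = i1 v * ((R v * P v) * p1 v) + i2 v * ((R' v * P v) * p1 v) +
        (i1 v * ((R v * P' v) * p2 v) + i2 v * ((R' v * P' v) * p2 v))"
        using d[OF v] dsd[OF v] by (simp add: add_mult_dim mult_add_dim mult_assoc_dim)
      also have "\<dots> = i1 v * p1 v + i2 v * p2 v"
        unfolding RP[OF v] RP2[OF v] RP'[OF v] R'P[OF v] using dsd[OF v] by (simp add: add_zero_dim)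
      finally show "?f v * ?g v = 1\<^sub>m (rdim ?S v)" using pi(5)[of v] by simp
    qed
  qed
  with ind M M' consider "zero_rep n M" | "zero_rep n M'" unfolding indecomposable_def by blast
  then show "(\<forall>v\<in>{1..n}. e v = 0\<^sub>m (rdim X v) (rdim X v)) \<or> (\<forall>v\<in>{1..n}. e v = 1\<^sub>m (rdim X v))"
  proof cases
    case 1
    have "e v = 0\<^sub>m (rdim X v) (rdim X v)" if v: "v \<in> {1..n}" for v
    proof -
      have "rdim M v = 0" using 1 v by (auto simp: zero_rep_def)
      then have "P v * R v = 0\<^sub>m (rdim X v) (rdim X v)"
        using d[OF v] by (intro eq_matI) (auto simp: scalar_prod_def)
      then show ?thesis using PR[OF v] by simp
    qed
    then show ?thesis by blast
  next
    case 2
    have "e v = 1\<^sub>m (rdim X v)" if v: "v \<in> {1..n}" for v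
    proof -
      have "rdim M' v = 0" using 2 v by (auto simp: zero_rep_def)
      then have "P' v * R' v = 0\<^sub>m (rdim X v) (rdim X v)"
        using d[OF v] by (intro eq_matI) (auto simp: scalar_prod_def)
      then have "e' v = 0\<^sub>m (rdim X v) (rdim X v)" using PR2[OF v] by simp
      then show ?thesis using sum1[OF v] ed[OF v] by (simp add: add_zero_dim)
    qed
    then show ?thesis by blast
  qed
qed

lemma isomorphicE:
  assumes "isomorphic n Q X Y"
  obtains f g where "mor X Y f" "mor Y X g"
    "\<forall>v\<in>{1..n}. g v * f v = 1\<^sub>m (rdim X v)" "\<forall>v\<in>{1..n}. f v * g v = 1\<^sub>m (rdim Y v)"
  using assms unfolding isomorphic_def mor_eq_def mor_comp_def mor_id_def by auto

lemma isomorphicI: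
  assumes "mor X Y f" "mor Y X g"
    "\<And>v. v \<in> {1..n} \<Longrightarrow> g v * f v = 1\<^sub>m (rdim X v)" "\<And>v. v \<in> {1..n} \<Longrightarrow> f v * g v = 1\<^sub>m (rdim Y v)"
  shows "isomorphic n Q X Y"
  using assms unfolding isomorphic_def mor_eq_def mor_comp_def mor_id_def by blast

lemma isomorphic_refl: "rep X \<Longrightarrow> isomorphic n Q X X"
  using mor_one by (intro isomorphicI) auto

lemma isomorphic_sym: "isomorphic n Q X Y \<Longrightarrow> isomorphic n Q Y X"
  unfolding isomorphic_def by blast

lemma isomorphic_trans:
  assumes "rep X" "rep Y" "rep Z" "isomorphic n Q X Y" "isomorphic n Q Y Z"
  shows "isomorphic n Q X Z"
proof -
  obtain f g where fg: "mor X Y f" "mor Y X g" "\<forall>v\<in>{1..n}. g v * f v = 1\<^sub>m (rdim X v)"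
    "\<forall>v\<in>{1..n}. f v * g v = 1\<^sub>m (rdim Y v)"
    by (rule isomorphicE[OF assms(4)])
  obtain f' g' where fg': "mor Y Z f'" "mor Z Y g'" "\<forall>v\<in>{1..n}. g' v * f' v = 1\<^sub>m (rdim Y v)"
    "\<forall>v\<in>{1..n}. f' v * g' v = 1\<^sub>m (rdim Z v)"
    by (rule isomorphicE[OF assms(5)])
  show ?thesis
  proof (rule isomorphicI)
    fix v assume v: "v \<in> {1..n}"
    note d = mor_dims[OF fg(1) v] mor_dims[OF fg(2) v] mor_dims[OF fg'(1) v] mor_dims[OF fg'(2) v]
    have "(g v * g' v) * (f' v * f v) = g v * ((g' v * f' v) * f v)" using d by (simp add: mult_assoc_dim)
    then show "(g v * g' v) * (f' v * f v) = 1\<^sub>m (rdim X v)" using d fg(3)[rule_format, OF v] fg'(3)[rule_format, OF v] by simp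
    have "(f' v * f v) * (g v * g' v) = f' v * ((f v * g v) * g' v)" using d by (simp add: mult_assoc_dim)
    then show "(f' v * f v) * (g v * g' v) = 1\<^sub>m (rdim Z v)" using d fg(4)[rule_format, OF v] fg'(4)[rule_format, OF v] by simp
  qed (use mor_comp_mor assms(1-3) fg(1,2) fg'(1,2) in blast)+
qed

lemma isomorphic_rdim:
  assumes "isomorphic n Q X Y" "v \<in> {1..n}"
  shows "rdim X v = rdim Y v"
proof -
  obtain f g where fg: "mor X Y f" "mor Y X g" "\<forall>v\<in>{1..n}. g v * f v = 1\<^sub>m (rdim X v)"
    "\<forall>v\<in>{1..n}. f v * g v = 1\<^sub>m (rdim Y v)"
    by (rule isomorphicE[OF assms(1)])
  show ?thesis
    using inverse_mat_dims[OF mor_carrier[OF fg(2) assms(2)] mor_carrier[OF fg(1) assms(2)]] fg(3,4) assms(2)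
    by simp
qed

lemma isomorphic_zero_rep: "isomorphic n Q X Y \<Longrightarrow> zero_rep n X \<longleftrightarrow> zero_rep n Y"
  unfolding zero_rep_def using isomorphic_rdim by simp

lemma indecomposable_if_trivial_idempotents:
  assumes X: "rep X" and nz: "\<not> zero_rep n X" and triv: "trivial_idempotents X"
  shows "indecomposable n Q X"
  unfolding indecomposable_def
proof (intro conjI allI impI X nz)
  fix M M' assume "rep M \<and> rep M' \<and> isomorphic n Q X (direct_sum M M')"
  then have M: "rep M" and M': "rep M'" and iso: "isomorphic n Q X (direct_sum M M')" by auto
  let ?S = "direct_sum M M'"
  obtain f g where f: "mor X ?S f" and g: "mor ?S X g"
    and "\<forall>v\<in>{1..n}. g v * f v = 1\<^sub>m (rdim X v)"
    and fg: "\<forall>v\<in>{1..n}. f v * g v = 1\<^sub>m (rdim ?S v)"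
    by (rule isomorphicE[OF iso])
  obtain i1 i2 p1 p2 where bp: "biproduct M M' ?S i1 i2 p1 p2" by (rule direct_sum_biproduct[OF M M'])
  note S = direct_sum_rep[OF M M'] and ds = biproductD(1-4)[OF bp] and pi = biproductD(5-9)[OF bp]
  have d: "dim_row (i1 v) = rdim ?S v" "dim_col (i1 v) = rdim M v" "dim_row (i2 v) = rdim ?S v"
    "dim_col (i2 v) = rdim M' v" "dim_col (p1 v) = rdim ?S v" "dim_row (p1 v) = rdim M v"
    "dim_col (p2 v) = rdim ?S v" "dim_row (p2 v) = rdim M' v" "dim_row (f v) = rdim ?S v"
    "dim_col (f v) = rdim X v" "dim_col (g v) = rdim ?S v" "dim_row (g v) = rdim X v" if "v \<in> {1..n}" for v
    using ds f g that by (simp_all add: mor_dims)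
  have fgc: "f v * (g v * Y) = Y" if "v \<in> {1..n}" "dim_row Y = rdim ?S v" for v Y
    using mult_cancel_assoc[OF fg[rule_format, OF that(1)]] d[OF that(1)] that(2) by simp
  \<comment> \<open>The projection onto the first summand, transported to \<open>X\<close>: if it is
    zero then \<open>M\<close> vanishes, if it is the identity then \<open>M'\<close>
    vanishes.\<close>
  let ?e = "\<lambda>v. g v * (i1 v * (p1 v * f v))"
  have e: "mor X X ?e"
    by (intro mor_comp_mor[where L = ?S] mor_comp_mor[where L = M] X M S f g ds)
  have "?e v * ?e v = ?e v" if v: "v \<in> {1..n}" for v
  proof -
    have "?e v * ?e v = g v * (i1 v * (p1 v * (f v * (g v * (i1 v * (p1 v * f v))))))"
      using d[OF v] by (simp add: mult_assoc_dim)
    also have "\<dots> = g v * (i1 v * ((p1 v * i1 v) * (p1 v * f v)))"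
      using d[OF v] fgc[OF v] by (simp add: mult_assoc_dim)
    finally show ?thesis using d[OF v] pi(1) by simp
  qed
  with triv e consider "\<forall>v\<in>{1..n}. ?e v = 0\<^sub>m (rdim X v) (rdim X v)" | "\<forall>v\<in>{1..n}. ?e v = 1\<^sub>m (rdim X v)"
    unfolding trivial_idempotents_def by meson
  then show "zero_rep n M \<or> zero_rep n M'"
  proof cases
    case 1
    have "rdim M v = 0" if v: "v \<in> {1..n}" for v
    proof -
      have "p1 v * (f v * (?e v * (g v * i1 v))) = (p1 v * i1 v) * (p1 v * i1 v)"
        using d[OF v] fgc[OF v] by (simp add: mult_assoc_dim)
      then have "1\<^sub>m (rdim M v) = (0\<^sub>m (rdim M v) (rdim M v) :: complex mat)"
        using 1 v d[OF v] pi(1) by simp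
      then show ?thesis by (simp add: one_mat_eq_zero_mat)
    qed
    then show ?thesis unfolding zero_rep_def by blast
  next
    case 2
    have "rdim M' v = 0" if v: "v \<in> {1..n}" for v
    proof -
      have "p2 v * (f v * (?e v * (g v * i2 v))) = (p2 v * i1 v) * (p1 v * i2 v)"
        using d[OF v] fgc[OF v] by (simp add: mult_assoc_dim)
      moreover have "p2 v * (f v * (1\<^sub>m (rdim X v) * (g v * i2 v))) = p2 v * i2 v"
        using d[OF v] fgc[OF v] by simp
      ultimately have "1\<^sub>m (rdim M' v) = (0\<^sub>m (rdim M' v) (rdim M' v) :: complex mat)"
        using 2 v d[OF v] pi by simp
      then show ?thesis by (simp add: one_mat_eq_zero_mat)
    qed
    then show ?thesis unfolding zero_rep_def by blast
  qed
qed

text \<open>Stronger than indecomposability, and the form in which existence is proved along the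
  word. Scalars can be compared at a single vertex with nonzero space, which makes composites easy
  to control.\<close>

definition brick :: "qrep \<Rightarrow> bool" where
  "brick X \<longleftrightarrow> rep X \<and> \<not> zero_rep n X \<and>
     (\<forall>e. mor X X e \<longrightarrow> (\<exists>c. \<forall>v\<in>{1..n}. e v = c \<cdot>\<^sub>m 1\<^sub>m (rdim X v)))"

lemma brick_rep: "brick X \<Longrightarrow> rep X"
  unfolding brick_def by blast

lemma brick_endo:
  assumes "brick X" "mor X X e"
  obtains c where "\<forall>v\<in>{1..n}. e v = c \<cdot>\<^sub>m 1\<^sub>m (rdim X v)"
  using assms unfolding brick_def by blast

lemma smult_one_eq:
  assumes "k \<noteq> 0" "c \<cdot>\<^sub>m (1\<^sub>m k :: complex mat) = c' \<cdot>\<^sub>m 1\<^sub>m k"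
  shows "c = c'"
proof -
  have "(c \<cdot>\<^sub>m (1\<^sub>m k :: complex mat)) $$ (0, 0) = (c' \<cdot>\<^sub>m 1\<^sub>m k) $$ (0, 0)" using assms by simp
  then show ?thesis using assms(1) by simp
qed

lemma brick_indecomposable:
  assumes "brick X"
  shows "indecomposable n Q X"
proof (rule indecomposable_if_trivial_idempotents)
  show X: "rep X" and nz: "\<not> zero_rep n X" using assms unfolding brick_def by auto
  show "trivial_idempotents X"
    unfolding trivial_idempotents_def
  proof (intro allI impI)
    fix e assume e: "mor X X e \<and> (\<forall>v\<in>{1..n}. e v * e v = e v)"
    from e have "mor X X e" ..
    then obtain c where c: "\<forall>v\<in>{1..n}. e v = c \<cdot>\<^sub>m 1\<^sub>m (rdim X v)"
      by (rule brick_endo[OF assms])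
    obtain v where v: "v \<in> {1..n}" "rdim X v \<noteq> 0" using nz unfolding zero_rep_def by blast
    have "(c * c) \<cdot>\<^sub>m (1\<^sub>m (rdim X v) :: complex mat) = c \<cdot>\<^sub>m 1\<^sub>m (rdim X v)"
    proof -
      have "e v * e v = e v" using e v(1) by blast
      then show ?thesis unfolding c[rule_format, OF v(1)]
        by (simp add: smult_mult_dim mult_smult_dim smult_smult_mat)
    qed
    from smult_one_eq[OF v(2) this] have "c = 0 \<or> c = 1" by simp
    then show "(\<forall>v\<in>{1..n}. e v = 0\<^sub>m (rdim X v) (rdim X v)) \<or> (\<forall>v\<in>{1..n}. e v = 1\<^sub>m (rdim X v))"
      using c by (auto simp: zero_smult_mat one_smult_mat)
  qed
qed

lemma brick_isomorphic:
  assumes X: "brick X" and Y: "rep Y" and iso: "isomorphic n Q X Y"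
  shows "brick Y"
  unfolding brick_def
proof (intro conjI allI impI Y)
  show "\<not> zero_rep n Y" using X isomorphic_zero_rep[OF iso] unfolding brick_def by simp
  fix e assume e: "mor Y Y e"
  obtain f g where fg: "mor X Y f" "mor Y X g" and "\<forall>v\<in>{1..n}. g v * f v = 1\<^sub>m (rdim X v)"
    and fg': "\<forall>v\<in>{1..n}. f v * g v = 1\<^sub>m (rdim Y v)"
    by (rule isomorphicE[OF iso])
  have "mor X X (\<lambda>v. g v * (e v * f v))"
    by (intro mor_comp_mor[where L = Y] brick_rep X Y e fg)
  then obtain c where c: "\<forall>v\<in>{1..n}. g v * (e v * f v) = c \<cdot>\<^sub>m 1\<^sub>m (rdim X v)"
    by (rule brick_endo[OF X])
  have "e v = c \<cdot>\<^sub>m 1\<^sub>m (rdim Y v)" if v: "v \<in> {1..n}" for v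
  proof -
    note d = mor_dims[OF fg(1) v] mor_dims[OF fg(2) v] mor_dims[OF e v]
    have "e v = (f v * g v) * e v * (f v * g v)" using fg'[rule_format, OF v] d by simp
    also have "\<dots> = f v * ((g v * (e v * f v)) * g v)" using d by (simp add: mult_assoc_dim)
    also have "\<dots> = c \<cdot>\<^sub>m (f v * g v)" unfolding c[rule_format, OF v] using d by (simp add: smult_mult_dim mult_smult_dim)
    finally show ?thesis using fg'[rule_format, OF v] by simp
  qed
  then show "\<exists>c. \<forall>v\<in>{1..n}. e v = c \<cdot>\<^sub>m 1\<^sub>m (rdim Y v)" by blast
qed

text \<open>For bricks \<open>M\<close> and \<open>N\<close> this is the square of the radical: a morphism from or to a brick is
  radical iff it composes to zero with all morphisms in the opposite direction.\<close>

definition rad2 :: "qrep \<Rightarrow> qrep \<Rightarrow> qmor \<Rightarrow> bool" where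
  "rad2 M N f \<longleftrightarrow> (\<exists>L h g. rep L \<and> mor M L h \<and> mor L N g \<and> (\<forall>v\<in>{1..n}. f v = g v * h v) \<and>
     (\<forall>r. mor L M r \<longrightarrow> (\<forall>v\<in>{1..n}. r v * h v = 0\<^sub>m (rdim M v) (rdim M v))) \<and>
     (\<forall>r. mor N L r \<longrightarrow> (\<forall>v\<in>{1..n}. g v * r v = 0\<^sub>m (rdim N v) (rdim N v))))"

text \<open>The two middle terms are joined by a direct sum. A morphism from it to \<open>M\<close>,
  or into it from \<open>N\<close>, splits into components on \<open>L\<close> and
  \<open>L'\<close>, where the vanishing conditions are known.\<close>

lemma rad2_add:
  assumes M: "rep M" and N: "rep N" and f: "rad2 M N f" and f': "rad2 M N f'"
  shows "rad2 M N (\<lambda>v. f v + f' v)"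
proof -
  obtain L h g where L: "rep L" "mor M L h" "mor L N g" "\<And>v. v\<in>{1..n} \<Longrightarrow> f v = g v * h v"
    "\<And>r v. mor L M r \<Longrightarrow> v\<in>{1..n} \<Longrightarrow> r v * h v = 0\<^sub>m (rdim M v) (rdim M v)"
    "\<And>r v. mor N L r \<Longrightarrow> v\<in>{1..n} \<Longrightarrow> g v * r v = 0\<^sub>m (rdim N v) (rdim N v)"
    using f unfolding rad2_def by blast
  obtain L' h' g' where L': "rep L'" "mor M L' h'" "mor L' N g'" "\<And>v. v\<in>{1..n} \<Longrightarrow> f' v = g' v * h' v"
    "\<And>r v. mor L' M r \<Longrightarrow> v\<in>{1..n} \<Longrightarrow> r v * h' v = 0\<^sub>m (rdim M v) (rdim M v)"
    "\<And>r v. mor N L' r \<Longrightarrow> v\<in>{1..n} \<Longrightarrow> g' v * r v = 0\<^sub>m (rdim N v) (rdim N v)"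
    using f' unfolding rad2_def by blast
  let ?S = "direct_sum L L'"
  obtain i1 i2 p1 p2 where bp: "biproduct L L' ?S i1 i2 p1 p2" by (rule direct_sum_biproduct[OF L(1) L'(1)])
  note S = direct_sum_rep[OF L(1) L'(1)] and ds = biproductD(1-4)[OF bp] and pi = biproductD(5-9)[OF bp]
  let ?h = "\<lambda>v. i1 v * h v + i2 v * h' v" and ?g = "\<lambda>v. g v * p1 v + g' v * p2 v"
  note Ls = L(1-3) L'(1-3)
  show ?thesis
    unfolding rad2_def
  proof (rule exI[of _ ?S], rule exI[of _ ?h], rule exI[of _ ?g], intro conjI allI impI ballI)
    show "rep ?S" by (rule S)
    show "mor M ?S ?h"
      by (intro mor_add mor_comp_mor[where L = L] mor_comp_mor[where L = L'] M S Ls ds)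
    show "mor ?S N ?g"
      by (intro mor_add mor_comp_mor[where L = L] mor_comp_mor[where L = L'] N S Ls ds)
  next
    fix v assume v: "v \<in> {1..n}"
    note d = mor_dims[OF L(2) v] mor_dims[OF L(3) v] mor_dims[OF L'(2) v] mor_dims[OF L'(3) v]
      mor_dims[OF ds(1) v] mor_dims[OF ds(2) v] mor_dims[OF ds(3) v] mor_dims[OF ds(4) v]
    have "?g v * ?h v = g v * ((p1 v * i1 v) * h v) + g' v * ((p2 v * i1 v) * h v) +
        (g v * ((p1 v * i2 v) * h' v) + g' v * ((p2 v * i2 v) * h' v))"
      using d by (simp add: add_mult_dim mult_add_dim mult_assoc_dim)
    also have "\<dots> = g v * h v + g' v * h' v"
      unfolding pi using d by (simp add: add_zero_dim)
    finally show "f v + f' v = ?g v * ?h v" using L(4)[OF v] L'(4)[OF v] by simp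
  next
    fix r v assume r: "mor ?S M r" and v: "v \<in> {1..n}"
    note d = mor_dims[OF L(2) v] mor_dims[OF L'(2) v] mor_dims[OF r v] mor_dims[OF ds(1) v] mor_dims[OF ds(2) v]
    have "mor L M (\<lambda>v. r v * i1 v)" "mor L' M (\<lambda>v. r v * i2 v)"
      by (intro mor_comp_mor[where L = ?S] M S Ls r ds)+
    then have z: "(r v * i1 v) * h v = 0\<^sub>m (rdim M v) (rdim M v)" "(r v * i2 v) * h' v = 0\<^sub>m (rdim M v) (rdim M v)"
      using L(5)[OF _ v] L'(5)[OF _ v] by blast+
    have "r v * ?h v = (r v * i1 v) * h v + (r v * i2 v) * h' v"
      using d by (simp add: mult_add_dim mult_assoc_dim)
    then show "r v * ?h v = 0\<^sub>m (rdim M v) (rdim M v)" unfolding z by simp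
  next
    fix r v assume r: "mor N ?S r" and v: "v \<in> {1..n}"
    note d = mor_dims[OF L(3) v] mor_dims[OF L'(3) v] mor_dims[OF r v] mor_dims[OF ds(3) v] mor_dims[OF ds(4) v]
    have "mor N L (\<lambda>v. p1 v * r v)" "mor N L' (\<lambda>v. p2 v * r v)"
      by (intro mor_comp_mor[where L = ?S] N S Ls r ds)+
    then have z: "g v * (p1 v * r v) = 0\<^sub>m (rdim N v) (rdim N v)" "g' v * (p2 v * r v) = 0\<^sub>m (rdim N v) (rdim N v)"
      using L(6)[OF _ v] L'(6)[OF _ v] by blast+
    have "?g v * r v = g v * (p1 v * r v) + g' v * (p2 v * r v)"
      using d by (simp add: add_mult_dim mult_assoc_dim)
    then show "?g v * r v = 0\<^sub>m (rdim N v) (rdim N v)" unfolding z by simp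
  qed
qed

lemma rad2_zero:
  assumes "rep M" "rep N" "\<And>v. v \<in> {1..n} \<Longrightarrow> f v = 0\<^sub>m (rdim N v) (rdim M v)"
  shows "rad2 M N f"
  unfolding rad2_def
proof (rule exI[of _ M], rule exI[of _ "\<lambda>v. 0\<^sub>m (rdim M v) (rdim M v)"],
    rule exI[of _ "\<lambda>v. 0\<^sub>m (rdim N v) (rdim M v)"], intro conjI allI impI ballI)
  fix r v assume v: "v \<in> {1..n}"
  show "r v * 0\<^sub>m (rdim M v) (rdim M v) = 0\<^sub>m (rdim M v) (rdim M v)" if "mor M M r"
    using mor_dims[OF that v] by simp
  show "0\<^sub>m (rdim N v) (rdim M v) * r v = 0\<^sub>m (rdim N v) (rdim N v)" if "mor N M r"
    using mor_dims[OF that v] by simp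
qed (use assms mor_zero in auto)

text \<open>A splitting of either factor would be a composite in the opposite direction that is both
  zero and the identity of a nonzero representation.\<close>

lemma rad2_not_irreducible:
  assumes "rad2 M N f" "\<not> zero_rep n M" "\<not> zero_rep n N"
  shows "\<not> irreducible_morphism n Q M N f"
proof
  assume irr: "irreducible_morphism n Q M N f"
  obtain L h g where L: "rep L" "mor M L h" "mor L N g" "\<And>v. v\<in>{1..n} \<Longrightarrow> f v = g v * h v"
    "\<And>r v. mor L M r \<Longrightarrow> v\<in>{1..n} \<Longrightarrow> r v * h v = 0\<^sub>m (rdim M v) (rdim M v)"
    "\<And>r v. mor N L r \<Longrightarrow> v\<in>{1..n} \<Longrightarrow> g v * r v = 0\<^sub>m (rdim N v) (rdim N v)"
    using assms(1) unfolding rad2_def by blast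
  have "mor_eq n f (mor_comp g h)" using L(4) unfolding mor_eq_def mor_comp_def by blast
  then consider "split_mono n Q M L h" | "split_epi n Q L N g"
    using irr L(1-3) unfolding irreducible_morphism_def by blast
  then show False
  proof cases
    case 1
    then obtain r where r: "mor L M r" "\<forall>v\<in>{1..n}. r v * h v = 1\<^sub>m (rdim M v)"
      unfolding split_mono_iff by blast
    have "rdim M v = 0" if "v \<in> {1..n}" for v
      using r(2) L(5)[OF r(1) that] that one_mat_eq_zero_mat[of "rdim M v", where 'a = complex]
      by simp
    then show False using assms(2) unfolding zero_rep_def by blast
  next
    case 2
    then obtain r where r: "mor N L r" "\<forall>v\<in>{1..n}. g v * r v = 1\<^sub>m (rdim N v)"
      unfolding split_epi_iff by blast
    have "rdim N v = 0" if "v \<in> {1..n}" for v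
      using r(2) L(6)[OF r(1) that] that one_mat_eq_zero_mat[of "rdim N v", where 'a = complex]
      by simp
    then show False using assms(3) unfolding zero_rep_def by blast
  qed
qed

end

section \<open>Reflection at a sink\<close>

locale sink_quiv = quiv +
  fixes a :: nat
  assumes a_vertex: "a \<in> {1..n}" and a_sink: "(a, t) \<notin> Q"
begin

abbreviation Q' :: quiver where "Q' \<equiv> reverse_at a Q"

definition nb :: "nat set" where "nb = {b. (b, a) \<in> Q}"

lemma nb_vertex: "b \<in> nb \<Longrightarrow> b \<in> {1..n}" "b \<in> nb \<Longrightarrow> b \<noteq> a"
  using arrow unfolding nb_def by auto

lemma finite_nb [simp]: "finite nb"
  using nb_vertex(1) by (meson finite_atLeastAtMost finite_subset subsetI)

lemma reversed_arrow: "(s, t) \<in> Q' \<longleftrightarrow> (s, t) \<in> Q \<and> t \<noteq> a \<or> s = a \<and> t \<in> nb"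
  unfolding reverse_at_def nb_def by auto

sublocale R: quiv n "reverse_at a Q"
  using arrow nb_vertex a_vertex by unfold_locales (auto simp: reversed_arrow)

text \<open>The map from the sum of the neighbouring spaces to the space at the sink, whose kernel
  defines the Bernstein-Gelfand-Ponomarev reflection functor; \<open>out_map\<close> is the dual map
  of a representation of the reversed quiver, whose cokernel defines the inverse reflection.\<close>

definition in_map :: "qrep \<Rightarrow> complex mat" where
  "in_map X = copair nb (rdim X) (rdim X a) (\<lambda>b. rmap X (b, a))"

definition out_map :: "qrep \<Rightarrow> complex mat" where
  "out_map X = pairing nb (rdim X) (rdim X a) (\<lambda>b. rmap X (a, b))"

abbreviation diag :: "qrep \<Rightarrow> qrep \<Rightarrow> qmor \<Rightarrow> complex mat" where
  "diag X Y f \<equiv> block_diag nb (rdim X) (rdim Y) f"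

lemma map_dims [simp]:
  "dim_row (in_map X) = rdim X a" "dim_col (in_map X) = tot nb (rdim X)"
  "dim_row (out_map X) = tot nb (rdim X)" "dim_col (out_map X) = rdim X a"
  by (auto simp: in_map_def out_map_def)

lemma in_map_incl:
  assumes "rep X" "b \<in> nb"
  shows "in_map X * incl nb (rdim X) b = rmap X (b, a)"
proof -
  have "rmap X (b, a) \<in> carrier_mat (rdim X a) (rdim X b)"
    using assms by (auto simp: representation_def nb_def)
  then show ?thesis unfolding in_map_def by (subst copair_incl[OF finite_nb assms(2)]) auto
qed

lemma proj_out_map:
  assumes "R.rep X" "b \<in> nb"
  shows "proj nb (rdim X) b * out_map X = rmap X (a, b)"
  unfolding out_map_def using assms reversed_arrow
  by (subst proj_pairing) (auto simp: representation_def)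

text \<open>The squares at the arrows into \<open>a\<close> are the block components of one matrix
  equation. The remaining arrows are shared with the reversed quiver, so morphisms on the two sides
  differ in this last equation only.\<close>

lemma mor_sink_iff:
  assumes X: "rep X" and Y: "rep Y"
  shows "mor X Y f \<longleftrightarrow> (\<forall>v\<in>{1..n}. f v \<in> carrier_mat (rdim Y v) (rdim X v)) \<and>
    (\<forall>s t. (s, t) \<in> Q \<longrightarrow> t \<noteq> a \<longrightarrow> f t * rmap X (s, t) = rmap Y (s, t) * f s) \<and>
    f a * in_map X = in_map Y * diag X Y f" (is "_ \<longleftrightarrow> ?C \<and> ?E \<and> ?A")
proof (cases ?C)
  case True
  then have c: "\<And>v. v \<in> {1..n} \<Longrightarrow> f v \<in> carrier_mat (rdim Y v) (rdim X v)" by blast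
  have key: "f a * in_map X * incl nb (rdim X) b = f a * rmap X (b, a)"
    "in_map Y * diag X Y f * incl nb (rdim X) b = rmap Y (b, a) * f b" if b: "b \<in> nb" for b
  proof -
    show "f a * in_map X * incl nb (rdim X) b = f a * rmap X (b, a)"
      using in_map_incl[OF X b] c[OF a_vertex] by (simp add: mult_assoc_dim)
    have "in_map Y * diag X Y f * incl nb (rdim X) b = in_map Y * (incl nb (rdim Y) b * f b)"
      using block_diag_incl[of nb b f "rdim Y" "rdim X"] b c[OF nb_vertex(1)[OF b]]
      by (simp add: mult_assoc_dim)
    also have "\<dots> = rmap Y (b, a) * f b"
      using in_map_incl[OF Y b, symmetric] c[OF nb_vertex(1)[OF b]] by (simp add: mult_assoc_dim)
    finally show "in_map Y * diag X Y f * incl nb (rdim X) b = rmap Y (b, a) * f b" .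
  qed
  have "?A \<longleftrightarrow> (\<forall>b\<in>nb. f a * rmap X (b, a) = rmap Y (b, a) * f b)"
  proof
    assume ?A
    then show "\<forall>b\<in>nb. f a * rmap X (b, a) = rmap Y (b, a) * f b" using key by metis
  next
    assume *: "\<forall>b\<in>nb. f a * rmap X (b, a) = rmap Y (b, a) * f b"
    show ?A
      by (rule copair_ext[of nb _ "rdim X"]) (use * key c[OF a_vertex] in auto)
  qed
  moreover have "mor X Y f \<longleftrightarrow> ?E \<and> (\<forall>b\<in>nb. f a * rmap X (b, a) = rmap Y (b, a) * f b)"
    using True unfolding morphism_def nb_def by blast
  ultimately show ?thesis using True by blast
next
  case False
  then show ?thesis unfolding morphism_def by blast
qed

lemma mor_source_iff:
  assumes X: "R.rep X" and Y: "R.rep Y"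
  shows "R.mor X Y f \<longleftrightarrow> (\<forall>v\<in>{1..n}. f v \<in> carrier_mat (rdim Y v) (rdim X v)) \<and>
    (\<forall>s t. (s, t) \<in> Q \<longrightarrow> t \<noteq> a \<longrightarrow> f t * rmap X (s, t) = rmap Y (s, t) * f s) \<and>
    out_map Y * f a = diag X Y f * out_map X" (is "_ \<longleftrightarrow> ?C \<and> ?E \<and> ?A")
proof (cases ?C)
  case True
  then have c: "\<And>v. v \<in> {1..n} \<Longrightarrow> f v \<in> carrier_mat (rdim Y v) (rdim X v)" by blast
  have key: "proj nb (rdim Y) b * (out_map Y * f a) = rmap Y (a, b) * f a"
    "proj nb (rdim Y) b * (diag X Y f * out_map X) = f b * rmap X (a, b)" if b: "b \<in> nb" for b
  proof -
    show "proj nb (rdim Y) b * (out_map Y * f a) = rmap Y (a, b) * f a"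
      using proj_out_map[OF Y b, symmetric] c[OF a_vertex] by (simp add: mult_assoc_dim)
    have "proj nb (rdim Y) b * (diag X Y f * out_map X) = (proj nb (rdim Y) b * diag X Y f) * out_map X"
      by (simp add: mult_assoc_dim)
    also have "\<dots> = (f b * proj nb (rdim X) b) * out_map X"
      using proj_block_diag[of nb b f "rdim Y" "rdim X"] b c nb_vertex(1) by simp
    also have "\<dots> = f b * rmap X (a, b)"
      using proj_out_map[OF X b] c[OF nb_vertex(1)[OF b]] by (simp add: mult_assoc_dim)
    finally show "proj nb (rdim Y) b * (diag X Y f * out_map X) = f b * rmap X (a, b)" .
  qed
  have "?A \<longleftrightarrow> (\<forall>b\<in>nb. f b * rmap X (a, b) = rmap Y (a, b) * f a)"
  proof
    assume ?A
    then show "\<forall>b\<in>nb. f b * rmap X (a, b) = rmap Y (a, b) * f a" using key by metis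
  next
    assume *: "\<forall>b\<in>nb. f b * rmap X (a, b) = rmap Y (a, b) * f a"
    show ?A
      by (rule pairing_ext[of nb _ "rdim Y"]) (use * key c[OF a_vertex] in auto)
  qed
  moreover have "R.mor X Y f \<longleftrightarrow> ?E \<and> (\<forall>b\<in>nb. f b * rmap X (a, b) = rmap Y (a, b) * f a)"
    using True unfolding morphism_def by (auto simp: reversed_arrow)
  ultimately show ?thesis using True by blast
next
  case False
  then show ?thesis unfolding morphism_def by blast
qed

text \<open>\<open>X'\<close> and \<open>X\<close> agree away from \<open>a\<close>, and \<open>X' a \<longrightarrow> (\<Oplus>b. X b) \<longrightarrow> X a\<close> is exact in the middle.\<close>

definition refl_exact :: "qrep \<Rightarrow> qrep \<Rightarrow> bool" where
  "refl_exact X X' \<longleftrightarrow> rep X \<and> R.rep X' \<and> (\<forall>v\<in>{1..n}. v \<noteq> a \<longrightarrow> rdim X' v = rdim X v) \<and>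
     (\<forall>s t. (s, t) \<in> Q \<longrightarrow> t \<noteq> a \<longrightarrow> rmap X' (s, t) = rmap X (s, t)) \<and>
     exact_pair (in_map X) (out_map X')"

text \<open>A short exact sequence rather than exactness in the middle. It fixes the dimension at
  \<open>a\<close> on both sides and makes morphisms determined by their components away from
  \<open>a\<close>.\<close>

definition reflected :: "qrep \<Rightarrow> qrep \<Rightarrow> bool" where
  "reflected X X' \<longleftrightarrow> refl_exact X X' \<and> right_invertible (in_map X) \<and> left_invertible (out_map X')"

lemma refl_exact_diag:
  assumes "refl_exact X X'" "refl_exact Y Y'" "\<And>b. b \<in> nb \<Longrightarrow> g b = f b"
    "\<And>b. b \<in> nb \<Longrightarrow> f b \<in> carrier_mat (rdim Y b) (rdim X b)"
  shows "diag X' Y' g = diag X Y f" "tot nb (rdim X') = tot nb (rdim X)"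
proof -
  have X: "rdim X' b = rdim X b" and Y: "rdim Y' b = rdim Y b" if "b \<in> nb" for b
    using assms(1,2) nb_vertex that unfolding refl_exact_def by auto
  note bX = block_cong[of nb "rdim X'" "rdim X", OF X]
  note bY = block_cong[of nb "rdim Y'" "rdim Y", OF Y]
  show t: "tot nb (rdim X') = tot nb (rdim X)" by (rule bX(1))
  show "diag X' Y' g = diag X Y f"
  proof (rule copair_ext[of nb _ "rdim X"])
    fix b assume b: "b \<in> nb"
    have fb: "f b \<in> carrier_mat (rdim Y b) (rdim X b)" by (rule assms(4)[OF b])
    have "diag X' Y' g * incl nb (rdim X) b = diag X' Y' g * incl nb (rdim X') b"
      by (simp add: bX(3)[OF _ b])
    also have "\<dots> = incl nb (rdim Y') b * g b"
      using fb b X Y assms(3) by (intro block_diag_incl) auto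
    also have "\<dots> = incl nb (rdim Y) b * f b" by (simp add: bY(3)[OF _ b] assms(3)[OF b])
    also have "\<dots> = diag X Y f * incl nb (rdim X) b"
      using fb b by (intro block_diag_incl[symmetric]) auto
    finally show "diag X' Y' g * incl nb (rdim X) b = diag X Y f * incl nb (rdim X) b" .
  qed (use t bY(1) in auto)
qed

lemma refl_exactD:
  assumes "refl_exact X X'"
  shows "rep X" "R.rep X'" "\<And>v. v \<in> {1..n} \<Longrightarrow> v \<noteq> a \<Longrightarrow> rdim X' v = rdim X v"
    "\<And>s t. (s, t) \<in> Q \<Longrightarrow> t \<noteq> a \<Longrightarrow> rmap X' (s, t) = rmap X (s, t)"
    "in_map X * out_map X' = 0\<^sub>m (rdim X a) (rdim X' a)" "tot nb (rdim X') = tot nb (rdim X)"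
    "\<exists>G H. G \<in> carrier_mat (tot nb (rdim X)) (rdim X a) \<and> H \<in> carrier_mat (rdim X' a) (tot nb (rdim X)) \<and>
      G * in_map X + out_map X' * H = 1\<^sub>m (tot nb (rdim X))"
proof -
  show "rep X" "R.rep X'" "\<And>v. v \<in> {1..n} \<Longrightarrow> v \<noteq> a \<Longrightarrow> rdim X' v = rdim X v"
    "\<And>s t. (s, t) \<in> Q \<Longrightarrow> t \<noteq> a \<Longrightarrow> rmap X' (s, t) = rmap X (s, t)"
    and z: "in_map X * out_map X' = 0\<^sub>m (rdim X a) (rdim X' a)" and t: "tot nb (rdim X') = tot nb (rdim X)"
    using assms unfolding refl_exact_def exact_pair_def by auto
  obtain G H where "G \<in> carrier_mat (dim_col (in_map X)) (dim_row (in_map X))"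
    "H \<in> carrier_mat (dim_col (out_map X')) (dim_row (out_map X'))"
    "G * in_map X + out_map X' * H = 1\<^sub>m (dim_col (in_map X))"
    using assms unfolding refl_exact_def exact_pair_def by blast
  then show "\<exists>G H. G \<in> carrier_mat (tot nb (rdim X)) (rdim X a) \<and> H \<in> carrier_mat (rdim X' a) (tot nb (rdim X)) \<and>
      G * in_map X + out_map X' * H = 1\<^sub>m (tot nb (rdim X))"
    by (rule_tac exI[of _ G], rule_tac exI[of _ H]) (simp add: t)
qed

lemma reflect_mor_down:
  assumes X: "refl_exact X X'" and Y: "refl_exact Y Y'" and f: "mor X Y f"
  obtains f' where "R.mor X' Y' f'" "\<forall>v\<in>{1..n}. v \<noteq> a \<longrightarrow> f' v = f v"
proof -
  note X' = refl_exactD[OF X] and Y' = refl_exactD[OF Y]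
  obtain G H where G: "G \<in> carrier_mat (tot nb (rdim Y)) (rdim Y a)" and
    H: "H \<in> carrier_mat (rdim Y' a) (tot nb (rdim Y))"
    and GH: "G * in_map Y + out_map Y' * H = 1\<^sub>m (tot nb (rdim Y))"
    using Y'(7) by blast
  let ?F = "diag X Y f"
  \<comment> \<open>The homotopy supplies a factorization: \<open>out_map Y' * (H * Z) = Z\<close>
    whenever \<open>in_map Y * Z = 0\<close>. It is applied to
    \<open>Z = ?F * out_map X'\<close>.\<close>
  define f' where "f' = f(a := H * (?F * out_map X'))"
  have fc: "\<And>v. v \<in> {1..n} \<Longrightarrow> f v \<in> carrier_mat (rdim Y v) (rdim X v)" using mor_carrier[OF f] .
  have fa: "f a * in_map X = in_map Y * ?F" using f mor_sink_iff[OF X'(1) Y'(1)] by blast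
  have F': "diag X' Y' f' = ?F"
    by (rule refl_exact_diag[OF X Y]) (use nb_vertex fc in \<open>auto simp: f'_def\<close>)
  note d = carrier_matD[OF G] carrier_matD[OF H] X'(6) Y'(6) carrier_matD[OF fc[OF a_vertex]]
  have "in_map Y * (?F * out_map X') = (f a * in_map X) * out_map X'"
    unfolding fa using d by (simp add: mult_assoc_dim)
  also have "\<dots> = 0\<^sub>m (rdim Y a) (rdim X' a)"
    using d X'(5) by (simp add: mult_assoc_dim)
  finally have z: "in_map Y * (?F * out_map X') = 0\<^sub>m (rdim Y a) (rdim X' a)" .
  have "?F * out_map X' = (G * in_map Y + out_map Y' * H) * (?F * out_map X')"
    unfolding GH using d by simp
  also have "\<dots> = G * (in_map Y * (?F * out_map X')) + out_map Y' * (H * (?F * out_map X'))"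
    using d by (subst add_mult_dim) (auto simp: mult_assoc_dim)
  also have "\<dots> = out_map Y' * (H * (?F * out_map X'))"
    unfolding z using d by (simp add: add_zero_dim)
  finally have eq: "out_map Y' * f' a = ?F * out_map X'" by (simp add: f'_def)
  have "R.mor X' Y' f'"
    unfolding mor_source_iff[OF X'(2) Y'(2)]
  proof (intro conjI ballI allI impI)
    fix v assume v: "v \<in> {1..n}"
    show "f' v \<in> carrier_mat (rdim Y' v) (rdim X' v)"
      using fc[OF v] X'(3)[OF v] Y'(3)[OF v] d by (auto simp: f'_def)
  next
    fix s t assume "(s, t) \<in> Q" "t \<noteq> a"
    moreover from this have "s \<noteq> a" using a_sink by auto
    ultimately show "f' t * rmap X' (s, t) = rmap Y' (s, t) * f' s"
      using X'(4) Y'(4) mor_comm[OF f] by (simp add: f'_def)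
  next
    show "out_map Y' * f' a = diag X' Y' f' * out_map X'" unfolding F' by (rule eq)
  qed
  then show thesis by (rule that) (simp add: f'_def)
qed

lemma reflect_mor_up:
  assumes X: "refl_exact X X'" and Y: "refl_exact Y Y'" and f': "R.mor X' Y' f'"
  obtains f where "mor X Y f" "\<forall>v\<in>{1..n}. v \<noteq> a \<longrightarrow> f v = f' v"
proof -
  note X' = refl_exactD[OF X] and Y' = refl_exactD[OF Y]
  obtain G H where G: "G \<in> carrier_mat (tot nb (rdim X)) (rdim X a)" and
    H: "H \<in> carrier_mat (rdim X' a) (tot nb (rdim X))"
    and GH: "G * in_map X + out_map X' * H = 1\<^sub>m (tot nb (rdim X))"
    using X'(7) by blast
  let ?F = "diag X' Y' f'"
  \<comment> \<open>Dually, \<open>(Z * G) * in_map X = Z\<close> whenever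
    \<open>Z * out_map X' = 0\<close>. It is applied to \<open>Z = in_map Y * ?F\<close>.\<close>
  define f where "f = f'(a := in_map Y * (?F * G))"
  have fc: "\<And>v. v \<in> {1..n} \<Longrightarrow> f' v \<in> carrier_mat (rdim Y' v) (rdim X' v)" using R.mor_carrier[OF f'] .
  have fa: "out_map Y' * f' a = ?F * out_map X'" using f' mor_source_iff[OF X'(2) Y'(2)] by blast
  have F': "?F = diag X Y f"
    by (rule refl_exact_diag[OF X Y])
      (use nb_vertex fc X'(3) Y'(3) in \<open>fastforce simp: f_def\<close>)+
  note d = carrier_matD[OF G] carrier_matD[OF H] X'(6) Y'(6) carrier_matD[OF fc[OF a_vertex]]
  have "in_map Y * (?F * out_map X') = (in_map Y * out_map Y') * f' a"
    unfolding fa[symmetric] using d by (simp add: mult_assoc_dim)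
  also have "\<dots> = 0\<^sub>m (rdim Y a) (rdim X' a)"
    using d Y'(5) by simp
  finally have z: "in_map Y * (?F * out_map X') = 0\<^sub>m (rdim Y a) (rdim X' a)" .
  have "in_map Y * ?F = in_map Y * ?F * (G * in_map X + out_map X' * H)"
    unfolding GH using d by simp
  also have "\<dots> = in_map Y * (?F * G) * in_map X + (in_map Y * (?F * out_map X')) * H"
    using d by (subst mult_add_dim) (auto simp: mult_assoc_dim)
  also have "\<dots> = in_map Y * (?F * G) * in_map X"
    unfolding z using d by (simp add: add_zero_dim)
  finally have eq: "f a * in_map X = in_map Y * ?F" by (simp add: f_def)
  have "mor X Y f"
    unfolding mor_sink_iff[OF X'(1) Y'(1)]
  proof (intro conjI ballI allI impI)
    fix v assume v: "v \<in> {1..n}"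
    show "f v \<in> carrier_mat (rdim Y v) (rdim X v)"
      using fc[OF v] X'(3)[OF v] Y'(3)[OF v] d by (auto simp: f_def)
  next
    fix s t assume Q: "(s, t) \<in> Q" "t \<noteq> a"
    moreover from this have "s \<noteq> a" using a_sink by auto
    moreover have "(s, t) \<in> Q'" using Q by (simp add: reversed_arrow)
    from R.mor_comm[OF f' this] have "f' t * rmap X (s, t) = rmap Y (s, t) * f' s"
      unfolding X'(4)[OF Q] Y'(4)[OF Q] .
    ultimately show "f t * rmap X (s, t) = rmap Y (s, t) * f s"
      using Q by (simp add: f_def)
  next
    show "f a * in_map X = in_map Y * diag X Y f" unfolding F'[symmetric] by (rule eq)
  qed
  then show thesis by (rule that) (simp add: f_def)
qed

text \<open>Surjectivity of \<open>in_map X\<close> forces the component at \<open>a\<close> from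
  those at the neighbours. Identities between morphisms that were carried across a reflection are
  verified through this and its dual.\<close>

lemma mor_determined:
  assumes X: "rep X" and inv: "right_invertible (in_map X)" and Y: "rep Y"
    and f: "mor X Y f" and g: "mor X Y g" and eq: "\<forall>v\<in>{1..n}. v \<noteq> a \<longrightarrow> f v = g v" and v: "v \<in> {1..n}"
  shows "f v = g v"
proof -
  have "diag X Y f = diag X Y g"
    using eq nb_vertex mor_carrier[OF f] mor_carrier[OF g] by (intro block_diag_cong) auto
  then have "f a * in_map X = g a * in_map X"
    using f g mor_sink_iff[OF X Y] by metis
  then have "f a = g a"
    by (rule mult_right_cancel[OF inv]) (use mor_dims[OF f a_vertex] mor_dims[OF g a_vertex] in auto)
  then show ?thesis using eq v by (cases "v = a") auto
qed

lemma mor_determined_source: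
  assumes X: "R.rep X" and Y: "R.rep Y" and inv: "left_invertible (out_map Y)"
    and f: "R.mor X Y f" and g: "R.mor X Y g" and eq: "\<forall>v\<in>{1..n}. v \<noteq> a \<longrightarrow> f v = g v" and v: "v \<in> {1..n}"
  shows "f v = g v"
proof -
  have "diag X Y f = diag X Y g"
    using eq nb_vertex R.mor_carrier[OF f] R.mor_carrier[OF g] by (intro block_diag_cong) auto
  then have "out_map Y * f a = out_map Y * g a"
    using f g mor_source_iff[OF X Y] by metis
  then have "f a = g a"
    by (rule mult_left_cancel[OF inv]) (use R.mor_dims[OF f a_vertex] R.mor_dims[OF g a_vertex] in auto)
  then show ?thesis using eq v by (cases "v = a") auto
qed

text \<open>The reflection functor on objects: the new space at \<open>a\<close> is the kernel of
  \<open>in_map X\<close>, and the new arrows are the blocks of the kernel inclusion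
  \<open>K\<close>. No surjectivity is demanded of \<open>X\<close>, so this also applies to middle
  terms of factorizations.\<close>

lemma ex_reflect_down:
  assumes X: "rep X"
  obtains X' where "refl_exact X X'" "left_invertible (out_map X')"
proof -
  obtain K where K: "exact_pair (in_map X) K" "left_invertible K" by (rule ex_kernel)
  then have dK: "dim_row K = tot nb (rdim X)" unfolding exact_pair_def by simp
  define X' where "X' = \<lparr>rdim = (rdim X)(a := dim_col K),
    rmap = (\<lambda>(s, t). if s = a then proj nb (rdim X) t * K else rmap X (s, t))\<rparr>"
  have rd: "rdim X' b = rdim X b" if "b \<in> nb" for b using nb_vertex(2)[OF that] by (simp add: X'_def)
  note bc = block_cong[of nb "rdim X'" "rdim X", OF rd]
  have rep': "R.rep X'"
    unfolding representation_def
  proof safe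
    fix s t assume "(s, t) \<in> Q'"
    then consider "(s, t) \<in> Q" "t \<noteq> a" | "s = a" "t \<in> nb" unfolding reversed_arrow by blast
    then show "rmap X' (s, t) \<in> carrier_mat (rdim X' t) (rdim X' s)"
    proof cases
      case 1
      then have "s \<noteq> a" using a_sink by auto
      with 1 show ?thesis using X unfolding representation_def by (auto simp: X'_def)
    next
      case 2
      then show ?thesis using nb_vertex(2) by (auto simp: X'_def)
    qed
  qed
  have "out_map X' = K"
  proof (rule pairing_ext[of nb _ "rdim X'"])
    fix b assume b: "b \<in> nb"
    show "proj nb (rdim X') b * out_map X' = proj nb (rdim X') b * K"
      unfolding proj_out_map[OF rep' b] by (simp add: bc(4)[OF _ b]) (simp add: X'_def)
  qed (use dK bc(1) in \<open>auto simp: X'_def\<close>)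
  moreover have "rmap X' (s, t) = rmap X (s, t)" if "(s, t) \<in> Q" for s t
    using that a_sink by (auto simp: X'_def)
  ultimately have "refl_exact X X'"
    unfolding refl_exact_def using X rep' K(1) by (auto simp: X'_def)
  with \<open>out_map X' = K\<close> K(2) show thesis using that by simp
qed

text \<open>The inverse reflection, with the cokernel of \<open>out_map X'\<close> as the space at
  the sink.\<close>

lemma ex_reflect_up:
  assumes X': "R.rep X'"
  obtains X where "refl_exact X X'" "right_invertible (in_map X)"
proof -
  obtain C where C: "exact_pair C (out_map X')" "right_invertible C" by (rule ex_cokernel)
  then have dC: "dim_col C = tot nb (rdim X')" unfolding exact_pair_def by simp
  define X where "X = \<lparr>rdim = (rdim X')(a := dim_row C),
    rmap = (\<lambda>(s, t). if t = a then C * incl nb (rdim X') s else rmap X' (s, t))\<rparr>"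
  have rd: "rdim X b = rdim X' b" if "b \<in> nb" for b using nb_vertex(2)[OF that] by (simp add: X_def)
  note bc = block_cong[of nb "rdim X" "rdim X'", OF rd]
  have rep: "rep X"
    unfolding representation_def
  proof safe
    fix s t assume Q: "(s, t) \<in> Q"
    then have s: "s \<noteq> a" using a_sink by auto
    show "rmap X (s, t) \<in> carrier_mat (rdim X t) (rdim X s)"
    proof (cases "t = a")
      case True
      then show ?thesis using s by (auto simp: X_def)
    next
      case False
      with Q have "(s, t) \<in> Q'" by (simp add: reversed_arrow)
      then show ?thesis using X' s False unfolding representation_def by (auto simp: X_def)
    qed
  qed
  have "in_map X = C"
  proof (rule copair_ext[of nb _ "rdim X"])
    fix b assume b: "b \<in> nb"
    show "in_map X * incl nb (rdim X) b = C * incl nb (rdim X) b"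
      unfolding in_map_incl[OF rep b] by (simp add: bc(3)[OF _ b]) (simp add: X_def)
  qed (use dC bc(1) in \<open>auto simp: X_def\<close>)
  then have "refl_exact X X'"
    unfolding refl_exact_def using X' rep C(1) by (auto simp: X_def)
  with \<open>in_map X = C\<close> C(2) show thesis using that by simp
qed

end

text \<open>A vector lies in the image of \<open>A\<close> exactly when the cokernel map
  \<open>C\<close> kills it. Otherwise some coordinate of \<open>C * x\<close> is nonzero, and that
  coordinate, normalised, is a functional that separates \<open>x\<close> from the image.\<close>

lemma image_or_functional:
  fixes A x :: "'a::field mat"
  assumes x: "x \<in> carrier_mat (dim_row A) 1"
  obtains (image) y where "y \<in> carrier_mat (dim_col A) 1" "x = A * y"
  | (functional) l where "l \<in> carrier_mat 1 (dim_row A)" "l * A = 0\<^sub>m 1 (dim_col A)" "l * x = 1\<^sub>m 1"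
proof -
  obtain C where C: "exact_pair C A" by (rule ex_cokernel[of A])
  then obtain G H where d: "dim_col C = dim_row A" and z: "C * A = 0\<^sub>m (dim_row C) (dim_col A)"
    and G: "G \<in> carrier_mat (dim_col C) (dim_row C)" and H: "H \<in> carrier_mat (dim_col A) (dim_row A)"
    and e: "G * C + A * H = 1\<^sub>m (dim_col C)"
    unfolding exact_pair_def by blast
  show thesis
  proof (cases "C * x = 0\<^sub>m (dim_row C) 1")
    case True
    have "x = (G * C + A * H) * x" unfolding e using d x by simp
    also have "\<dots> = G * (C * x) + A * (H * x)"
      using d x G H by (subst add_mult_dim) (auto simp: mult_assoc_dim)
    also have "\<dots> = A * (H * x)"
      unfolding True using G H x d by (simp add: add_zero_dim)
    finally show thesis by (rule image[rotated]) (use H x in auto)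
  next
    case False
    then obtain i where i: "i < dim_row C" "(C * x) $$ (i, 0) \<noteq> 0"
      using x by (metis carrier_matD(2) eq_matI index_mult_mat(2,3) index_zero_mat less_one)
    \<comment> \<open>The coordinate \<open>i\<close> of the cokernel, scaled so that it takes the
      value 1 on \<open>x\<close>.\<close>
    define l where "l = mat 1 (dim_row C) (\<lambda>(_, j). if j = i then 1 / (C * x) $$ (i, 0) else 0) * C"
    have "l * A = mat 1 (dim_row C) (\<lambda>(_, j). if j = i then 1 / (C * x) $$ (i, 0) else 0) * (C * A)"
      unfolding l_def using d by (simp add: mult_assoc_dim)
    then have lA: "l * A = 0\<^sub>m 1 (dim_col A)" unfolding z by simp
    have "l * x = mat 1 (dim_row C) (\<lambda>(_, j). if j = i then 1 / (C * x) $$ (i, 0) else 0) * (C * x)"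
      unfolding l_def using d x by (simp add: mult_assoc_dim)
    also have "\<dots> = 1\<^sub>m 1"
    proof (rule eq_matI)
      fix p q assume "p < dim_row (1\<^sub>m 1 :: 'a mat)" "q < dim_col (1\<^sub>m 1 :: 'a mat)"
      then have [simp]: "p = 0" "q = 0" by auto
      define c where "c = (C * x) $$ (i, 0)"
      have "(mat 1 (dim_row C) (\<lambda>(_, j). if j = i then 1 / c else 0) * (C * x)) $$ (p, q) =
        (\<Sum>j<dim_row C. (if j = i then 1 / c else 0) * (C * x) $$ (j, 0))"
        using x by (subst index_mult_sum) auto
      also have "\<dots> = (\<Sum>j<dim_row C. if j = i then 1 / c * (C * x) $$ (j, 0) else 0)"
        by (intro sum.cong) auto
      also have "\<dots> = 1 / c * c" unfolding c_def using i(1) by simp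
      also have "\<dots> = 1" using i(2) unfolding c_def by simp
      finally show "(mat 1 (dim_row C) (\<lambda>(_, j). if j = i then 1 / (C * x) $$ (i, 0) else 0) * (C * x)) $$ (p, q) =
        1\<^sub>m 1 $$ (p, q)" unfolding c_def by simp
    qed (use x in auto)
    finally show thesis using lA by (intro functional[of l]) (auto simp: l_def d)
  qed
qed

text \<open>If every standard basis vector had a preimage, the preimages would be the columns of a
  right inverse; so some basis vector can be separated from the image, and it serves as
  \<open>h\<close>.\<close>

lemma right_invertible_or_functional:
  fixes A :: "'a::field mat"
  assumes "\<not> right_invertible A"
  obtains l h where "l \<in> carrier_mat 1 (dim_row A)" "h \<in> carrier_mat (dim_row A) 1"
    "l * A = 0\<^sub>m 1 (dim_col A)" "l * h = 1\<^sub>m 1"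
proof -
  define e :: "nat \<Rightarrow> 'a mat" where "e i = mat (dim_row A) 1 (\<lambda>(r, _). if r = i then 1 else 0)" for i
  have e: "e i \<in> carrier_mat (dim_row A) 1" for i by (simp add: e_def)
  have "\<exists>i. \<not> (\<exists>y \<in> carrier_mat (dim_col A) 1. e i = A * y)"
  proof (rule ccontr)
    assume "\<not> ?thesis"
    then obtain y where y: "\<And>i. y i \<in> carrier_mat (dim_col A) 1" "\<And>i. e i = A * y i" by metis
    define G where "G = mat (dim_col A) (dim_row A) (\<lambda>(r, i). y i $$ (r, 0))"
    have "A * G = 1\<^sub>m (dim_row A)"
    proof (rule eq_matI)
      fix r i assume "r < dim_row (1\<^sub>m (dim_row A) :: 'a mat)" "i < dim_col (1\<^sub>m (dim_row A) :: 'a mat)"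
      then have ri: "r < dim_row A" "i < dim_row A" by auto
      have "(A * G) $$ (r, i) = (\<Sum>l<dim_col A. A $$ (r, l) * y i $$ (l, 0))"
        using ri by (subst index_mult_sum) (auto simp: G_def)
      also have "\<dots> = (A * y i) $$ (r, 0)"
        using ri carrier_matD[OF y(1)[of i]] by (subst index_mult_sum) auto
      also have "\<dots> = 1\<^sub>m (dim_row A) $$ (r, i)" unfolding y(2)[symmetric] using ri by (simp add: e_def)
      finally show "(A * G) $$ (r, i) = 1\<^sub>m (dim_row A) $$ (r, i)" .
    qed (auto simp: G_def)
    then have "right_invertible A"
      unfolding right_invertible_def by (intro bexI[of _ G]) (auto simp: G_def)
    then show False using assms by blast
  qed
  then obtain i where "\<forall>y \<in> carrier_mat (dim_col A) 1. e i \<noteq> A * y" by blast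
  then show thesis
    by (cases rule: image_or_functional[OF e[of i]]) (use that e in blast)+
qed

lemma left_invertible_or_vector:
  fixes B :: "'a::field mat"
  assumes "\<not> left_invertible B"
  obtains k l where "k \<in> carrier_mat (dim_col B) 1" "l \<in> carrier_mat 1 (dim_col B)"
    "B * k = 0\<^sub>m (dim_row B) 1" "l * k = 1\<^sub>m 1"
proof -
  have "\<not> right_invertible (transpose_mat B)"
  proof
    assume "right_invertible (transpose_mat B)"
    then obtain G where G: "G \<in> carrier_mat (dim_row B) (dim_col B)" "transpose_mat B * G = 1\<^sub>m (dim_col B)"
      unfolding right_invertible_def by auto
    have "transpose_mat G * B = transpose_mat (transpose_mat B * G)"
      using G by (subst transpose_mult[of _ "dim_col B" "dim_row B" _ "dim_col B"]) auto
    then have "left_invertible B" unfolding left_invertible_def using G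
      by (intro bexI[of _ "transpose_mat G"]) auto
    then show False using assms by blast
  qed
  then obtain l h where l: "l \<in> carrier_mat 1 (dim_col B)" "h \<in> carrier_mat (dim_col B) 1"
    "l * transpose_mat B = 0\<^sub>m 1 (dim_row B)" "l * h = 1\<^sub>m 1"
    by (rule right_invertible_or_functional) auto
  show thesis
  proof (rule that[of "transpose_mat l" "transpose_mat h"])
    have "B * transpose_mat l = transpose_mat (l * transpose_mat B)"
      using l by (subst transpose_mult[of _ 1 "dim_col B" _ "dim_row B"]) auto
    then show "B * transpose_mat l = 0\<^sub>m (dim_row B) 1" unfolding l(3) by simp
    have "transpose_mat h * transpose_mat l = transpose_mat (l * h)"
      using l by (subst transpose_mult[of _ 1 "dim_col B" _ 1]) auto
    then show "transpose_mat h * transpose_mat l = 1\<^sub>m 1" unfolding l(4) by simp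
  qed (use l in auto)
qed

section \<open>Generators and composites of bricks\<close>

context quiv
begin

text \<open>The pair \<open>(P, e)\<close> stands for the projective cover of the simple at \<open>b\<close> with its canonical
  generator; the uniqueness of \<open>g\<close> is never needed.\<close>

definition generates :: "nat \<Rightarrow> qrep \<Rightarrow> complex mat \<Rightarrow> bool" where
  "generates b P e \<longleftrightarrow> rep P \<and> e \<in> carrier_mat (rdim P b) 1 \<and>
     (\<forall>X x. rep X \<and> x \<in> carrier_mat (rdim X b) 1 \<longrightarrow> (\<exists>g. mor P X g \<and> g b * e = x))"

text \<open>Both composites are scalars, \<open>u * r = c\<close> and \<open>r * u = c'\<close>, and
  \<open>c u = u r u = c' u\<close>. If \<open>c\<close> were nonzero, then \<open>u\<close> would
  be nonzero, hence \<open>c = c'\<close>, and \<open>r / c\<close> would invert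
  \<open>u\<close>.\<close>

lemma brick_comp_zero_or_isomorphic:
  assumes P: "brick P" and N: "brick N" and u: "mor P N u" and r: "mor N P r"
    and niso: "\<not> isomorphic n Q P N" and v: "v \<in> {1..n}"
  shows "u v * r v = 0\<^sub>m (rdim N v) (rdim N v)"
proof -
  note PN = brick_rep[OF P] brick_rep[OF N]
  obtain c where c: "\<forall>v\<in>{1..n}. u v * r v = c \<cdot>\<^sub>m 1\<^sub>m (rdim N v)"
    using mor_comp_mor[OF PN(2,1,2) r u] by (rule brick_endo[OF N])
  obtain c' where c': "\<forall>v\<in>{1..n}. r v * u v = c' \<cdot>\<^sub>m 1\<^sub>m (rdim P v)"
    using mor_comp_mor[OF PN(1,2,1) u r] by (rule brick_endo[OF P])
  have "c = 0"
  proof (rule ccontr)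
    assume c0: "c \<noteq> 0"
    obtain w where w: "w \<in> {1..n}" "rdim N w \<noteq> 0" using N unfolding brick_def zero_rep_def by blast
    note d = mor_dims[OF u w(1)] mor_dims[OF r w(1)]
    have "c \<cdot>\<^sub>m u w = (u w * r w) * u w"
      unfolding c[rule_format, OF w(1)] using d by (simp add: smult_mult_dim)
    also have "\<dots> = u w * (r w * u w)" using d by (simp add: mult_assoc_dim)
    also have "\<dots> = c' \<cdot>\<^sub>m u w" unfolding c'[rule_format, OF w(1)] using d by (simp add: mult_smult_dim)
    finally have eq: "c \<cdot>\<^sub>m u w = c' \<cdot>\<^sub>m u w" .
    have "u w \<noteq> 0\<^sub>m (rdim N w) (rdim P w)"
    proof
      assume "u w = 0\<^sub>m (rdim N w) (rdim P w)"
      then have "c \<cdot>\<^sub>m 1\<^sub>m (rdim N w) = (0 :: complex) \<cdot>\<^sub>m 1\<^sub>m (rdim N w)"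
        using c[rule_format, OF w(1)] d by (simp add: zero_smult_mat)
      with c0 show False using smult_one_eq[OF w(2)] by blast
    qed
    then obtain i j where ij: "i < rdim N w" "j < rdim P w" "u w $$ (i, j) \<noteq> 0"
      using d by (metis eq_matI index_zero_mat)
    have "(c \<cdot>\<^sub>m u w) $$ (i, j) = (c' \<cdot>\<^sub>m u w) $$ (i, j)" using eq by simp
    then have cc: "c' = c" using ij d by simp
    have "isomorphic n Q P N"
    proof (rule isomorphicI[OF u mor_smult[OF PN(2,1) r, of "1 / c"]])
      fix v assume v: "v \<in> {1..n}"
      note d = mor_dims[OF u v] mor_dims[OF r v]
      show "(1 / c) \<cdot>\<^sub>m r v * u v = 1\<^sub>m (rdim P v)"
        using d c0 c'[rule_format, OF v] cc by (simp add: smult_mult_dim smult_smult_mat one_smult_mat)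
      show "u v * ((1 / c) \<cdot>\<^sub>m r v) = 1\<^sub>m (rdim N v)"
        using d c0 c[rule_format, OF v] by (simp add: mult_smult_dim smult_smult_mat one_smult_mat)
    qed
    with niso show False by blast
  qed
  with c v show ?thesis by (simp add: zero_smult_mat)
qed

end

section \<open>Transport of bricks, isomorphisms and irreducible morphisms along a
  reflection\<close>

context sink_quiv
begin

lemma reflected_dim:
  assumes "reflected X X'"
  shows "rdim X a + rdim X' a = (\<Sum>b\<in>nb. rdim X b)"
  using assms exact_pair_dim[of "in_map X" "out_map X'"]
  unfolding reflected_def refl_exact_def by (simp add: tot_def)

lemma reflected_zero_rep:
  assumes "reflected X X'"
  shows "zero_rep n X \<longleftrightarrow> zero_rep n X'"
proof -
  have eq: "rdim X' v = rdim X v" if "v \<in> {1..n}" "v \<noteq> a" for v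
    using assms that unfolding reflected_def refl_exact_def by blast
  have "rdim X a = 0 \<and> rdim X' a = 0" if "\<forall>v\<in>{1..n}. v \<noteq> a \<longrightarrow> rdim X v = 0"
    using reflected_dim[OF assms] nb_vertex that by auto
  then show ?thesis unfolding zero_rep_def using eq by metis
qed

lemma reflectedD:
  assumes "reflected X X'"
  shows "refl_exact X X'" "rep X" "R.rep X'" "right_invertible (in_map X)" "left_invertible (out_map X')"
    "\<And>v. v \<in> {1..n} \<Longrightarrow> v \<noteq> a \<Longrightarrow> rdim X' v = rdim X v"
  using assms unfolding reflected_def refl_exact_def by blast+

lemma comp_eq_sink:
  assumes X: "rep X" and inv: "right_invertible (in_map X)" and L: "rep L" and Y: "rep Y"
    and h: "mor X L h" and g: "mor L Y g" and f: "mor X Y f"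
    and eq: "\<And>v. v \<in> {1..n} \<Longrightarrow> v \<noteq> a \<Longrightarrow> g v * h v = f v" and v: "v \<in> {1..n}"
  shows "g v * h v = f v"
  using mor_determined[OF X inv Y mor_comp_mor[OF X L Y h g] f _ v] eq by blast

lemma comp_eq_source:
  assumes X: "R.rep X" and L: "R.rep L" and Y: "R.rep Y" and inv: "left_invertible (out_map Y)"
    and h: "R.mor X L h" and g: "R.mor L Y g" and f: "R.mor X Y f"
    and eq: "\<And>v. v \<in> {1..n} \<Longrightarrow> v \<noteq> a \<Longrightarrow> g v * h v = f v" and v: "v \<in> {1..n}"
  shows "g v * h v = f v"
  using mor_determined_source[OF X Y inv R.mor_comp_mor[OF X L Y h g] f _ v] eq by blast

lemma reflected_brick:
  assumes X: "reflected X X'" and brick: "brick X"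
  shows "R.brick X'"
  unfolding R.brick_def
proof (intro conjI allI impI)
  note X' = reflectedD[OF X]
  show "R.rep X'" by (rule X'(3))
  show "\<not> zero_rep n X'" using brick reflected_zero_rep[OF X] unfolding brick_def by blast
  fix e' assume e': "R.mor X' X' e'"
  obtain e where e: "mor X X e" "\<forall>v\<in>{1..n}. v \<noteq> a \<longrightarrow> e v = e' v"
    by (rule reflect_mor_up[OF X'(1) X'(1) e'])
  obtain c where c: "\<forall>v\<in>{1..n}. e v = c \<cdot>\<^sub>m 1\<^sub>m (rdim X v)" by (rule brick_endo[OF brick e(1)])
  have "\<forall>v\<in>{1..n}. v \<noteq> a \<longrightarrow> e' v = c \<cdot>\<^sub>m 1\<^sub>m (rdim X' v)" using e(2) c X'(6) by auto
  then have "\<forall>v\<in>{1..n}. e' v = c \<cdot>\<^sub>m 1\<^sub>m (rdim X' v)"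
    using mor_determined_source[OF X'(3) X'(3) X'(5) e' R.mor_smult[OF X'(3) X'(3) R.mor_one[OF X'(3)]]]
    by blast
  then show "\<exists>c. \<forall>v\<in>{1..n}. e' v = c \<cdot>\<^sub>m 1\<^sub>m (rdim X' v)" by blast
qed

lemma reflected_brick_up:
  assumes X: "reflected X X'" and brick: "R.brick X'"
  shows "brick X"
  unfolding brick_def
proof (intro conjI allI impI)
  note X' = reflectedD[OF X]
  show "rep X" by (rule X'(2))
  show "\<not> zero_rep n X" using brick reflected_zero_rep[OF X] unfolding R.brick_def by blast
  fix e assume e: "mor X X e"
  obtain e' where e': "R.mor X' X' e'" "\<forall>v\<in>{1..n}. v \<noteq> a \<longrightarrow> e' v = e v"
    by (rule reflect_mor_down[OF X'(1) X'(1) e])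
  obtain c where c: "\<forall>v\<in>{1..n}. e' v = c \<cdot>\<^sub>m 1\<^sub>m (rdim X' v)" by (rule R.brick_endo[OF brick e'(1)])
  have "\<forall>v\<in>{1..n}. v \<noteq> a \<longrightarrow> e v = c \<cdot>\<^sub>m 1\<^sub>m (rdim X v)" using e'(2) c X'(6) by auto
  then have "\<forall>v\<in>{1..n}. e v = c \<cdot>\<^sub>m 1\<^sub>m (rdim X v)"
    using mor_determined[OF X'(2) X'(4) X'(2) e mor_smult[OF X'(2) X'(2) mor_one[OF X'(2)]]]
    by blast
  then show "\<exists>c. \<forall>v\<in>{1..n}. e v = c \<cdot>\<^sub>m 1\<^sub>m (rdim X v)" by blast
qed

lemma reflected_indecomposable:
  assumes X: "reflected X X'" and ind: "indecomposable n Q X"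
  shows "indecomposable n Q' X'"
proof (rule R.indecomposable_if_trivial_idempotents)
  note X' = reflectedD[OF X]
  show "R.rep X'" by (rule X'(3))
  show "\<not> zero_rep n X'" using ind reflected_zero_rep[OF X] unfolding indecomposable_def by blast
  show "R.trivial_idempotents X'"
    unfolding R.trivial_idempotents_def
  proof (intro allI impI)
    fix e' assume asm: "R.mor X' X' e' \<and> (\<forall>v\<in>{1..n}. e' v * e' v = e' v)"
    then have e': "R.mor X' X' e'" ..
    obtain e where e: "mor X X e" "\<forall>v\<in>{1..n}. v \<noteq> a \<longrightarrow> e v = e' v"
      by (rule reflect_mor_up[OF X'(1) X'(1) e'])
    have "e v * e v = e v" if v: "v \<in> {1..n}" for v
      by (rule comp_eq_sink[OF X'(2,4,2,2) e(1) e(1) e(1) _ v]) (use asm e(2) in auto)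
    then consider "\<forall>v\<in>{1..n}. e v = 0\<^sub>m (rdim X v) (rdim X v)" | "\<forall>v\<in>{1..n}. e v = 1\<^sub>m (rdim X v)"
      using trivial_idempotents_if_indecomposable[OF ind] e(1) unfolding trivial_idempotents_def by blast
    then show "(\<forall>v\<in>{1..n}. e' v = 0\<^sub>m (rdim X' v) (rdim X' v)) \<or> (\<forall>v\<in>{1..n}. e' v = 1\<^sub>m (rdim X' v))"
    proof cases
      case 1
      have "\<forall>v\<in>{1..n}. v \<noteq> a \<longrightarrow> e' v = 0\<^sub>m (rdim X' v) (rdim X' v)" using e(2) 1 X'(6) by auto
      then have "\<forall>v\<in>{1..n}. e' v = 0\<^sub>m (rdim X' v) (rdim X' v)"
        using mor_determined_source[OF X'(3) X'(3) X'(5) e' R.mor_zero[OF X'(3) X'(3)]] by blast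
      then show ?thesis by blast
    next
      case 2
      have "\<forall>v\<in>{1..n}. v \<noteq> a \<longrightarrow> e' v = 1\<^sub>m (rdim X' v)" using e(2) 2 X'(6) by auto
      then have "\<forall>v\<in>{1..n}. e' v = 1\<^sub>m (rdim X' v)"
        using mor_determined_source[OF X'(3) X'(3) X'(5) e' R.mor_one[OF X'(3)]] by blast
      then show ?thesis by blast
    qed
  qed
qed

lemma reflected_isomorphic:
  assumes X: "reflected X X'" and Y: "reflected Y Y'" and iso: "isomorphic n Q' X' Y'"
  shows "isomorphic n Q X Y"
proof -
  note X' = reflectedD[OF X] and Y' = reflectedD[OF Y]
  obtain f' g' where fg: "R.mor X' Y' f'" "R.mor Y' X' g'"
    "\<forall>v\<in>{1..n}. g' v * f' v = 1\<^sub>m (rdim X' v)" "\<forall>v\<in>{1..n}. f' v * g' v = 1\<^sub>m (rdim Y' v)"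
    by (rule R.isomorphicE[OF iso])
  obtain f where f: "mor X Y f" "\<forall>v\<in>{1..n}. v \<noteq> a \<longrightarrow> f v = f' v"
    by (rule reflect_mor_up[OF X'(1) Y'(1) fg(1)])
  obtain g where g: "mor Y X g" "\<forall>v\<in>{1..n}. v \<noteq> a \<longrightarrow> g v = g' v"
    by (rule reflect_mor_up[OF Y'(1) X'(1) fg(2)])
  show ?thesis
  proof (rule isomorphicI[OF f(1) g(1)])
    fix v assume v: "v \<in> {1..n}"
    show "g v * f v = 1\<^sub>m (rdim X v)"
      by (rule comp_eq_sink[OF X'(2,4) Y'(2) X'(2) f(1) g(1) mor_one[OF X'(2)] _ v])
        (use fg f(2) g(2) X'(6) in auto)
    show "f v * g v = 1\<^sub>m (rdim Y v)"
      by (rule comp_eq_sink[OF Y'(2,4) X'(2) Y'(2) g(1) f(1) mor_one[OF Y'(2)] _ v])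
        (use fg f(2) g(2) Y'(6) in auto)
  qed
qed

text \<open>The equation to be verified is between endomorphisms of \<open>X\<close> or
  \<open>X'\<close>, so uniqueness is required at this end only, and \<open>L\<close> may be an
  arbitrary middle term. For split epimorphisms the same holds at the target.\<close>

lemma reflected_split_mono:
  assumes X: "reflected X X'" and L: "refl_exact L L'" and h: "mor X L h" and h': "R.mor X' L' h'"
    and eq: "\<forall>v\<in>{1..n}. v \<noteq> a \<longrightarrow> h' v = h v"
  shows "split_mono n Q' X' L' h' \<longleftrightarrow> split_mono n Q X L h"
proof
  note X' = reflectedD[OF X]
  have LQ: "rep L" "R.rep L'" using L unfolding refl_exact_def by blast+
  {
    assume "split_mono n Q' X' L' h'"
    then obtain r' where r': "R.mor L' X' r'" "\<forall>v\<in>{1..n}. r' v * h' v = 1\<^sub>m (rdim X' v)"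
      unfolding R.split_mono_iff by blast
    obtain r where r: "mor L X r" "\<forall>v\<in>{1..n}. v \<noteq> a \<longrightarrow> r v = r' v"
      by (rule reflect_mor_up[OF L X'(1) r'(1)])
    have "r v * h v = 1\<^sub>m (rdim X v)" if "v \<in> {1..n}" for v
      by (rule comp_eq_sink[OF X'(2,4) LQ(1) X'(2) h r(1) mor_one[OF X'(2)] _ that])
        (use r r' eq X'(6) in metis)
    then show "split_mono n Q X L h"
      using h r(1) unfolding split_mono_iff by blast
  next
    assume "split_mono n Q X L h"
    then obtain r where r: "mor L X r" "\<forall>v\<in>{1..n}. r v * h v = 1\<^sub>m (rdim X v)"
      unfolding split_mono_iff by blast
    obtain r' where r': "R.mor L' X' r'" "\<forall>v\<in>{1..n}. v \<noteq> a \<longrightarrow> r' v = r v"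
      by (rule reflect_mor_down[OF L X'(1) r(1)])
    have "r' v * h' v = 1\<^sub>m (rdim X' v)" if "v \<in> {1..n}" for v
      by (rule comp_eq_source[OF X'(3) LQ(2) X'(3) X'(5) h' r'(1) R.mor_one[OF X'(3)] _ that])
        (use r r' eq X'(6) in metis)
    then show "split_mono n Q' X' L' h'"
      using h' r'(1) unfolding R.split_mono_iff by blast
  }
qed

lemma reflected_split_epi:
  assumes Y: "reflected Y Y'" and L: "refl_exact L L'" and g: "mor L Y g" and g': "R.mor L' Y' g'"
    and eq: "\<forall>v\<in>{1..n}. v \<noteq> a \<longrightarrow> g' v = g v"
  shows "split_epi n Q' L' Y' g' \<longleftrightarrow> split_epi n Q L Y g"
proof
  note Y' = reflectedD[OF Y]
  have LQ: "rep L" "R.rep L'" using L unfolding refl_exact_def by blast+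
  {
    assume "split_epi n Q' L' Y' g'"
    then obtain r' where r': "R.mor Y' L' r'" "\<forall>v\<in>{1..n}. g' v * r' v = 1\<^sub>m (rdim Y' v)"
      unfolding R.split_epi_iff by blast
    obtain r where r: "mor Y L r" "\<forall>v\<in>{1..n}. v \<noteq> a \<longrightarrow> r v = r' v"
      by (rule reflect_mor_up[OF Y'(1) L r'(1)])
    have "g v * r v = 1\<^sub>m (rdim Y v)" if "v \<in> {1..n}" for v
      by (rule comp_eq_sink[OF Y'(2,4) LQ(1) Y'(2) r(1) g mor_one[OF Y'(2)] _ that])
        (use r r' eq Y'(6) in metis)
    then show "split_epi n Q L Y g"
      using g r(1) unfolding split_epi_iff by blast
  next
    assume "split_epi n Q L Y g"
    then obtain r where r: "mor Y L r" "\<forall>v\<in>{1..n}. g v * r v = 1\<^sub>m (rdim Y v)"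
      unfolding split_epi_iff by blast
    obtain r' where r': "R.mor Y' L' r'" "\<forall>v\<in>{1..n}. v \<noteq> a \<longrightarrow> r' v = r v"
      by (rule reflect_mor_down[OF Y'(1) L r(1)])
    have "g' v * r' v = 1\<^sub>m (rdim Y' v)" if "v \<in> {1..n}" for v
      by (rule comp_eq_source[OF Y'(3) LQ(2) Y'(3) Y'(5) r'(1) g' R.mor_one[OF Y'(3)] _ that])
        (use r r' eq Y'(6) in metis)
    then show "split_epi n Q' L' Y' g'"
      using g' r'(1) unfolding R.split_epi_iff by blast
  }
qed

text \<open>A factorization on one side is carried to the other through a \<open>refl_exact\<close>
  partner of its middle term, one factor splits there by irreducibility, and the splitting is
  carried back.\<close>

lemma reflected_irreducible_iff:
  assumes X: "reflected X X'" and Y: "reflected Y Y'" and f: "mor X Y f" and f': "R.mor X' Y' f'"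
    and eq: "\<forall>v\<in>{1..n}. v \<noteq> a \<longrightarrow> f' v = f v"
  shows "irreducible_morphism n Q' X' Y' f' \<longleftrightarrow> irreducible_morphism n Q X Y f"
proof -
  note X' = reflectedD[OF X] and Y' = reflectedD[OF Y]
  have down: "split_mono n Q X L h \<or> split_epi n Q L Y g"
    if irr: "irreducible_morphism n Q' X' Y' f'" and L: "rep L" and h: "mor X L h" and g: "mor L Y g"
      and gh: "mor_eq n f (mor_comp g h)" for L h g
  proof -
    obtain L' where L': "refl_exact L L'" by (rule ex_reflect_down[OF L])
    have LQ: "R.rep L'" using L' unfolding refl_exact_def by blast
    obtain h' where h': "R.mor X' L' h'" "\<forall>v\<in>{1..n}. v \<noteq> a \<longrightarrow> h' v = h v" by (rule reflect_mor_down[OF X'(1) L' h])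
    obtain g' where g': "R.mor L' Y' g'" "\<forall>v\<in>{1..n}. v \<noteq> a \<longrightarrow> g' v = g v" by (rule reflect_mor_down[OF L' Y'(1) g])
    have "g' v * h' v = f' v" if "v \<in> {1..n}" for v
      by (rule comp_eq_source[OF X'(3) LQ Y'(3) Y'(5) h'(1) g'(1) f' _ that])
        (use h'(2) g'(2) eq gh in \<open>auto simp: mor_eq_def mor_comp_def\<close>)
    then have "mor_eq n f' (mor_comp g' h')" unfolding mor_eq_def mor_comp_def by simp
    then have "split_mono n Q' X' L' h' \<or> split_epi n Q' L' Y' g'"
      using irr LQ h'(1) g'(1) unfolding irreducible_morphism_def by blast
    then show ?thesis
      using reflected_split_mono[OF X L' h h'] reflected_split_epi[OF Y L' g g'] by blast
  qed
  have up: "split_mono n Q' X' L' h' \<or> split_epi n Q' L' Y' g'"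
    if irr: "irreducible_morphism n Q X Y f" and L': "R.rep L'" and h': "R.mor X' L' h'"
      and g': "R.mor L' Y' g'" and gh: "mor_eq n f' (mor_comp g' h')" for L' h' g'
  proof -
    obtain L where L: "refl_exact L L'" by (rule ex_reflect_up[OF L'])
    have LQ: "rep L" using L unfolding refl_exact_def by blast
    obtain h where h: "mor X L h" "\<forall>v\<in>{1..n}. v \<noteq> a \<longrightarrow> h v = h' v" by (rule reflect_mor_up[OF X'(1) L h'])
    obtain g where g: "mor L Y g" "\<forall>v\<in>{1..n}. v \<noteq> a \<longrightarrow> g v = g' v" by (rule reflect_mor_up[OF L Y'(1) g'])
    have "g v * h v = f v" if "v \<in> {1..n}" for v
      by (rule comp_eq_sink[OF X'(2,4) LQ Y'(2) h(1) g(1) f _ that])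
        (use h(2) g(2) eq gh in \<open>auto simp: mor_eq_def mor_comp_def\<close>)
    then have "mor_eq n f (mor_comp g h)" unfolding mor_eq_def mor_comp_def by simp
    then have "split_mono n Q X L h \<or> split_epi n Q L Y g"
      using irr LQ h(1) g(1) unfolding irreducible_morphism_def by blast
    moreover have "\<forall>v\<in>{1..n}. v \<noteq> a \<longrightarrow> h' v = h v" "\<forall>v\<in>{1..n}. v \<noteq> a \<longrightarrow> g' v = g v"
      using h(2) g(2) by simp_all
    ultimately show ?thesis
      using reflected_split_mono[OF X L h(1) h'] reflected_split_epi[OF Y L g(1) g'] by blast
  qed
  have "split_mono n Q' X' Y' f' \<longleftrightarrow> split_mono n Q X Y f" by (rule reflected_split_mono[OF X Y'(1) f f' eq])
  moreover have "split_epi n Q' X' Y' f' \<longleftrightarrow> split_epi n Q X Y f" by (rule reflected_split_epi[OF Y X'(1) f f' eq])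
  ultimately show ?thesis
    using f f' down up unfolding irreducible_morphism_def by blast
qed

lemma reflected_irreducible:
  assumes X: "reflected X X'" and Y: "reflected Y Y'"
  shows "(\<exists>f. irreducible_morphism n Q' X' Y' f) \<longleftrightarrow> (\<exists>f. irreducible_morphism n Q X Y f)"
proof
  note XY = reflectedD(1)[OF X] reflectedD(1)[OF Y]
  {
    assume "\<exists>f. irreducible_morphism n Q' X' Y' f"
    then obtain f' where f': "irreducible_morphism n Q' X' Y' f'" "R.mor X' Y' f'"
      unfolding irreducible_morphism_def by blast
    obtain f where f: "mor X Y f" "\<forall>v\<in>{1..n}. v \<noteq> a \<longrightarrow> f v = f' v" by (rule reflect_mor_up[OF XY f'(2)])
    then have "irreducible_morphism n Q X Y f"
      using reflected_irreducible_iff[OF X Y f(1) f'(2)] f'(1) by simp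
    then show "\<exists>f. irreducible_morphism n Q X Y f" by blast
  next
    assume "\<exists>f. irreducible_morphism n Q X Y f"
    then obtain f where f: "irreducible_morphism n Q X Y f" "mor X Y f"
      unfolding irreducible_morphism_def by blast
    obtain f' where f': "R.mor X' Y' f'" "\<forall>v\<in>{1..n}. v \<noteq> a \<longrightarrow> f' v = f v" by (rule reflect_mor_down[OF XY f(2)])
    then have "irreducible_morphism n Q' X' Y' f'"
      using reflected_irreducible_iff[OF X Y f(2) f'(1)] f(1) by simp
    then show "\<exists>f. irreducible_morphism n Q' X' Y' f" by blast
  }
qed

end

lemma mat_1_1:
  fixes A :: "'a::semiring_1 mat"
  assumes "A \<in> carrier_mat 1 1"
  shows "A = A $$ (0, 0) \<cdot>\<^sub>m 1\<^sub>m 1"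
  using assms by (intro eq_matI) auto

lemma one_mat_neq_zero: "(1\<^sub>m 1 :: 'a::zero_neq_one mat) \<noteq> 0\<^sub>m 1 1"
  unfolding one_mat_eq_zero_mat by simp

lemma (in quiv) rad2_cong:
  assumes "rad2 M N f" "\<And>v. v \<in> {1..n} \<Longrightarrow> g v = f v"
  shows "rad2 M N g"
  using assms unfolding rad2_def by (metis (no_types, lifting))

text \<open>Because \<open>l * h = 1\<close>, the product \<open>h * l\<close> is an idempotent of
  rank one. Indecomposability forces it, extended by zero, to be the identity, which leaves a line
  at \<open>a\<close> and zero elsewhere.\<close>

lemma (in quiv) concentrated_at_vertex:
  assumes ind: "indecomposable n Q X" and a: "a \<in> {1..n}"
    and e: "mor X X (\<lambda>v. if v = a then h * l else 0\<^sub>m (rdim X v) (rdim X v))" (is "mor X X ?e")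
    and h: "h \<in> carrier_mat (rdim X a) 1" and l: "l \<in> carrier_mat 1 (rdim X a)" and lh: "l * h = 1\<^sub>m 1"
    and v: "v \<in> {1..n}"
  shows "rdim X v = (if v = a then 1 else 0)"
proof -
  note d = carrier_matD[OF l] carrier_matD[OF h]
  have "?e v * ?e v = ?e v" if "v \<in> {1..n}" for v
  proof (cases "v = a")
    case True
    have "l * (h * l) = l" using mult_cancel_assoc[OF lh, of l] d by simp
    then show ?thesis using True d by (simp add: mult_assoc_dim)
  qed simp
  then consider "\<forall>v\<in>{1..n}. ?e v = 0\<^sub>m (rdim X v) (rdim X v)" | "\<forall>v\<in>{1..n}. ?e v = 1\<^sub>m (rdim X v)"
    using trivial_idempotents_if_indecomposable[OF ind] e unfolding trivial_idempotents_def by blast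
  then show ?thesis
  proof cases
    case 1
    have "h * l = 0\<^sub>m (rdim X a) (rdim X a)" using bspec[OF 1 a] by simp
    moreover have "l * (h * l * h) = 1\<^sub>m 1"
      using mult_cancel_assoc[OF lh, of "l * h"] d lh by (simp add: mult_assoc_dim)
    ultimately have "(0\<^sub>m 1 1 :: complex mat) = 1\<^sub>m 1" using d by simp
    then show ?thesis using one_mat_neq_zero by metis
  next
    case 2
    show ?thesis
    proof (cases "v = a")
      case True
      have "h * l = 1\<^sub>m (rdim X a)" using bspec[OF 2 a] by simp
      then show ?thesis using inverse_mat_dims[OF h l _ lh] True by simp
    next
      case False
      then have "(1\<^sub>m (rdim X v) :: complex mat) = 0\<^sub>m (rdim X v) (rdim X v)"
        using bspec[OF 2 v] by simp
      then show ?thesis using False by (simp add: one_mat_eq_zero_mat)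
    qed
  qed
qed

section \<open>The simple representation at the sink\<close>

context sink_quiv
begin

lemma functional_arrow:
  assumes X: "rep X" and l: "l \<in> carrier_mat 1 (rdim X a)" "l * in_map X = 0\<^sub>m 1 (tot nb (rdim X))"
    and s: "(s, a) \<in> Q"
  shows "l * rmap X (s, a) = 0\<^sub>m 1 (rdim X s)"
proof -
  have b: "s \<in> nb" using s unfolding nb_def by blast
  have "l * rmap X (s, a) = (l * in_map X) * incl nb (rdim X) s"
    using in_map_incl[OF X b, symmetric] l(1) by (simp add: mult_assoc_dim)
  then show ?thesis unfolding l(2) by simp
qed

text \<open>A functional that kills the image of \<open>in_map X\<close> makes \<open>h * l\<close>,
  extended by zero, an endomorphism; the simple representation at \<open>a\<close> splits
  off.\<close>

lemma indecomposable_not_onto: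
  assumes ind: "indecomposable n Q X" and ninv: "\<not> right_invertible (in_map X)" and v: "v \<in> {1..n}"
  shows "rdim X v = (if v = a then 1 else 0)"
proof -
  have X: "rep X" using ind unfolding indecomposable_def by blast
  obtain l h where l: "l \<in> carrier_mat 1 (rdim X a)" and h: "h \<in> carrier_mat (rdim X a) 1"
    and z: "l * in_map X = 0\<^sub>m 1 (tot nb (rdim X))" and lh: "l * h = 1\<^sub>m 1"
    by (rule right_invertible_or_functional[OF ninv]) auto
  define e where "e v = (if v = a then h * l else 0\<^sub>m (rdim X v) (rdim X v))" for v
  note d = carrier_matD[OF l] carrier_matD[OF h]
  have e: "mor X X e"
  proof (rule morI)
    fix s t assume Q: "(s, t) \<in> Q"
    then have s: "s \<noteq> a" using a_sink by blast
    note dd = rep_dims[OF X Q]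
    show "e t * rmap X (s, t) = rmap X (s, t) * e s"
    proof (cases "t = a")
      case True
      then have "l * rmap X (s, a) = 0\<^sub>m 1 (rdim X s)" using functional_arrow[OF X l z] Q by blast
      then have "h * l * rmap X (s, a) = 0\<^sub>m (rdim X a) (rdim X s)"
        using d dd True by (simp add: mult_assoc_dim)
      then show ?thesis using s dd True by (simp add: e_def)
    qed (use s dd in \<open>simp add: e_def\<close>)
  qed (use d in \<open>auto simp: e_def\<close>)
  show ?thesis by (rule concentrated_at_vertex[OF ind a_vertex e[unfolded e_def] h l lh v])
qed

text \<open>The dual statement at the new source: a vector in the kernel of \<open>out_map X\<close>
  spans a direct summand, because all arrows out of \<open>a\<close> kill it.\<close>

lemma indecomposable_not_into:
  assumes ind: "indecomposable n Q' X" and ninv: "\<not> left_invertible (out_map X)" and v: "v \<in> {1..n}"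
  shows "rdim X v = (if v = a then 1 else 0)"
proof -
  have X: "R.rep X" using ind unfolding indecomposable_def by blast
  obtain h l where h: "h \<in> carrier_mat (rdim X a) 1" and l: "l \<in> carrier_mat 1 (rdim X a)"
    and z: "out_map X * h = 0\<^sub>m (tot nb (rdim X)) 1" and lh: "l * h = 1\<^sub>m 1"
    by (rule left_invertible_or_vector[OF ninv]) auto
  define e where "e v = (if v = a then h * l else 0\<^sub>m (rdim X v) (rdim X v))" for v
  note d = carrier_matD[OF l] carrier_matD[OF h]
  have e: "R.mor X X e"
  proof (rule R.morI)
    fix s t assume Q: "(s, t) \<in> Q'"
    note dd = R.rep_dims[OF X Q]
    from Q have t: "t \<noteq> a" using nb_vertex(2) unfolding reversed_arrow by blast
    show "e t * rmap X (s, t) = rmap X (s, t) * e s"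
    proof (cases "s = a")
      case True
      then have b: "t \<in> nb" using Q a_sink unfolding reversed_arrow by blast
      have "rmap X (a, t) * h = proj nb (rdim X) t * (out_map X * h)"
        using proj_out_map[OF X b, symmetric] d by (simp add: mult_assoc_dim)
      then have "rmap X (a, t) * h = 0\<^sub>m (rdim X t) 1" unfolding z by simp
      then have "rmap X (a, t) * (h * l) = 0\<^sub>m (rdim X t) (rdim X a)"
        using d dd True mult_assoc_dim[of "rmap X (a, t)" h l] by simp
      then show ?thesis using t dd True by (simp add: e_def)
    qed (use t dd in \<open>simp add: e_def\<close>)
  qed (use d in \<open>auto simp: e_def\<close>)
  show ?thesis by (rule R.concentrated_at_vertex[OF ind a_vertex e[unfolded e_def] h l lh v])
qed

text \<open>The dimensions determine it up to isomorphism, since every arrow starts away from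
  \<open>a\<close>, hence at a zero space.\<close>

definition simple_at_sink :: "qrep \<Rightarrow> bool" where
  "simple_at_sink M \<longleftrightarrow> rep M \<and> (\<forall>v\<in>{1..n}. rdim M v = (if v = a then 1 else 0))"

lemma simple_at_sinkD:
  assumes "simple_at_sink M"
  shows "rep M" "rdim M a = 1" "v \<in> {1..n} \<Longrightarrow> v \<noteq> a \<Longrightarrow> rdim M v = 0"
  using assms a_vertex unfolding simple_at_sink_def by auto

lemma ex_simple_at_sink: "\<exists>M. simple_at_sink M"
  unfolding simple_at_sink_def representation_def
  by (rule exI[of _ "\<lparr>rdim = (\<lambda>v. if v = a then 1 else 0),
    rmap = (\<lambda>(s, t). 0\<^sub>m (if t = a then 1 else 0) (if s = a then 1 else 0))\<rparr>"]) auto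

text \<open>All commuting squares start at a zero space of \<open>M\<close>, so a morphism amounts
  to an arbitrary vector of \<open>Y\<close> at \<open>a\<close>.\<close>

lemma mor_from_simple:
  assumes M: "simple_at_sink M" and Y: "rep Y"
    and f: "\<And>v. v \<in> {1..n} \<Longrightarrow> f v \<in> carrier_mat (rdim Y v) (rdim M v)"
  shows "mor M Y f"
proof (rule morI[OF f])
  fix s t assume Q: "(s, t) \<in> Q" and st: "s \<in> {1..n}" "t \<in> {1..n}"
  note M' = simple_at_sinkD[OF M]
  have "s \<noteq> a" using Q a_sink by blast
  then have "rdim M s = 0" using M'(3) st by blast
  then show "f t * rmap M (s, t) = rmap Y (s, t) * f s"
    using rep_dims[OF M'(1) Q] rep_dims[OF Y Q] carrier_matD[OF f[OF st(1)]] carrier_matD[OF f[OF st(2)]]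
    by (intro mat_eq_no_cols) auto
qed

lemma simple_isomorphic:
  assumes M: "simple_at_sink M" and M': "simple_at_sink M'"
  shows "isomorphic n Q M M'"
proof (rule isomorphicI[of _ _ "\<lambda>v. 1\<^sub>m (rdim M v)" "\<lambda>v. 1\<^sub>m (rdim M v)"])
  have eq: "rdim M v = rdim M' v" if "v \<in> {1..n}" for v
    using M M' that unfolding simple_at_sink_def by simp
  show "mor M M' (\<lambda>v. 1\<^sub>m (rdim M v))" "mor M' M (\<lambda>v. 1\<^sub>m (rdim M v))"
    by (intro mor_from_simple M M' simple_at_sinkD(1); simp add: eq)+
qed (use M M' in \<open>auto simp: simple_at_sink_def\<close>)

lemma simple_brick:
  assumes M: "simple_at_sink M"
  shows "brick M"
  unfolding brick_def
proof (intro conjI allI impI)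
  note M' = simple_at_sinkD[OF M]
  show "rep M" by (rule M'(1))
  show "\<not> zero_rep n M" using M'(2) a_vertex unfolding zero_rep_def by force
  fix e assume e: "mor M M e"
  have "e v = e a $$ (0, 0) \<cdot>\<^sub>m 1\<^sub>m (rdim M v)" if v: "v \<in> {1..n}" for v
  proof (cases "v = a")
    case True
    then show ?thesis using mat_1_1[of "e a"] mor_carrier[OF e a_vertex] M'(2) by simp
  next
    case False
    then show ?thesis using M'(3)[OF v] mor_dims[OF e v] by (intro mat_eq_no_rows) auto
  qed
  then show "\<exists>c. \<forall>v\<in>{1..n}. e v = c \<cdot>\<^sub>m 1\<^sub>m (rdim M v)" by blast
qed

lemma simple_generates:
  assumes M: "simple_at_sink M"
  shows "generates a M (1\<^sub>m 1)"
  unfolding generates_def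
proof (intro conjI allI impI)
  note M' = simple_at_sinkD[OF M]
  show "rep M" by (rule M'(1))
  show "1\<^sub>m 1 \<in> carrier_mat (rdim M a) 1" using M'(2) by simp
  fix X and x :: "complex mat" assume X: "rep X \<and> x \<in> carrier_mat (rdim X a) 1"
  define g where "g v = (if v = a then x else 0\<^sub>m (rdim X v) (rdim M v))" for v
  have "mor M X g" using X M'(2) by (intro mor_from_simple M) (auto simp: g_def)
  moreover have "g a * 1\<^sub>m 1 = x" using X right_mult_one_mat[of x] by (auto simp: g_def)
  ultimately show "\<exists>g. mor M X g \<and> g a * 1\<^sub>m 1 = x" by blast
qed

text \<open>Such a morphism vanishes away from \<open>a\<close> for lack of room, and surjectivity
  of \<open>in_map X\<close> propagates this to \<open>a\<close>.\<close>

lemma mor_to_simple_zero: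
  assumes X: "rep X" and inv: "right_invertible (in_map X)" and M: "simple_at_sink M"
    and f: "mor X M f" and v: "v \<in> {1..n}"
  shows "f v = 0\<^sub>m (rdim M v) (rdim X v)"
proof -
  note M' = simple_at_sinkD[OF M]
  have "\<forall>v\<in>{1..n}. v \<noteq> a \<longrightarrow> f v = 0\<^sub>m (rdim M v) (rdim X v)"
  proof (intro ballI impI)
    fix v assume "v \<in> {1..n}" "v \<noteq> a"
    then show "f v = 0\<^sub>m (rdim M v) (rdim X v)"
      using M'(3) mor_dims[OF f] by (intro mat_eq_no_rows) auto
  qed
  then show ?thesis using mor_determined[OF X inv M'(1) f mor_zero[OF X M'(1)] _ v] by blast
qed

text \<open>The test representation is reflected down, the morphism is found there, and it is
  carried back. The vectors \<open>e\<close> and \<open>x\<close> sit at \<open>b\<close>, where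
  reflection changes nothing.\<close>

lemma generates_up:
  assumes P: "refl_exact P P'" and gen: "R.generates b P' e" and b: "b \<in> {1..n}" "b \<noteq> a"
  shows "generates b P e"
  unfolding generates_def
proof (intro conjI allI impI)
  show "rep P" using P unfolding refl_exact_def by blast
  have eq: "rdim P' b = rdim P b" using P b unfolding refl_exact_def by blast
  show "e \<in> carrier_mat (rdim P b) 1" using gen eq unfolding R.generates_def by simp
  fix X and x :: "complex mat" assume X: "rep X \<and> x \<in> carrier_mat (rdim X b) 1"
  then obtain X' where X': "refl_exact X X'" using ex_reflect_down by blast
  then have "R.rep X'" "rdim X' b = rdim X b" using b unfolding refl_exact_def by blast+
  then obtain g' where g': "R.mor P' X' g'" "g' b * e = x" using gen X unfolding R.generates_def by metis
  obtain g where "mor P X g" "\<forall>v\<in>{1..n}. v \<noteq> a \<longrightarrow> g v = g' v" by (rule reflect_mor_up[OF P X' g'(1)])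
  then show "\<exists>g. mor P X g \<and> g b * e = x" using g'(2) b by auto
qed

text \<open>The morphism sends the generator of \<open>M\<close> to the image of \<open>e\<close>
  under the arrow from \<open>b\<close> to \<open>a\<close>. In a factorization through
  \<open>L\<close>, the vector \<open>h a\<close> decides which factor splits: outside the image of
  \<open>in_map L\<close> it is \<open>h\<close>, inside it is \<open>g\<close>.\<close>

lemma irreducible_from_simple:
  assumes M: "simple_at_sink M" and b: "b \<in> nb" and P: "brick P" and gen: "generates b P e"
    and dim: "rdim P b = 1" and onto: "right_invertible (in_map P)" and into: "left_invertible (in_map P)"
  shows "\<exists>f. irreducible_morphism n Q M P f"
proof -
  note M' = simple_at_sinkD[OF M]
  have PQ: "rep P" by (rule brick_rep[OF P])
  note bv = nb_vertex[OF b]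
  have bQ: "(b, a) \<in> Q" using b unfolding nb_def by blast
  have e: "e \<in> carrier_mat 1 1" using gen dim unfolding generates_def by simp
  \<comment> \<open>A zero generator could not be sent to the nonzero vector 1 of the
    one-dimensional space of \<open>P\<close> at \<open>b\<close>.\<close>
  have e_nz: "e $$ (0, 0) \<noteq> 0"
  proof
    assume "e $$ (0, 0) = 0"
    then have "e = 0\<^sub>m 1 1" using mat_1_1[OF e] e by (auto simp: zero_smult_mat)
    moreover have "1\<^sub>m 1 \<in> carrier_mat (rdim P b) 1" using dim by simp
    then obtain g where "mor P P g" "g b * e = 1\<^sub>m 1"
      using gen PQ unfolding generates_def by blast
    ultimately have "(0\<^sub>m 1 1 :: complex mat) = 1\<^sub>m 1"
      using mor_dims[OF \<open>mor P P g\<close> bv(1)] dim by simp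
    then show False using one_mat_neq_zero by metis
  qed
  define f where "f v = (if v = a then rmap P (b, a) * e else 0\<^sub>m (rdim P v) (rdim M v))" for v
  note d = rep_dims[OF PQ bQ] carrier_matD[OF e] dim
  have f: "mor M P f" using d M'(2) by (intro mor_from_simple M PQ) (auto simp: f_def)
  have fa: "f a = in_map P * (incl nb (rdim P) b * e)"
    unfolding f_def using in_map_incl[OF PQ b, symmetric] d by (simp add: mult_assoc_dim)
  have "\<not> split_mono n Q M P f"
  proof
    assume "split_mono n Q M P f"
    then obtain r where r: "mor P M r" "r a * f a = 1\<^sub>m (rdim M a)"
      using a_vertex unfolding split_mono_iff by blast
    have "r a = 0\<^sub>m (rdim M a) (rdim P a)" by (rule mor_to_simple_zero[OF PQ onto M r(1) a_vertex])
    then have "(1\<^sub>m 1 :: complex mat) = 0\<^sub>m 1 1" using r(2) M'(2) mor_dims[OF f a_vertex] by simp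
    then show False using one_mat_neq_zero by metis
  qed
  moreover have "\<not> split_epi n Q M P f"
  proof
    assume "split_epi n Q M P f"
    then obtain r where r: "mor P M r" "f b * r b = 1\<^sub>m (rdim P b)"
      using bv(1) unfolding split_epi_iff by blast
    have "r b = 0\<^sub>m (rdim M b) (rdim P b)" by (rule mor_to_simple_zero[OF PQ onto M r(1) bv(1)])
    then have "(1\<^sub>m 1 :: complex mat) = 0\<^sub>m 1 1" using r(2) dim mor_dims[OF f bv(1)] by simp
    then show False using one_mat_neq_zero by metis
  qed
  moreover have "split_mono n Q M L h \<or> split_epi n Q L P g"
    if L: "rep L" and h: "mor M L h" and g: "mor L P g" and eq: "mor_eq n f (mor_comp g h)" for L h g
  proof -
    have "h a \<in> carrier_mat (dim_row (in_map L)) 1" using mor_carrier[OF h a_vertex] M'(2) by simp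
    then show ?thesis
    proof (cases rule: image_or_functional)
      case (functional l)
      \<comment> \<open>A functional that vanishes on the image of \<open>in_map L\<close> is a
        morphism to the simple representation; its value 1 on \<open>h a\<close> makes it a
        retraction of \<open>h\<close>.\<close>
      define r where "r v = (if v = a then l else 0\<^sub>m (rdim M v) (rdim L v))" for v
      have r: "mor L M r"
      proof (rule morI)
        fix s t assume Q: "(s, t) \<in> Q" and st: "s \<in> {1..n}" "t \<in> {1..n}"
        have s: "s \<noteq> a" using Q a_sink by blast
        note dd = rep_dims[OF L Q] rep_dims[OF M'(1) Q] M'(3)[OF st(1) s]
        show "r t * rmap L (s, t) = rmap M (s, t) * r s"
        proof (cases "t = a")
          case True
          have "l * rmap L (s, a) = 0\<^sub>m 1 (rdim L s)"
            using functional_arrow[OF L, of l s] functional(1,2) Q True by simp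
          then show ?thesis using True s dd M'(2) by (simp add: r_def)
        next
          case False
          then show ?thesis using dd s by (simp add: r_def)
        qed
      qed (use functional(1) M'(2) in \<open>auto simp: r_def\<close>)
      have "r v * h v = 1\<^sub>m (rdim M v)" if v: "v \<in> {1..n}" for v
      proof (cases "v = a")
        case True
        then show ?thesis using functional(3) M'(2) by (simp add: r_def)
      next
        case False
        then show ?thesis using M'(3)[OF v False] mor_dims[OF h v]
          by (intro mat_eq_no_rows) (auto simp: r_def)
      qed
      then have "split_mono n Q M L h"
        using h r unfolding split_mono_iff by blast
      then show ?thesis ..
    next
      case (image y)
      have y: "dim_row y = tot nb (rdim L)" "dim_col y = 1" using image(1) by auto
      note gd = mor_dims[OF g a_vertex] mor_dims[OF g bv(1)]
      have "in_map P * (incl nb (rdim P) b * e) = g a * h a"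
        using fa eq a_vertex unfolding mor_eq_def mor_comp_def by auto
      also have "\<dots> = (g a * in_map L) * y"
        unfolding image(2) using y gd by (simp add: mult_assoc_dim)
      also have "\<dots> = in_map P * (diag L P g * y)"
        using g mor_sink_iff[OF L PQ, of g] y by (simp add: mult_assoc_dim)
      \<comment> \<open>Injectivity of \<open>in_map P\<close> is decisive: the vector concentrated
        at \<open>b\<close> with value \<open>e\<close> is the only preimage of \<open>f a\<close>,
        so \<open>g\<close> must send \<open>y\<close> to it.\<close>
      finally have "incl nb (rdim P) b * e = diag L P g * y"
        by (rule mult_left_cancel[OF into]) (use d in auto)
      then have "proj nb (rdim P) b * (incl nb (rdim P) b * e) = proj nb (rdim P) b * (diag L P g * y)" by simp
      then have "(proj nb (rdim P) b * incl nb (rdim P) b) * e = (proj nb (rdim P) b * diag L P g) * y"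
        using d y by (simp add: mult_assoc_dim)
      moreover have "proj nb (rdim P) b * diag L P g = g b * proj nb (rdim L) b"
        using b nb_vertex(1) mor_carrier[OF g] by (intro proj_block_diag) auto
      ultimately have e_eq: "e = g b * (proj nb (rdim L) b * y)"
        unfolding proj_incl[OF finite_nb b b] using d y gd by (simp add: mult_assoc_dim)
      have "proj nb (rdim L) b * y \<in> carrier_mat (rdim L b) 1" using y by auto
      \<comment> \<open>The block of \<open>y\<close> at \<open>b\<close> is mapped to
        \<open>e\<close> by \<open>g b\<close>, so the morphism \<open>u\<close> that sends the
        generator to this block is a candidate section: \<open>g * u\<close> is a scalar that fixes
        \<open>e\<close>.\<close>
      then obtain u where u: "mor P L u" "u b * e = proj nb (rdim L) b * y"
        using gen L unfolding generates_def by blast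
      obtain c where c: "\<forall>v\<in>{1..n}. g v * u v = c \<cdot>\<^sub>m 1\<^sub>m (rdim P v)"
        using mor_comp_mor[OF PQ L PQ u(1) g] by (rule brick_endo[OF P])
      have "e = (g b * u b) * e"
        using e_eq[folded u(2)] gd mor_dims[OF u(1) bv(1)] d by (simp add: mult_assoc_dim)
      also have "\<dots> = c \<cdot>\<^sub>m e" using c bv(1) d by (simp add: smult_mult_dim)
      finally have "e $$ (0, 0) = (c \<cdot>\<^sub>m e) $$ (0, 0)" by simp
      then have "c = 1" using e_nz e by simp
      then have "split_epi n Q L P g"
        using g u(1) c unfolding split_epi_iff
        by (auto simp: one_smult_mat)
      then show ?thesis ..
    qed
  qed
  ultimately show ?thesis using f unfolding irreducible_morphism_def by blast
qed

text \<open>Each summand of the vector factors through a brick \<open>P\<close>. The factor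
  \<open>M -> P\<close> has no morphism back, since \<open>in_map P\<close> is onto; the factor
  \<open>P -> N\<close> composes to zero with every morphism back, as the two bricks are not
  isomorphic. The summands are collected by \<open>rad2_add\<close>.\<close>

lemma rad2_from_simple:
  assumes M: "simple_at_sink M" and N: "brick N" and onto: "right_invertible (in_map N)"
    and f: "mor M N f"
    and gen: "\<And>b. b \<in> nb \<Longrightarrow> rdim N b \<noteq> 0 \<Longrightarrow> \<exists>P e. brick P \<and> generates b P e \<and>
      right_invertible (in_map P) \<and> \<not> isomorphic n Q P N"
  shows "rad2 M N f"
proof -
  note M' = simple_at_sinkD[OF M]
  have NQ: "rep N" by (rule brick_rep[OF N])
  obtain G where G: "G \<in> carrier_mat (tot nb (rdim N)) (rdim N a)" "in_map N * G = 1\<^sub>m (rdim N a)"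
    using onto unfolding right_invertible_def by auto
  \<comment> \<open>A preimage of the vector \<open>f a\<close> under \<open>in_map N\<close>; its
    block at \<open>b\<close> is the contribution of the neighbour \<open>b\<close>.\<close>
  define y where "y = G * f a"
  have y: "y \<in> carrier_mat (tot nb (rdim N)) 1"
    unfolding y_def using G(1) mor_carrier[OF f a_vertex] M'(2) by auto
  note yd = carrier_matD[OF y]
  have fy: "f a = in_map N * y"
    unfolding y_def using mult_cancel_assoc[OF G(2), of "f a"] G(1) mor_dims[OF f a_vertex] by simp
  \<comment> \<open>Reads a vector of \<open>N\<close> at \<open>a\<close> as a morphism from
    \<open>M\<close>.\<close>
  define ext where "ext w v = (if v = a then w else 0\<^sub>m (rdim N v) (rdim M v))" for w :: "complex mat" and v
  have single: "rad2 M N (ext (rmap N (b, a) * (proj nb (rdim N) b * y)))" if b: "b \<in> nb" for b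
  proof (cases "rdim N b = 0")
    case True
    have bQ: "(b, a) \<in> Q" using b unfolding nb_def by blast
    have "rmap N (b, a) * (proj nb (rdim N) b * y) = 0\<^sub>m (rdim N a) 1"
      using rep_dims[OF NQ bQ] True yd by (intro eq_matI) (auto simp: scalar_prod_def)
    then show ?thesis using M'(2) by (intro rad2_zero M'(1) NQ) (auto simp: ext_def)
  next
    case False
    then obtain P e where P: "brick P" "generates b P e" "right_invertible (in_map P)" "\<not> isomorphic n Q P N"
      using gen b by blast
    have PQ: "rep P" by (rule brick_rep[OF P(1)])
    have bQ: "(b, a) \<in> Q" using b unfolding nb_def by blast
    note bv = nb_vertex[OF b]
    have e: "e \<in> carrier_mat (rdim P b) 1" using P(2) unfolding generates_def by blast
    have "proj nb (rdim N) b * y \<in> carrier_mat (rdim N b) 1" using yd by auto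
    then obtain u where u: "mor P N u" "u b * e = proj nb (rdim N) b * y"
      using P(2) NQ unfolding generates_def by blast
    define h where "h v = (if v = a then rmap P (b, a) * e else 0\<^sub>m (rdim P v) (rdim M v))" for v
    note d = rep_dims[OF PQ bQ] carrier_matD[OF e] rep_dims[OF NQ bQ] mor_dims[OF u(1) a_vertex]
      mor_dims[OF u(1) bv(1)]
    have h: "mor M P h" using d M'(2) by (intro mor_from_simple M PQ) (auto simp: h_def)
    have uh: "ext (rmap N (b, a) * (proj nb (rdim N) b * y)) v = u v * h v" if v: "v \<in> {1..n}" for v
    proof (cases "v = a")
      case True
      have "u a * (rmap P (b, a) * e) = (u a * rmap P (b, a)) * e" using d by (simp add: mult_assoc_dim)
      also have "\<dots> = rmap N (b, a) * (u b * e)"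
        unfolding mor_comm[OF u(1) bQ] using d by (simp add: mult_assoc_dim)
      finally show ?thesis using True u(2) by (simp add: ext_def h_def)
    next
      case False
      then show ?thesis using mor_dims[OF u(1) v] by (simp add: ext_def h_def)
    qed
    have rh: "r v * h v = 0\<^sub>m (rdim M v) (rdim M v)" if "mor P M r" "v \<in> {1..n}" for r v
      using mor_to_simple_zero[OF PQ P(3) M that] mor_dims[OF h that(2)] by simp
    have ur: "u v * r v = 0\<^sub>m (rdim N v) (rdim N v)" if "mor N P r" "v \<in> {1..n}" for r v
      by (rule brick_comp_zero_or_isomorphic[OF P(1) N u(1) that(1) P(4) that(2)])
    show ?thesis
      unfolding rad2_def using PQ h u(1) uh rh ur by blast
  qed
  \<comment> \<open>Induction on a set \<open>C\<close> of neighbours: \<open>w\<close> has the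
    blocks of \<open>y\<close> inside \<open>C\<close> and zero blocks outside, hence equals
    \<open>y\<close> when \<open>C\<close> contains all neighbours.\<close>
  have partial: "\<exists>w \<in> carrier_mat (tot nb (rdim N)) 1.
      (\<forall>b\<in>nb. proj nb (rdim N) b * w = (if b \<in> C then proj nb (rdim N) b * y else 0\<^sub>m (rdim N b) 1)) \<and>
      rad2 M N (ext (in_map N * w))" if "C \<subseteq> nb" for C
    using finite_subset[OF that finite_nb] that
  proof (induction C rule: finite_induct)
    case empty
    have "rad2 M N (ext (in_map N * 0\<^sub>m (tot nb (rdim N)) 1))"
      using M'(2) by (intro rad2_zero M'(1) NQ) (auto simp: ext_def)
    then show ?case by (intro bexI[of _ "0\<^sub>m (tot nb (rdim N)) 1"]) auto
  next
    case (insert b C)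
    then obtain w where w: "w \<in> carrier_mat (tot nb (rdim N)) 1"
      and pw: "\<forall>b\<in>nb. proj nb (rdim N) b * w = (if b \<in> C then proj nb (rdim N) b * y else 0\<^sub>m (rdim N b) 1)"
      and rw: "rad2 M N (ext (in_map N * w))" by auto
    have b: "b \<in> nb" using insert by auto
    note wd = carrier_matD[OF w]
    define w' where "w' = w + incl nb (rdim N) b * (proj nb (rdim N) b * y)"
    have w': "w' \<in> carrier_mat (tot nb (rdim N)) 1" unfolding w'_def using w yd by auto
    moreover have "proj nb (rdim N) c * w' = (if c \<in> insert b C then proj nb (rdim N) c * y else 0\<^sub>m (rdim N c) 1)"
      if c: "c \<in> nb" for c
    proof -
      have "proj nb (rdim N) c * w' = proj nb (rdim N) c * w +
          (proj nb (rdim N) c * incl nb (rdim N) b) * (proj nb (rdim N) b * y)"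
        unfolding w'_def using wd yd by (simp add: mult_add_dim mult_assoc_dim)
      then show ?thesis
        unfolding proj_incl[OF finite_nb c b] using pw c insert(2) yd
        by (auto simp: add_zero_dim)
    qed
    moreover have "rad2 M N (ext (in_map N * w'))"
    proof (rule rad2_cong[OF rad2_add[OF M'(1) NQ rw single[OF b]]])
      fix v assume v: "v \<in> {1..n}"
      have "in_map N * w' = in_map N * w + (in_map N * incl nb (rdim N) b) * (proj nb (rdim N) b * y)"
        unfolding w'_def using wd yd by (simp add: mult_add_dim mult_assoc_dim)
      then show "ext (in_map N * w') v = ext (in_map N * w) v + ext (rmap N (b, a) * (proj nb (rdim N) b * y)) v"
        unfolding in_map_incl[OF NQ b] by (simp add: ext_def)
    qed
    ultimately show ?case by blast
  qed
  obtain w where w: "w \<in> carrier_mat (tot nb (rdim N)) 1" "\<forall>b\<in>nb. proj nb (rdim N) b * w = proj nb (rdim N) b * y"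
    and rw: "rad2 M N (ext (in_map N * w))"
    using partial[OF subset_refl] by auto
  have "w = y" by (rule pairing_ext[OF finite_nb]) (use w y in auto)
  show ?thesis
  proof (rule rad2_cong[OF rw])
    fix v assume v: "v \<in> {1..n}"
    show "f v = ext (in_map N * w) v"
    proof (cases "v = a")
      case True
      then show ?thesis using fy \<open>w = y\<close> by (simp add: ext_def)
    next
      case False
      then show ?thesis using M'(3)[OF v False] mor_dims[OF f v]
        by (intro mat_eq_no_cols) (auto simp: ext_def)
    qed
  qed
qed

end

section \<open>Simple reflections and reduced words\<close>

definition simple_graph :: "nat \<Rightarrow> nat set set \<Rightarrow> bool" where
  "simple_graph n D \<longleftrightarrow> (\<forall>i j. linked D i j \<longrightarrow> i \<in> {1..n} \<and> j \<in> {1..n} \<and> i \<noteq> j)"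

lemma linked_sym: "linked D i j \<longleftrightarrow> linked D j i"
  unfolding linked_def by (simp add: insert_commute)

lemma standard_ade_edge:
  assumes "standard_ade n E" "e \<in> E"
  obtains x y where "e = {x, y}" "x \<noteq> y" "x \<in> {1..n}" "y \<in> {1..n}"
proof -
  have "\<exists>x y. e = {x, y} \<and> x \<noteq> y \<and> x \<in> {1..n} \<and> y \<in> {1..n}"
    using assms(1) unfolding standard_ade_def
  proof (elim disjE conjE)
    assume "E = edges_A n"
    then obtain i where "e = {i, i + 1}" "1 \<le> i" "i < n" using assms(2) unfolding edges_A_def by blast
    then show ?thesis by (intro exI[of _ i] exI[of _ "i + 1"]) auto
  next
    assume n: "4 \<le> n" and "E = edges_D n"
    then consider i where "e = {i, i + 1}" "1 \<le> i" "i < n - 1" | "e = {n - 2, n}"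
      using assms(2) unfolding edges_D_def by blast
    then show ?thesis
    proof cases
      case (1 i)
      then show ?thesis by (intro exI[of _ i] exI[of _ "i + 1"]) auto
    next
      case 2
      then show ?thesis using n by (intro exI[of _ "n - 2"] exI[of _ n]) auto
    qed
  next
    assume n: "n \<in> {6, 7, 8}" and "E = edges_E n"
    then consider i where "e = {i, i + 1}" "4 \<le> i" "i < n" | "e = {1, 3}" | "e = {2, 4}" | "e = {3, 4}"
      using assms(2) unfolding edges_E_def by blast
    then show ?thesis
    proof cases
      case (1 i)
      then show ?thesis by (intro exI[of _ i] exI[of _ "i + 1"]) auto
    next
      case 2
      then show ?thesis using n by (intro exI[of _ 1] exI[of _ 3]) auto
    next
      case 3
      then show ?thesis using n by (intro exI[of _ 2] exI[of _ 4]) auto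
    next
      case 4
      then show ?thesis using n by (intro exI[of _ 3] exI[of _ 4]) auto
    qed
  qed
  then show thesis using that by blast
qed

lemma ade_simple_graph:
  assumes "ade_diagram n D"
  shows "simple_graph n D"
  unfolding simple_graph_def
proof (intro allI impI)
  fix i j assume "linked D i j"
  from assms obtain E \<pi> where E: "standard_ade n E" and \<pi>: "bij_betw \<pi> {1..n} {1..n}"
    and D: "D = (\<lambda>e. \<pi> ` e) ` E" unfolding ade_diagram_def by blast
  obtain e where e: "e \<in> E" "{i, j} = \<pi> ` e" using \<open>linked D i j\<close> D unfolding linked_def by blast
  obtain x y where xy: "e = {x, y}" "x \<noteq> y" "x \<in> {1..n}" "y \<in> {1..n}"
    using standard_ade_edge[OF E e(1)] .
  have "\<pi> x \<noteq> \<pi> y" using \<pi> xy(2-4) unfolding bij_betw_def inj_on_def by blast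
  moreover have "\<pi> x \<in> {1..n}" "\<pi> y \<in> {1..n}" using \<pi> xy(3,4) bij_betwE by blast+
  moreover have "i = \<pi> x \<and> j = \<pi> y \<or> i = \<pi> y \<and> j = \<pi> x"
    using e(2) xy(1) by (auto simp: doubleton_eq_iff)
  ultimately show "i \<in> {1..n} \<and> j \<in> {1..n} \<and> i \<noteq> j" by metis
qed

definition coroot :: "nat \<Rightarrow> nat set set \<Rightarrow> nat \<Rightarrow> lattice \<Rightarrow> int" where
  "coroot n D a v = (\<Sum>l = 1..n. cartan D a l * v l)"

lemma simple_reflection_eq: "simple_reflection n D a v = (\<lambda>j. v j - coroot n D a v * simple_root a j)"
  unfolding simple_reflection_def coroot_def ..

text \<open>Linearity is stated for \<open>v - k w\<close> because this is the shape of a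
  reflection; the later linearity lemmas follow the same pattern.\<close>

lemma coroot_lin: "coroot n D a (\<lambda>j. v j - k * w j) = coroot n D a v - k * coroot n D a w"
  unfolding coroot_def by (simp add: algebra_simps sum_subtractf sum_distrib_left)

lemma coroot_simple: "b \<in> {1..n} \<Longrightarrow> coroot n D a (simple_root b) = cartan D a b"
  unfolding coroot_def simple_root_def
  by (subst sum.cong[OF refl, of _ _ "\<lambda>l. if l = b then cartan D a b else 0"]) auto

lemma simple_reflection_lin:
  "simple_reflection n D a (\<lambda>j. v j - k * w j) = (\<lambda>j. simple_reflection n D a v j - k * simple_reflection n D a w j)"
  unfolding simple_reflection_eq coroot_lin by (simp add: algebra_simps)

lemma coroot_reflection: "a \<in> {1..n} \<Longrightarrow> coroot n D a (simple_reflection n D a v) = - coroot n D a v"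
  unfolding simple_reflection_eq coroot_lin by (simp add: coroot_simple cartan_def)

lemma simple_reflection_involution:
  "a \<in> {1..n} \<Longrightarrow> simple_reflection n D a (simple_reflection n D a v) = v"
  unfolding simple_reflection_eq[of n D a "simple_reflection n D a v"]
  by (simp add: coroot_reflection) (simp add: simple_reflection_eq)

lemma simple_reflection_simple:
  "a \<in> {1..n} \<Longrightarrow> simple_reflection n D a (simple_root a) = (\<lambda>j. - simple_root a j)"
  unfolding simple_reflection_eq by (simp add: coroot_simple cartan_def)

text \<open>The symmetric bilinear form of the Cartan matrix. Its invariance under words serves to
  compare coroots in \<open>conjugate_reflection\<close>.\<close>

definition root_form :: "nat \<Rightarrow> nat set set \<Rightarrow> lattice \<Rightarrow> lattice \<Rightarrow> int" where
  "root_form n D v w = (\<Sum>i = 1..n. v i * coroot n D i w)"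

lemma cartan_sym: "cartan D i j = cartan D j i"
  unfolding cartan_def using linked_sym[of D i j] by simp

lemma root_form_sym: "root_form n D v w = root_form n D w v"
proof -
  have "root_form n D v w = (\<Sum>i = 1..n. \<Sum>j = 1..n. v i * cartan D i j * w j)"
    unfolding root_form_def coroot_def by (simp add: sum_distrib_left mult.assoc)
  also have "\<dots> = (\<Sum>j = 1..n. \<Sum>i = 1..n. w j * (cartan D j i * v i))"
    by (subst sum.swap) (simp add: cartan_sym[of D _ j for j] mult_ac)
  also have "\<dots> = root_form n D w v"
    unfolding root_form_def coroot_def by (simp add: sum_distrib_left)
  finally show ?thesis .
qed

lemma root_form_simple: "a \<in> {1..n} \<Longrightarrow> root_form n D (simple_root a) w = coroot n D a w"
  unfolding root_form_def simple_root_def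
  by (subst sum.cong[OF refl, of _ _ "\<lambda>i. if i = a then coroot n D a w else 0"]) auto

lemma root_form_lin: "root_form n D (\<lambda>j. v j - k * u j) w = root_form n D v w - k * root_form n D u w"
  unfolding root_form_def by (simp add: algebra_simps sum_subtractf sum_distrib_left)

lemma root_form_reflection:
  assumes a: "a \<in> {1..n}"
  shows "root_form n D (simple_reflection n D a v) (simple_reflection n D a w) = root_form n D v w"
proof -
  have *: "root_form n D (simple_reflection n D a v) w = root_form n D v w - coroot n D a v * coroot n D a w" for v w
    unfolding simple_reflection_eq root_form_lin root_form_simple[OF a] ..
  have "root_form n D v (simple_reflection n D a w) = root_form n D v w - coroot n D a w * coroot n D a v"
    using *[of w v] by (simp add: root_form_sym)
  then show ?thesis unfolding *[of v "simple_reflection n D a w"] coroot_reflection[OF a] by simp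
qed

lemma word_product_simps [simp]:
  "word_product n D [] = id"
  "word_product n D (a # ws) v = simple_reflection n D a (word_product n D ws v)"
  unfolding word_product_def by simp_all

lemma word_product_append: "word_product n D (us @ vs) v = word_product n D us (word_product n D vs v)"
  by (induction us) simp_all

lemma word_product_lin:
  "word_product n D ws (\<lambda>j. v j - k * w j) = (\<lambda>j. word_product n D ws v j - k * word_product n D ws w j)"
  by (induction ws) (simp_all add: simple_reflection_lin)

lemma root_form_word_product:
  "set ws \<subseteq> {1..n} \<Longrightarrow> root_form n D (word_product n D ws v) (word_product n D ws w) = root_form n D v w"
  by (induction ws) (simp_all add: root_form_reflection)

text \<open>The relation \<open>s_a u s_b = u\<close> for a Weyl group element \<open>u\<close> that
  takes the simple root at \<open>b\<close> to that at \<open>a\<close>. Invariance of the form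
  identifies the coroot at \<open>a\<close> after \<open>u\<close> with the coroot at
  \<open>b\<close> before it.\<close>

lemma conjugate_reflection:
  assumes us: "set us \<subseteq> {1..n}" and ab: "a \<in> {1..n}" "b \<in> {1..n}"
    and eq: "word_product n D us (simple_root b) = simple_root a"
  shows "simple_reflection n D a (word_product n D us (simple_reflection n D b v)) = word_product n D us v"
proof -
  let ?u = "word_product n D us"
  have c: "coroot n D a (?u v) = coroot n D b v"
    using root_form_word_product[OF us, of D "simple_root b" v] ab by (simp add: eq root_form_simple)
  have "?u (simple_reflection n D b v) = (\<lambda>j. ?u v j - coroot n D b v * simple_root a j)"
    unfolding simple_reflection_eq word_product_lin eq ..
  also have "\<dots> = simple_reflection n D a (?u v)" unfolding simple_reflection_eq c ..
  finally show ?thesis using simple_reflection_involution[OF ab(1)] by simp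
qed

definition word_root :: "nat \<Rightarrow> nat set set \<Rightarrow> nat list \<Rightarrow> nat \<Rightarrow> lattice" where
  "word_root n D ws p = word_product n D (take p ws) (simple_root (ws ! p))"

lemma word_root_Cons [simp]:
  "word_root n D (a # ws) 0 = simple_root a"
  "word_root n D (a # ws) (Suc p) = simple_reflection n D a (word_root n D ws p)"
  unfolding word_root_def by simp_all

text \<open>This weak consequence of reducedness is what the construction of representations needs: no
  intermediate root is the simple root at which it is about to be reflected.\<close>

fun good_word :: "nat \<Rightarrow> nat set set \<Rightarrow> nat list \<Rightarrow> bool" where
  "good_word n D [] \<longleftrightarrow> True"
| "good_word n D (a # ws) \<longleftrightarrow> good_word n D ws \<and> (\<forall>p<length ws. word_root n D ws p \<noteq> simple_root a)"

text \<open>If the root at \<open>p\<close> in the tail were the simple root at \<open>a\<close>,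
  then \<open>conjugate_reflection\<close> with \<open>u\<close> the product of
  \<open>take p ws\<close> would cancel \<open>a\<close> against the letter \<open>ws ! p\<close>,
  giving the same product with two letters fewer.\<close>

lemma good_word_if_minimal:
  assumes "set ws \<subseteq> {1..n}"
    "\<And>js. set js \<subseteq> {1..n} \<Longrightarrow> word_product n D js = word_product n D ws \<Longrightarrow> length ws \<le> length js"
  shows "good_word n D ws"
  using assms
proof (induction ws)
  case (Cons a ws)
  have "length ws \<le> length js" if "set js \<subseteq> {1..n}" "word_product n D js = word_product n D ws" for js
    using Cons.prems(2)[of "a # js"] Cons.prems(1) that by (auto simp: fun_eq_iff)
  then have "good_word n D ws" using Cons by auto
  moreover have "word_root n D ws p \<noteq> simple_root a" if p: "p < length ws" for p
  proof
    assume eq: "word_root n D ws p = simple_root a"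
    have "ws = take p ws @ ws ! p # drop (Suc p) ws" using p by (rule id_take_nth_drop)
    then have wp: "word_product n D ws v =
      word_product n D (take p ws) (simple_reflection n D (ws ! p) (word_product n D (drop (Suc p) ws) v))" for v
      by (metis word_product_append word_product_simps(2))
    have mem: "set (take p ws) \<subseteq> {1..n}" "a \<in> {1..n}" "ws ! p \<in> {1..n}"
    proof -
      have "set ws \<subseteq> {1..n}" "a \<in> {1..n}" using Cons.prems(1) by auto
      then show "set (take p ws) \<subseteq> {1..n}" "a \<in> {1..n}" "ws ! p \<in> {1..n}"
        using set_take_subset[of p ws] nth_mem[OF p] by blast+
    qed
    have "word_product n D (take p ws @ drop (Suc p) ws) = word_product n D (a # ws)"
    proof
      fix v
      show "word_product n D (take p ws @ drop (Suc p) ws) v = word_product n D (a # ws) v"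
        unfolding word_product_append word_product_simps(2) wp
        by (rule conjugate_reflection[OF mem eq[unfolded word_root_def], symmetric])
    qed
    moreover have "set (take p ws @ drop (Suc p) ws) \<subseteq> {1..n}"
      using Cons.prems(1) set_take_subset[of p ws] set_drop_subset[of "Suc p" ws] by auto
    ultimately have "length (a # ws) \<le> length (take p ws @ drop (Suc p) ws)"
      using Cons.prems(2) by blast
    then show False using p by simp
  qed
  ultimately show ?case by simp
qed simp

lemma reduced_good_word:
  assumes "reduced_expression n D ws w"
  shows "good_word n D ws"
proof (rule good_word_if_minimal)
  show "set ws \<subseteq> {1..n}" using assms unfolding reduced_expression_def by blast
  fix js assume "set js \<subseteq> {1..n}" "word_product n D js = word_product n D ws"
  then show "length ws \<le> length js"
    using assms unfolding reduced_expression_def weyl_length_def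
    by (metis (mono_tags, lifting) Least_le)
qed

lemma word_product_fixes: "b \<notin> set us \<Longrightarrow> word_product n D us v b = v b"
  by (induction us) (auto simp: simple_reflection_eq simple_root_def)

text \<open>A reflection changes its own coordinate only. Hence a root has coordinate 1 at a letter
  that occurs for the first time, and 0 at every other letter not yet used.\<close>

lemma word_root_coordinate:
  assumes "b \<notin> set (take p ws)"
  shows "word_root n D ws p b = (if b = ws ! p then 1 else 0)"
  unfolding word_root_def word_product_fixes[OF assms] simple_root_def by simp

section \<open>Adapted words\<close>

text \<open>An arrow out of \<open>x\<close> keeps \<open>x\<close> from being a sink, and it is
  reversed only when one of its ends is used; as \<open>x\<close> cannot be, \<open>y\<close> must
  come earlier.\<close>

lemma arrow_source_waits:
  assumes "adapted n Q ws" "(x, y) \<in> Q" "x \<noteq> y" "k < length ws" "ws ! k = x"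
  shows "y \<in> set (take k ws)"
  using assms
proof (induction ws arbitrary: Q k)
  case (Cons c cs)
  have c: "c \<noteq> x" using Cons.prems(1-3) by (auto simp: sink_def)
  with Cons.prems obtain k' where k: "k = Suc k'" by (cases k) auto
  show ?case
  proof (cases "c = y")
    case False
    then have "(x, y) \<in> reverse_at c Q" using Cons.prems(2) by (auto simp: reverse_at_def)
    then show ?thesis using Cons k by auto
  qed (simp add: k)
qed simp

text \<open>Using \<open>y\<close> turns the arrow towards \<open>x\<close>, after which
  \<open>y\<close> has to wait for \<open>x\<close>. So \<open>y\<close> occurs at most once before
  \<open>x\<close> does.\<close>

lemma arrow_target_first:
  assumes "adapted n Q ws" "(x, y) \<in> Q" "x \<noteq> y" "k < length ws" "ws ! k = y" "x \<notin> set (take k ws)"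
  shows "y \<notin> set (take k ws)"
  using assms
proof (induction ws arbitrary: Q k)
  case (Cons c cs)
  show ?case
  proof (cases k)
    case (Suc k')
    have c: "c \<noteq> x" using Cons.prems(6) Suc by auto
    have "c \<noteq> y"
    proof
      assume "c = y"
      then have "(y, x) \<in> reverse_at c Q" using Cons.prems(2) by (auto simp: reverse_at_def)
      then have "x \<in> set (take k' cs)"
        using arrow_source_waits[of n "reverse_at c Q" cs y x k'] Cons.prems Suc by auto
      then show False using Cons.prems(6) Suc by simp
    qed
    then have "(x, y) \<in> reverse_at c Q" using Cons.prems(2) by (auto simp: reverse_at_def)
    then have "y \<notin> set (take k' cs)" using Cons Suc by auto
    then show ?thesis using Suc \<open>c \<noteq> y\<close> by simp
  qed simp
qed simp

lemma quiv_orientation: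
  assumes "simple_graph n D" "orientation D Q"
  shows "quiv n Q"
  using assms unfolding simple_graph_def orientation_def by unfold_locales blast

lemma sink_quiv_orientation:
  assumes D: "simple_graph n D" and Q: "orientation D Q" and a: "sink n Q a"
  shows "sink_quiv n Q a"
proof -
  interpret quiv n Q by (rule quiv_orientation[OF D Q])
  show ?thesis
    using a arrow unfolding sink_def by unfold_locales blast+
qed

lemma orientation_reverse:
  assumes D: "simple_graph n D" and Q: "orientation D Q" and a: "sink n Q a"
  shows "orientation D (reverse_at a Q)"
proof -
  interpret sink_quiv n Q a by (rule sink_quiv_orientation[OF D Q a])
  have 1: "(s, t) \<in> Q \<Longrightarrow> linked D s t" and 2: "linked D s t \<Longrightarrow> (s, t) \<in> Q \<longleftrightarrow> (t, s) \<notin> Q" for s t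
    using Q unfolding orientation_def by blast+
  show ?thesis
    unfolding orientation_def reversed_arrow nb_def
    using 1 2 a_sink linked_sym[of D] by blast
qed

lemma dimension_vector_eq: "dimension_vector n M = (\<lambda>j. if j \<in> {1..n} then int (rdim M j) else 0)"
  unfolding dimension_vector_def simple_root_def
  by (rule ext) (subst sum.cong[OF refl, of _ _ "\<lambda>i. if i = j then int (rdim M j) else 0" for j], auto)

lemma dimension_vector_eq_iff:
  "dimension_vector n M = dimension_vector n N \<longleftrightarrow> (\<forall>v\<in>{1..n}. rdim M v = rdim N v)"
  unfolding dimension_vector_eq fun_eq_iff by auto

section \<open>Dimension vectors under reflection\<close>

context sink_quiv
begin

lemma nb_linked:
  assumes "orientation D Q"
  shows "nb = {b. linked D a b}"
  using assms a_sink linked_sym[of D a] unfolding nb_def orientation_def by blast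

lemma coroot_dimension_vector:
  assumes D: "simple_graph n D" and Q: "orientation D Q"
  shows "coroot n D a (dimension_vector n X) = 2 * int (rdim X a) - int (\<Sum>b\<in>nb. rdim X b)"
proof -
  have sub: "nb \<subseteq> {1..n}" using nb_vertex(1) by blast
  have "cartan D a l * dimension_vector n X l =
      (if l = a then 2 * int (rdim X a) else 0) - (if l \<in> nb then int (rdim X l) else 0)" if "l \<in> {1..n}" for l
    using that nb_vertex(2)[of l] by (auto simp: cartan_def nb_linked[OF Q] dimension_vector_eq)
  then have "coroot n D a (dimension_vector n X) =
      (\<Sum>l = 1..n. (if l = a then 2 * int (rdim X a) else 0) - (if l \<in> nb then int (rdim X l) else 0))"
    unfolding coroot_def by (intro sum.cong) auto
  also have "\<dots> = 2 * int (rdim X a) - (\<Sum>l\<in>{1..n} \<inter> nb. int (rdim X l))"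
    using a_vertex by (simp add: sum_subtractf sum.inter_restrict)
  also have "{1..n} \<inter> nb = nb" using sub by blast
  finally show ?thesis by simp
qed

text \<open>By exactness the dimensions at \<open>a\<close> on the two sides add up to the sum over
  the neighbours, and that is the formula of the simple reflection.\<close>

lemma reflected_dimension_vector:
  assumes D: "simple_graph n D" and Q: "orientation D Q" and X: "reflected X X'"
  shows "dimension_vector n X' = simple_reflection n D a (dimension_vector n X)"
proof
  fix j
  show "dimension_vector n X' j = simple_reflection n D a (dimension_vector n X) j"
    unfolding simple_reflection_eq coroot_dimension_vector[OF D Q]
    using reflectedD(6)[OF X, of j] reflected_dim[OF X, symmetric] a_vertex
    by (auto simp: dimension_vector_eq simple_root_def)
qed

lemma simple_at_sink_iff:
  "simple_at_sink M \<longleftrightarrow> rep M \<and> dimension_vector n M = simple_root a"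
  unfolding simple_at_sink_def dimension_vector_eq simple_root_def fun_eq_iff
  using a_vertex by auto

lemma indecomposable_onto:
  assumes "indecomposable n Q X" "dimension_vector n X \<noteq> simple_root a"
  shows "right_invertible (in_map X)"
  using assms indecomposable_not_onto[OF assms(1)] simple_at_sink_iff[of X]
  unfolding simple_at_sink_def indecomposable_def by blast

lemma indecomposable_into:
  assumes "indecomposable n Q' X" "dimension_vector n X \<noteq> simple_root a"
  shows "left_invertible (out_map X)"
proof (rule ccontr)
  assume "\<not> ?thesis"
  from indecomposable_not_into[OF assms(1) this]
  have "dimension_vector n X = simple_root a"
    unfolding dimension_vector_eq simple_root_def fun_eq_iff using a_vertex by auto
  with assms(2) show False by blast
qed

lemma brick_reflect_up:
  assumes D: "simple_graph n D" and Q: "orientation D Q"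
    and M': "R.brick M'" "dimension_vector n M' \<noteq> simple_root a"
  obtains M where "reflected M M'" "brick M"
    "dimension_vector n M = simple_reflection n D a (dimension_vector n M')"
proof -
  obtain M where "refl_exact M M'" "right_invertible (in_map M)"
    by (rule ex_reflect_up[OF R.brick_rep[OF M'(1)]])
  then have M: "reflected M M'"
    unfolding reflected_def using indecomposable_into[OF R.brick_indecomposable[OF M'(1)] M'(2)] by blast
  show thesis
    using that[OF M reflected_brick_up[OF M M'(1)]] reflected_dimension_vector[OF D Q M]
      simple_reflection_involution[OF a_vertex] by simp
qed

lemma indecomposable_reflect_down:
  assumes "indecomposable n Q X" "dimension_vector n X \<noteq> simple_root a"
  obtains X' where "reflected X X'"
proof -
  obtain X' where "refl_exact X X'" "left_invertible (out_map X')"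
    using ex_reflect_down assms(1) unfolding indecomposable_def by blast
  then show thesis using that indecomposable_onto[OF assms] unfolding reflected_def by blast
qed

text \<open>A zero morphism lies in \<open>rad2\<close>. A nonzero one exists only if
  \<open>in_map M\<close> is not onto, so that \<open>M\<close> is itself simple at the sink; then
  the morphism is an invertible scalar and splits.\<close>

lemma no_irreducible_to_simple:
  assumes M: "brick M" and N: "simple_at_sink N"
  shows "\<not> irreducible_morphism n Q M N f"
proof
  assume irr: "irreducible_morphism n Q M N f"
  then have f: "mor M N f" unfolding irreducible_morphism_def by blast
  note MQ = brick_rep[OF M] and N' = simple_at_sinkD[OF N]
  have nz: "\<not> zero_rep n M" "\<not> zero_rep n N"
    using M simple_brick[OF N] unfolding brick_def by auto
  have "\<exists>v\<in>{1..n}. f v \<noteq> 0\<^sub>m (rdim N v) (rdim M v)"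
    using rad2_zero[OF MQ N'(1)] rad2_not_irreducible[OF _ nz] irr by blast
  then have M_simple: "simple_at_sink M"
    using indecomposable_onto[OF brick_indecomposable[OF M]] mor_to_simple_zero[OF MQ _ N f]
      simple_at_sink_iff[of M] MQ by blast
  note M' = simple_at_sinkD[OF M_simple]
  define c where "c = f a $$ (0, 0)"
  have fa: "f a = c \<cdot>\<^sub>m 1\<^sub>m 1"
    unfolding c_def using mat_1_1[of "f a"] mor_carrier[OF f a_vertex] M'(2) N'(2) by simp
  have "c \<noteq> 0"
  proof
    assume "c = 0"
    have "f v = 0\<^sub>m (rdim N v) (rdim M v)" if v: "v \<in> {1..n}" for v
    proof (cases "v = a")
      case True
      then show ?thesis using fa \<open>c = 0\<close> M'(2) N'(2) by (simp add: zero_smult_mat)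
    next
      case False
      then show ?thesis using M'(3)[OF v] mor_dims[OF f v] by (intro mat_eq_no_cols) auto
    qed
    then show False using \<open>\<exists>v\<in>{1..n}. _\<close> by blast
  qed
  define r where "r v = (if v = a then (1 / c) \<cdot>\<^sub>m 1\<^sub>m 1 else 0\<^sub>m (rdim M v) (rdim N v))" for v
  have r: "mor N M r" using M'(2) N'(2) by (intro mor_from_simple N MQ) (auto simp: r_def)
  have "r v * f v = 1\<^sub>m (rdim M v)" if v: "v \<in> {1..n}" for v
  proof (cases "v = a")
    case True
    then show ?thesis using fa \<open>c \<noteq> 0\<close> M'(2)
      by (simp add: r_def smult_mult_dim mult_smult_dim smult_smult_mat one_smult_mat)
  next
    case False
    then show ?thesis using M'(3)[OF v] mor_dims[OF f v] by (intro mat_eq_no_rows) (auto simp: r_def)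
  qed
  then have "split_mono n Q M N f"
    using f r unfolding split_mono_iff by blast
  then show False using irr unfolding irreducible_morphism_def by blast
qed

end

section \<open>The Auslander-Reiten quiver of an adapted word\<close>

lemma left_invertible_of_exact_no_cols:
  assumes "exact_pair A B" "dim_col B = 0"
  shows "left_invertible A"
proof -
  from assms obtain G H where G: "G \<in> carrier_mat (dim_col A) (dim_row A)"
    and H: "H \<in> carrier_mat (dim_col B) (dim_row B)" and d: "dim_col A = dim_row B"
    and eq: "G * A + B * H = 1\<^sub>m (dim_col A)"
    unfolding exact_pair_def by blast
  have "B * H = 0\<^sub>m (dim_col A) (dim_col A)"
    using H d assms(2) by (intro eq_matI) (auto simp: scalar_prod_def)
  then have "G * A = 1\<^sub>m (dim_col A)" using eq G by (simp add: add_zero_dim)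
  then show ?thesis using G unfolding left_invertible_def by blast
qed

text \<open>The invariant of all inductions along the word. A tail of the word no longer expresses
  the longest element, but these four conditions pass from \<open>a # ws\<close> over
  \<open>Q\<close> to \<open>ws\<close> over \<open>reverse_at a Q\<close>.\<close>

definition good_setting :: "nat \<Rightarrow> nat set set \<Rightarrow> quiver \<Rightarrow> nat list \<Rightarrow> bool" where
  "good_setting n D Q ws \<longleftrightarrow> simple_graph n D \<and> orientation D Q \<and> adapted n Q ws \<and> good_word n D ws"

lemma good_setting_quiv: "good_setting n D Q ws \<Longrightarrow> quiv n Q"
  unfolding good_setting_def using quiv_orientation by blast

lemma good_setting_Cons:
  assumes "good_setting n D Q (a # ws)"
  shows "sink_quiv n Q a" "good_setting n D (reverse_at a Q) ws" "simple_graph n D" "orientation D Q"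
    "\<And>p. p < length ws \<Longrightarrow> word_root n D ws p \<noteq> simple_root a"
  using assms sink_quiv_orientation orientation_reverse unfolding good_setting_def by auto

lemma adapted_vertices: "adapted n Q ws \<Longrightarrow> set ws \<subseteq> {1..n}"
  by (induction ws arbitrary: Q) (auto simp: sink_def)

text \<open>The brick of the tail is reflected up; this could fail only for the simple root at
  \<open>a\<close>, which \<open>good_word\<close> excludes. A letter that occurs for the first time
  differs from \<open>a\<close>, so its generator survives the reflection.\<close>

lemma ex_brick:
  assumes "good_setting n D Q ws" "p < length ws"
  shows "\<exists>M e. quiv.brick n Q M \<and> dimension_vector n M = word_root n D ws p \<and>
    (ws ! p \<notin> set (take p ws) \<longrightarrow> quiv.generates n Q (ws ! p) M e)"
  using assms
proof (induction ws arbitrary: Q p)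
  case (Cons a ws)
  note S = good_setting_Cons[OF Cons.prems(1)]
  interpret sink_quiv n Q a by (rule S(1))
  show ?case
  proof (cases p)
    case 0
    obtain M where M: "simple_at_sink M" using ex_simple_at_sink by blast
    then show ?thesis
      using simple_brick[OF M] simple_generates[OF M] 0 unfolding simple_at_sink_iff by auto
  next
    case (Suc p')
    with Cons.prems have p': "p' < length ws" by simp
    from Cons.IH[OF S(2) this] obtain M' e where M': "R.brick M'"
      and dim: "dimension_vector n M' = word_root n D ws p'"
      and gen: "ws ! p' \<notin> set (take p' ws) \<Longrightarrow> R.generates (ws ! p') M' e" by blast
    obtain M where M: "reflected M M'" "brick M"
      "dimension_vector n M = simple_reflection n D a (dimension_vector n M')"
      using brick_reflect_up[OF S(3,4) M'] S(5)[OF p'] dim by metis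
    have "generates (ws ! p') M e" if "ws ! p' \<notin> set (take p ((a # ws)))"
    proof (rule generates_up[OF reflectedD(1)[OF M(1)] gen])
      have "adapted n (reverse_at a Q) ws" using S(2) unfolding good_setting_def by blast
      then show "ws ! p' \<in> {1..n}" using adapted_vertices nth_mem[OF p'] by blast
    qed (use that Suc in auto)
    then show ?thesis using M(2,3) Suc dim by auto
  qed
qed simp

text \<open>Positivity of the roots along the word is read off from their being dimension
  vectors.\<close>

lemma word_root_nonneg:
  assumes "good_setting n D Q ws" "p < length ws"
  shows "0 \<le> word_root n D ws p v"
proof -
  obtain M where "dimension_vector n M = word_root n D ws p" using ex_brick[OF assms] by blast
  from fun_cong[OF this, of v] show ?thesis unfolding dimension_vector_eq by (auto split: if_splits)
qed

text \<open>Only the negative of the simple root is reflected to the simple root.\<close>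

lemma reflection_neq_simple:
  assumes "a \<in> {1..n}" "0 \<le> v a"
  shows "simple_reflection n D a v \<noteq> simple_root a"
proof
  assume eq: "simple_reflection n D a v = simple_root a"
  have "v = simple_reflection n D a (simple_reflection n D a v)"
    using simple_reflection_involution[OF assms(1)] by simp
  then have "v a = -1" unfolding eq simple_reflection_simple[OF assms(1)] by (simp add: simple_root_def)
  then show False using assms(2) by simp
qed

lemma word_root_Suc_neq_simple:
  assumes "good_setting n D Q (a # ws)" "p < length ws"
  shows "word_root n D (a # ws) (Suc p) \<noteq> simple_root a"
  unfolding word_root_Cons
  by (rule reflection_neq_simple[OF sink_quiv.a_vertex[OF good_setting_Cons(1)[OF assms(1)]]
      word_root_nonneg[OF good_setting_Cons(2)[OF assms(1)] assms(2)]])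

text \<open>Removing the common letters in front reduces the claim to \<open>p = 0\<close>, where
  one of the roots is the simple root at the head.\<close>

lemma word_root_distinct:
  assumes "good_setting n D Q ws" "p < k" "k < length ws"
  shows "word_root n D ws p \<noteq> word_root n D ws k"
  using assms
proof (induction ws arbitrary: Q p k)
  case (Cons a ws)
  note S = good_setting_Cons[OF Cons.prems(1)]
  obtain k' where k: "k = Suc k'" using Cons.prems(2) by (cases k) auto
  show ?case
  proof (cases p)
    case 0
    then show ?thesis using word_root_Suc_neq_simple[OF Cons.prems(1), of k'] Cons.prems(3) k by simp
  next
    case (Suc p')
    then have "word_root n D ws p' \<noteq> word_root n D ws k'" using Cons.IH[OF S(2)] Cons.prems(2,3) k by simp
    then show ?thesis
      using simple_reflection_involution[OF sink_quiv.a_vertex[OF S(1)]] Suc k by (metis word_root_Cons(2))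
  qed
qed simp

text \<open>Both representations are reflected down until they become simple at the sink, and the
  isomorphism is carried back. It is stated for indecomposables, not bricks, because
  \<open>root_class\<close> ranges over all indecomposable classes.\<close>

lemma indecomposable_unique:
  assumes "good_setting n D Q ws" "p < length ws"
    "indecomposable n Q X" "dimension_vector n X = word_root n D ws p"
    "indecomposable n Q Y" "dimension_vector n Y = word_root n D ws p"
  shows "isomorphic n Q X Y"
  using assms
proof (induction ws arbitrary: Q p X Y)
  case (Cons a ws)
  note S = good_setting_Cons[OF Cons.prems(1)]
  interpret sink_quiv n Q a by (rule S(1))
  show ?case
  proof (cases p)
    case 0
    then have "simple_at_sink X" "simple_at_sink Y"
      using Cons.prems unfolding simple_at_sink_iff indecomposable_def by auto
    then show ?thesis by (rule simple_isomorphic)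
  next
    case (Suc p')
    then have p': "p' < length ws" using Cons.prems(2) by simp
    have neq: "dimension_vector n X \<noteq> simple_root a" "dimension_vector n Y \<noteq> simple_root a"
      using word_root_Suc_neq_simple[OF Cons.prems(1) p'] Cons.prems(4,6) Suc by simp_all
    obtain X' where X': "reflected X X'" by (rule indecomposable_reflect_down[OF Cons.prems(3) neq(1)])
    obtain Y' where Y': "reflected Y Y'" by (rule indecomposable_reflect_down[OF Cons.prems(5) neq(2)])
    have "dimension_vector n X' = word_root n D ws p'" "dimension_vector n Y' = word_root n D ws p'"
      using reflected_dimension_vector[OF S(3,4) X'] reflected_dimension_vector[OF S(3,4) Y']
        Cons.prems(4,6) Suc simple_reflection_involution[OF a_vertex] by simp_all
    then have "isomorphic n (reverse_at a Q) X' Y'"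
      using Cons.IH[OF S(2) p'] reflected_indecomposable[OF X' Cons.prems(3)]
        reflected_indecomposable[OF Y' Cons.prems(5)] by blast
    then show ?thesis by (rule reflected_isomorphic[OF X' Y'])
  qed
qed simp

text \<open>Works with chosen bricks instead of isomorphism classes, so that it can be moved through
  reflections; the passage to \<open>ar_arrows\<close> is made once, in
  \<open>ar_arrow_word_roots\<close>.\<close>

definition arrow_between :: "nat \<Rightarrow> quiver \<Rightarrow> lattice \<Rightarrow> lattice \<Rightarrow> bool" where
  "arrow_between n Q \<alpha> \<beta> \<longleftrightarrow> (\<exists>M N f. quiv.brick n Q M \<and> quiv.brick n Q N \<and>
     dimension_vector n M = \<alpha> \<and> dimension_vector n N = \<beta> \<and> irreducible_morphism n Q M N f)"

section \<open>Arrows under reflection, and arrows from the simple representation at the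
  sink\<close>

context sink_quiv
begin

lemma brick_reflect_down:
  assumes D: "simple_graph n D" and Q: "orientation D Q"
    and M: "brick M" "dimension_vector n M = simple_reflection n D a \<alpha>"
    "simple_reflection n D a \<alpha> \<noteq> simple_root a"
  obtains M' where "reflected M M'" "R.brick M'" "dimension_vector n M' = \<alpha>"
proof -
  obtain M' where M': "reflected M M'"
    using indecomposable_reflect_down[OF brick_indecomposable[OF M(1)]] M(2,3) by metis
  show thesis
    using that[OF M' reflected_brick[OF M' M(1)]] reflected_dimension_vector[OF D Q M']
      simple_reflection_involution[OF a_vertex] M(2) by simp
qed

text \<open>For each of the two roots, the first inequality allows reflecting up from
  \<open>Q'\<close> and the second reflecting down from \<open>Q\<close>.\<close>

lemma arrow_between_reflect:
  assumes D: "simple_graph n D" and Q: "orientation D Q"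
    and \<alpha>: "\<alpha> \<noteq> simple_root a" "simple_reflection n D a \<alpha> \<noteq> simple_root a"
    and \<beta>: "\<beta> \<noteq> simple_root a" "simple_reflection n D a \<beta> \<noteq> simple_root a"
  shows "arrow_between n Q (simple_reflection n D a \<alpha>) (simple_reflection n D a \<beta>) \<longleftrightarrow>
    arrow_between n Q' \<alpha> \<beta>"
proof
  assume "arrow_between n Q (simple_reflection n D a \<alpha>) (simple_reflection n D a \<beta>)"
  then obtain M N f where M: "brick M" "dimension_vector n M = simple_reflection n D a \<alpha>"
    and N: "brick N" "dimension_vector n N = simple_reflection n D a \<beta>"
    and f: "irreducible_morphism n Q M N f"
    unfolding arrow_between_def by blast
  obtain M' where M': "reflected M M'" "R.brick M'" "dimension_vector n M' = \<alpha>"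
    by (rule brick_reflect_down[OF D Q M \<alpha>(2)])
  obtain N' where N': "reflected N N'" "R.brick N'" "dimension_vector n N' = \<beta>"
    by (rule brick_reflect_down[OF D Q N \<beta>(2)])
  show "arrow_between n Q' \<alpha> \<beta>"
    unfolding arrow_between_def using M' N' f reflected_irreducible[OF M'(1) N'(1)] by blast
next
  assume "arrow_between n Q' \<alpha> \<beta>"
  then obtain M' N' f where M': "R.brick M'" "dimension_vector n M' = \<alpha>"
    and N': "R.brick N'" "dimension_vector n N' = \<beta>" and f: "irreducible_morphism n Q' M' N' f"
    unfolding arrow_between_def by blast
  obtain M where M: "reflected M M'" "brick M" "dimension_vector n M = simple_reflection n D a (dimension_vector n M')"
    using brick_reflect_up[OF D Q M'(1)] M'(2) \<alpha>(1) by blast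
  obtain N where N: "reflected N N'" "brick N" "dimension_vector n N = simple_reflection n D a (dimension_vector n N')"
    using brick_reflect_up[OF D Q N'(1)] N'(2) \<beta>(1) by blast
  show "arrow_between n Q (simple_reflection n D a \<alpha>) (simple_reflection n D a \<beta>)"
    unfolding arrow_between_def
    using M N M'(2) N'(2) f reflected_irreducible[OF M(1) N(1)] by blast
qed

lemma no_arrow_to_simple: "\<not> arrow_between n Q \<alpha> (simple_root a)"
  unfolding arrow_between_def
  using no_irreducible_to_simple simple_at_sink_iff brick_rep by blast

text \<open>The targets of the arrows starting at the simple projective \<open>[\<alpha>\<^sub>a]\<close> are the projective covers
  of the simples at the neighbours of \<open>a\<close>, and these are given by the first occurrences of the
  neighbours in the word.\<close>

lemma arrow_from_simple:
  assumes setting: "good_setting n D Q (a # ws)" and k: "k < length ws"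
  shows "arrow_between n Q (simple_root a) (word_root n D (a # ws) (Suc k)) \<longleftrightarrow>
    linked D a (ws ! k) \<and> a \<notin> set (take k ws)" (is "_ \<longleftrightarrow> ?cond")
proof
  note S = good_setting_Cons[OF setting]
  have ad: "adapted n Q' ws" using S(2) unfolding good_setting_def by blast
  have nbQ': "b \<in> nb \<Longrightarrow> (a, b) \<in> Q'" for b by (simp add: reversed_arrow)
  {
    assume "arrow_between n Q (simple_root a) (word_root n D (a # ws) (Suc k))"
    then obtain M N f where M: "brick M" "dimension_vector n M = simple_root a"
      and N: "brick N" "dimension_vector n N = word_root n D (a # ws) (Suc k)"
      and irr: "irreducible_morphism n Q M N f"
      unfolding arrow_between_def by blast
    have f: "mor M N f" using irr unfolding irreducible_morphism_def by blast
    have M_simple: "simple_at_sink M" using M brick_rep[OF M(1)] unfolding simple_at_sink_iff by blast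
    have N_onto: "right_invertible (in_map N)"
      using indecomposable_onto[OF brick_indecomposable[OF N(1)]] N(2)
        word_root_Suc_neq_simple[OF setting k] by simp
    show ?cond
    proof (rule ccontr)
      assume no: "\<not> ?cond"
      have "rad2 M N f"
      proof (rule rad2_from_simple[OF M_simple N(1) N_onto f])
        fix b assume b: "b \<in> nb" and nz: "rdim N b \<noteq> 0"
        note bv = nb_vertex[OF b]
        \<comment> \<open>The reflection at \<open>a\<close> leaves the coordinate at
          \<open>b\<close> unchanged, so the nonzero space of \<open>N\<close> at \<open>b\<close>
          means that the letter \<open>b\<close> has been used up to position
          \<open>k\<close>.\<close>
        have "word_root n D ws k b \<noteq> 0"
          using N(2) nz bv unfolding dimension_vector_eq fun_eq_iff
          by (auto simp: simple_reflection_eq simple_root_def dest!: spec[of _ b])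
        then have occ: "b \<in> set (take (Suc k) ws)"
          using word_root_coordinate[of b k ws n D] k by (auto simp: take_Suc_conv_app_nth split: if_splits)
        then have ex: "\<exists>p. p \<le> k \<and> ws ! p = b"
          using k by (auto simp: in_set_conv_nth less_Suc_eq_le)
        define p where "p = (LEAST p. p \<le> k \<and> ws ! p = b)"
        have p: "p \<le> k" "ws ! p = b" using LeastI_ex[OF ex] unfolding p_def by auto
        have first: "b \<notin> set (take p ws)"
        proof
          assume "b \<in> set (take p ws)"
          then obtain q where "q < p" "ws ! q = b" using p k by (auto simp: in_set_conv_nth)
          then show False using not_less_Least[of q "\<lambda>p. p \<le> k \<and> ws ! p = b"] p unfolding p_def by auto
        qed
        \<comment> \<open>If \<open>b\<close> occurred first at \<open>k\<close>, then
          \<open>a\<close>, which has to wait for \<open>b\<close> after its own use, could not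
          occur before \<open>k\<close> either, and the condition would hold.\<close>
        have "p \<noteq> k"
        proof
          assume "p = k"
          have "a \<notin> set (take k ws)"
          proof
            assume "a \<in> set (take k ws)"
            then obtain q where q: "q < k" "ws ! q = a" using k by (auto simp: in_set_conv_nth)
            then have "b \<in> set (take q ws)"
              using arrow_source_waits[OF ad nbQ'[OF b]] bv k by auto
            moreover have "set (take q ws) \<subseteq> set (take k ws)" using q(1) by (simp add: set_take_subset_set_take)
            ultimately show False using first \<open>p = k\<close> by blast
          qed
          moreover have "linked D a (ws ! k)" using b p \<open>p = k\<close> nb_linked[OF S(4)] by simp
          ultimately show False using no by blast
        qed
        with p k have pk: "p < k" "p < length ws" by auto
        obtain P' e where P': "R.brick P'" "dimension_vector n P' = word_root n D ws p"
          "R.generates b P' e"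
          using ex_brick[OF S(2) pk(2)] p(2) first by auto
        obtain P where P: "reflected P P'" "brick P"
          "dimension_vector n P = simple_reflection n D a (dimension_vector n P')"
          using brick_reflect_up[OF S(3,4) P'(1)] P'(2) S(5)[OF pk(2)] by metis
        \<comment> \<open>Different positions carry different roots, which separates the brick at
          the first occurrence of \<open>b\<close> from \<open>N\<close>.\<close>
        have "dimension_vector n P \<noteq> dimension_vector n N"
          using word_root_distinct[OF setting, of "Suc p" "Suc k"] pk k P(3) P'(2) N(2) by simp
        then have "\<not> isomorphic n Q P N"
          using isomorphic_rdim unfolding dimension_vector_eq_iff by blast
        then show "\<exists>P e. brick P \<and> generates b P e \<and> right_invertible (in_map P) \<and> \<not> isomorphic n Q P N"
          using P(2) generates_up[OF reflectedD(1)[OF P(1)] P'(3) bv] reflectedD(4)[OF P(1)] by blast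
      qed
      then show False
        using rad2_not_irreducible irr M(1) N(1) unfolding brick_def by blast
    qed
  next
    assume cond: ?cond
    let ?b = "ws ! k"
    have b: "?b \<in> nb" using cond nb_linked[OF S(4)] by simp
    note bv = nb_vertex[OF b]
    have first: "?b \<notin> set (take k ws)"
      using arrow_target_first[OF ad nbQ'[OF b] _ k] bv cond by auto
    obtain P' e where P': "R.brick P'" "dimension_vector n P' = word_root n D ws k" "R.generates ?b P' e"
      using ex_brick[OF S(2) k] first by auto
    obtain P where P: "reflected P P'" "brick P"
      "dimension_vector n P = simple_reflection n D a (dimension_vector n P')"
      using brick_reflect_up[OF S(3,4) P'(1)] P'(2) S(5)[OF k] by metis
    note PD = reflectedD[OF P(1)]
    \<comment> \<open>Neither the letter at \<open>k\<close> nor \<open>a\<close> occurs earlier in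
      \<open>ws\<close>, so both coordinates are known. The zero space of \<open>P'\<close> at
      \<open>a\<close> makes \<open>in_map P\<close> injective by exactness.\<close>
    have "rdim P' ?b = 1" "rdim P' a = 0"
      using fun_cong[OF P'(2), of ?b] fun_cong[OF P'(2), of a] bv a_vertex cond first
        word_root_coordinate[of ?b k ws n D] word_root_coordinate[of a k ws n D]
      unfolding dimension_vector_eq by auto
    moreover from this have "left_invertible (in_map P)"
      using PD(1) unfolding refl_exact_def
      by (intro left_invertible_of_exact_no_cols[of _ "out_map P'"]) auto
    ultimately have "rdim P ?b = 1" "left_invertible (in_map P)" using PD(6)[OF bv] by auto
    moreover obtain M where M: "simple_at_sink M" using ex_simple_at_sink by blast
    ultimately obtain f where "irreducible_morphism n Q M P f"
      using irreducible_from_simple[OF M b P(2) generates_up[OF PD(1) P'(3) bv] _ PD(4)] by blast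
    then show "arrow_between n Q (simple_root a) (word_root n D (a # ws) (Suc k))"
      unfolding arrow_between_def
      using simple_brick[OF M] P(2,3) P'(2) M unfolding simple_at_sink_iff by auto
  }
qed

end

lemma all_between_Suc:
  "(\<forall>p. Suc j < p \<and> p < Suc k \<longrightarrow> P p) \<longleftrightarrow> (\<forall>p. j < p \<and> p < k \<longrightarrow> P (Suc p))"
proof (intro iffI allI impI)
  fix p assume "\<forall>p. j < p \<and> p < k \<longrightarrow> P (Suc p)" "Suc j < p \<and> p < Suc k"
  then show "P p" by (cases p) auto
qed auto

text \<open>For \<open>k = 0\<close> there is no arrow into the simple at the sink, and for
  \<open>j = 0\<close> the arrows out of it are known. In the remaining case the head is removed by
  a reflection and all positions shift by one.\<close>

lemma arrow_between_word_roots: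
  assumes "good_setting n D Q ws" "j < length ws" "k < length ws"
  shows "arrow_between n Q (word_root n D ws j) (word_root n D ws k) \<longleftrightarrow>
    linked D (ws ! j) (ws ! k) \<and> j < k \<and> (\<forall>p. j < p \<and> p < k \<longrightarrow> ws ! p \<noteq> ws ! j)"
  using assms
proof (induction ws arbitrary: Q j k)
  case (Cons a ws)
  note S = good_setting_Cons[OF Cons.prems(1)]
  interpret sink_quiv n Q a by (rule S(1))
  show ?case
  proof (cases k)
    case 0
    then show ?thesis using no_arrow_to_simple by simp
  next
    case (Suc k')
    then have k': "k' < length ws" using Cons.prems(3) by simp
    show ?thesis
    proof (cases j)
      case 0
      have "(\<forall>p. 0 < p \<and> p < Suc k' \<longrightarrow> (a # ws) ! p \<noteq> a) \<longleftrightarrow> a \<notin> set (take k' ws)"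
        using k' by (auto simp: in_set_conv_nth gr0_conv_Suc)
      then show ?thesis using arrow_from_simple[OF Cons.prems(1) k'] 0 Suc by simp
    next
      case j: (Suc j')
      then have j': "j' < length ws" using Cons.prems(2) by simp
      have "(\<forall>p. Suc j' < p \<and> p < Suc k' \<longrightarrow> (a # ws) ! p \<noteq> ws ! j') \<longleftrightarrow>
        (\<forall>p. j' < p \<and> p < k' \<longrightarrow> ws ! p \<noteq> ws ! j')"
        by (simp add: all_between_Suc)
      moreover have "arrow_between n Q (word_root n D (a # ws) (Suc j')) (word_root n D (a # ws) (Suc k')) \<longleftrightarrow>
        arrow_between n (reverse_at a Q) (word_root n D ws j') (word_root n D ws k')"
        using word_root_Suc_neq_simple[OF Cons.prems(1)] j' k' S(5)
        by (simp add: arrow_between_reflect[OF S(3,4)])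
      ultimately show ?thesis using Cons.IH[OF S(2) j' k'] Suc j by simp
    qed
  qed
qed simp

text \<open>Resolves the definite description: the brick provides a class, and
  \<open>indecomposable_unique\<close> shows that it is the only one.\<close>

lemma root_class_brick:
  assumes setting: "good_setting n D Q ws" and p: "p < length ws"
    and M: "quiv.brick n Q M" "dimension_vector n M = word_root n D ws p"
  shows "root_class n Q (word_root n D ws p) = iso_class n Q M"
proof -
  interpret quiv n Q by (rule good_setting_quiv[OF setting])
  note MQ = brick_rep[OF M(1)] and Mi = brick_indecomposable[OF M(1)]
  show ?thesis
    unfolding root_class_def
  proof (rule the_equality)
    have "dimension_vector n N = word_root n D ws p" if "N \<in> iso_class n Q M" for N
      using that isomorphic_rdim M(2) dimension_vector_eq_iff[of n M N] unfolding iso_class_def by simp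
    then show "iso_class n Q M \<in> ar_vertices n Q \<and>
        (\<forall>N\<in>iso_class n Q M. dimension_vector n N = word_root n D ws p)"
      using Mi unfolding ar_vertices_def by blast
  next
    fix X assume X: "X \<in> ar_vertices n Q \<and> (\<forall>N\<in>X. dimension_vector n N = word_root n D ws p)"
    then obtain L where L: "indecomposable n Q L" "X = iso_class n Q L"
      unfolding ar_vertices_def by blast
    have LQ: "rep L" using L(1) unfolding indecomposable_def by blast
    have "L \<in> X" using LQ isomorphic_refl[OF LQ] L(2) unfolding iso_class_def by blast
    then have "isomorphic n Q L M"
      using indecomposable_unique[OF setting p L(1) _ Mi M(2)] X by blast
    then show "X = iso_class n Q M"
      unfolding L(2) iso_class_def
      using isomorphic_trans[OF LQ MQ] isomorphic_trans[OF MQ LQ] isomorphic_sym by blast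
  qed
qed

text \<open>An arrow may be witnessed by any members of the two classes; these are again bricks with
  the same dimension vectors.\<close>

lemma ar_arrow_word_roots:
  assumes setting: "good_setting n D Q ws" and j: "j < length ws" and k: "k < length ws"
  shows "(root_class n Q (word_root n D ws j), root_class n Q (word_root n D ws k)) \<in> ar_arrows n Q \<longleftrightarrow>
    arrow_between n Q (word_root n D ws j) (word_root n D ws k)"
proof -
  interpret quiv n Q by (rule good_setting_quiv[OF setting])
  have vertex: "iso_class n Q M \<in> ar_vertices n Q" if "brick M" for M
    using brick_indecomposable[OF that] unfolding ar_vertices_def by blast
  show ?thesis
  proof
    obtain M where M: "brick M" "dimension_vector n M = word_root n D ws j"
      using ex_brick[OF setting j] by blast
    obtain N where N: "brick N" "dimension_vector n N = word_root n D ws k"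
      using ex_brick[OF setting k] by blast
    have member: "brick L' \<and> dimension_vector n L' = dimension_vector n L"
      if "brick L" "L' \<in> iso_class n Q L" for L L'
      using that brick_isomorphic isomorphic_rdim dimension_vector_eq_iff[of n L L']
      unfolding iso_class_def by auto
    assume "(root_class n Q (word_root n D ws j), root_class n Q (word_root n D ws k)) \<in> ar_arrows n Q"
    then obtain M' N' f where "M' \<in> iso_class n Q M" "N' \<in> iso_class n Q N" "irreducible_morphism n Q M' N' f"
      unfolding ar_arrows_def root_class_brick[OF setting j M] root_class_brick[OF setting k N] by blast
    then show "arrow_between n Q (word_root n D ws j) (word_root n D ws k)"
      unfolding arrow_between_def using member M N by metis
  next
    assume "arrow_between n Q (word_root n D ws j) (word_root n D ws k)"
    then obtain M N f where M: "brick M" "dimension_vector n M = word_root n D ws j"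
      and N: "brick N" "dimension_vector n N = word_root n D ws k" and f: "irreducible_morphism n Q M N f"
      unfolding arrow_between_def by blast
    have "M \<in> iso_class n Q M" "N \<in> iso_class n Q N"
      using isomorphic_refl brick_rep[OF M(1)] brick_rep[OF N(1)] unfolding iso_class_def by auto
    then show "(root_class n Q (word_root n D ws j), root_class n Q (word_root n D ws k)) \<in> ar_arrows n Q"
      unfolding ar_arrows_def root_class_brick[OF setting j M] root_class_brick[OF setting k N]
      using vertex M(1) N(1) f by blast
  qed
qed

theorem proposition1p2:
  fixes n N j k :: nat and D :: "nat set set" and Q :: quiver
    and i :: "nat \<Rightarrow> nat" and w0 :: "lattice \<Rightarrow> lattice" and \<alpha> \<beta> :: lattice
  assumes "ade_diagram n D"
    and "orientation D Q"
    and "N = card (positive_roots n D)"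
    and "longest_element n D w0"
    and "reduced_expression n D (map i [1..<N + 1]) w0"
    and "adapted n Q (map i [1..<N + 1])"
    and "1 \<le> j" "j \<le> N" "1 \<le> k" "k \<le> N"
    and "\<alpha> = word_product n D (map i [1..<j]) (simple_root (i j))"
    and "\<beta> = word_product n D (map i [1..<k]) (simple_root (i k))"
  shows "(root_class n Q \<alpha>, root_class n Q \<beta>) \<in> ar_arrows n Q \<longleftrightarrow>
           linked D (i j) (i k) \<and> j < k \<and> (\<forall>p. j < p \<and> p < k \<longrightarrow> i p \<noteq> i j)"
proof -
  define ws where "ws = map i [1..<N + 1]"
  have setting: "good_setting n D Q ws"
    unfolding good_setting_def ws_def
    using ade_simple_graph[OF assms(1)] assms(2,6) reduced_good_word[OF assms(5)] by blast
  \<comment> \<open>List positions start at 0, the letters of the expression at 1; every index is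
    shifted by one from here on.\<close>
  have nth: "ws ! (m - 1) = i m" if "1 \<le> m" "m \<le> N" for m
    using that by (simp add: ws_def nth_append del: upt_Suc)
  have root: "word_root n D ws (m - 1) = word_product n D (map i [1..<m]) (simple_root (i m))"
    if m: "1 \<le> m" "m \<le> N" for m
  proof -
    have "take (m - 1) ws = map i [1..<m]"
      using m by (simp add: ws_def take_map del: upt_Suc)
    then show ?thesis unfolding word_root_def nth[OF m] by simp
  qed
  have len: "j - 1 < length ws" "k - 1 < length ws"
    using assms(7-10) by (auto simp: ws_def)
  \<comment> \<open>The bound variable is shifted as well; \<open>1 \<le> j\<close> keeps the
    truncated subtraction exact.\<close>
  have "(\<forall>p. j - 1 < p \<and> p < k - 1 \<longrightarrow> ws ! p \<noteq> i j) \<longleftrightarrow> (\<forall>p. j < p \<and> p < k \<longrightarrow> i p \<noteq> i j)"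
  proof
    assume *: "\<forall>p. j - 1 < p \<and> p < k - 1 \<longrightarrow> ws ! p \<noteq> i j"
    show "\<forall>p. j < p \<and> p < k \<longrightarrow> i p \<noteq> i j"
    proof (intro allI impI)
      fix p assume p: "j < p \<and> p < k"
      then have "j - 1 < p - 1" "p - 1 < k - 1" using assms(7) by linarith+
      then have "ws ! (p - 1) \<noteq> i j" using * by blast
      then show "i p \<noteq> i j" using nth[of p] p assms(10) by simp
    qed
  next
    assume *: "\<forall>p. j < p \<and> p < k \<longrightarrow> i p \<noteq> i j"
    show "\<forall>p. j - 1 < p \<and> p < k - 1 \<longrightarrow> ws ! p \<noteq> i j"
    proof (intro allI impI)
      fix p assume p: "j - 1 < p \<and> p < k - 1"
      then have "j < Suc p" "Suc p < k" by linarith+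
      then have "i (Suc p) \<noteq> i j" using * by blast
      then show "ws ! p \<noteq> i j" using nth[of "Suc p"] \<open>Suc p < k\<close> assms(10) by simp
    qed
  qed
  moreover have "j - 1 < k - 1 \<longleftrightarrow> j < k" using assms(7,9) by auto
  ultimately show ?thesis
    unfolding assms(11,12) root[OF assms(7,8), symmetric] root[OF assms(9,10), symmetric]
      ar_arrow_word_roots[OF setting len] arrow_between_word_roots[OF setting len]
      nth[OF assms(7,8)] nth[OF assms(9,10)] by blast
qed

end
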